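(* Let $X=(X(t))_{t\ge0}$, $X(0)=0$, be a real-valued Lévy process with Gaussian coefficient $\sigma>0$, arbitrary drift $\gamma\in\mathbb R$, and Lévy measure $\rho$, i.e. $E e^{isX(t)}=e^{t\psi(s)}$ with $$\psi(s)=i\gamma s-\frac{\sigma^2s^2}{2}+\int_{-\infty}^{\infty}\big(e^{isx}-1-isx\mathbf 1(|x|\le1)\big)\rho(dx).$$ Assume $\rho((0,\infty))>0$, $\rho((-\infty,0))<\infty$, and that for some $a>0$ with $\rho((a,\infty))>0$ the probability measure $\mu_a(\cdot)=\rho(\cdot\cap(a,\infty))/\rho((a,\infty))$ has a light right tail. Then $$\lim_{u\to\infty}\frac{P\big(\sup_{0\le t\le1}X(t)>u\big)}{P(X(1)>u)}=1 .$$
   Context: A Lévy measure $\rho$ is a Borel measure on $\mathbb R$ with $\int\min\{1,x^2\}\rho(dx)<\infty$. A random variable $X$ (or its distribution) has a light right tail if either (i) $P(X>u)>0$ for all $u>0$ and $\lim_{u\to\infty}P(X_1>u)/P(X_1+X_2>u)=0$, where $X_1,X_2$ are independent copies of $X$; or (ii) there are constants $A>0,\alpha>0$ with $X\le A$ a.s. and $P(X>\alpha)>0$. *)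

theory Defs
  imports "HOL-Probability.Probability"
begin

definition levy_measure :: "real measure \<Rightarrow> bool" where
  "levy_measure \<rho> \<longleftrightarrow> sets \<rho> = sets borel \<and>
     (\<integral>\<^sup>+ x. ennreal (min 1 (x\<^sup>2)) \<partial>\<rho>) < \<infinity>"

definition levy_exponent :: "real \<Rightarrow> real \<Rightarrow> real measure \<Rightarrow> real \<Rightarrow> complex" where
  "levy_exponent \<gamma> \<sigma> \<rho> s =
     \<i> * complex_of_real (\<gamma> * s) - complex_of_real (\<sigma>\<^sup>2 * s\<^sup>2 / 2)
     + (CLINT x|\<rho>. iexp (s * x) - 1 - \<i> * complex_of_real (s * x * indicator {-1..1} x))"

definition cadlag_on_nonneg :: "(real \<Rightarrow> real) \<Rightarrow> bool" where
  "cadlag_on_nonneg f \<longleftrightarrow> (\<forall>t\<ge>0. (f \<longlongrightarrow> f t) (at_right t) \<and>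
      (t > 0 \<longrightarrow> (\<exists>l. (f \<longlongrightarrow> l) (at_left t))))"

definition levy_process ::
  "'a measure \<Rightarrow> (real \<Rightarrow> 'a \<Rightarrow> real) \<Rightarrow> real \<Rightarrow> real \<Rightarrow> real measure \<Rightarrow> bool" where
  "levy_process M X \<gamma> \<sigma> \<rho> \<longleftrightarrow>
     prob_space M \<and> levy_measure \<rho> \<and>
     (\<forall>t\<ge>0. X t \<in> borel_measurable M) \<and>
     (\<forall>\<omega>\<in>space M. X 0 \<omega> = 0) \<and>
     (\<forall>\<omega>\<in>space M. cadlag_on_nonneg (\<lambda>t. X t \<omega>)) \<and>
     (\<forall>\<tau>::nat \<Rightarrow> real. 0 \<le> \<tau> 0 \<and> incseq \<tau> \<longrightarrow>
        prob_space.indep_vars M (\<lambda>_. borel) (\<lambda>i \<omega>. X (\<tau> (Suc i)) \<omega> - X (\<tau> i) \<omega>) UNIV) \<and>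
     (\<forall>s t. 0 \<le> s \<and> s \<le> t \<longrightarrow>
        distr M borel (\<lambda>\<omega>. X t \<omega> - X s \<omega>) = distr M borel (X (t - s))) \<and>
     (\<forall>t\<ge>0. \<forall>s. char (distr M borel (X t)) s = exp (complex_of_real t * levy_exponent \<gamma> \<sigma> \<rho> s))"

text \<open>Light right tail of a (probability) distribution mu on the reals.
  The law of X1+X2 for independent copies is the convolution mu * mu.\<close>
definition light_right_tail :: "real measure \<Rightarrow> bool" where
  "light_right_tail \<mu> \<longleftrightarrow>
     ((\<forall>u>0. measure \<mu> {u<..} > 0) \<and>
      ((\<lambda>u. measure \<mu> {u<..} / measure (\<mu> \<star> \<mu>) {u<..}) \<longlongrightarrow> 0) at_top)
   \<or> (\<exists>A>0. \<exists>\<alpha>>0. (AE x in \<mu>. x \<le> A) \<and> measure \<mu> {\<alpha><..} > 0)"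

definition levy_tail_measure :: "real measure \<Rightarrow> real \<Rightarrow> real measure" where
  "levy_tail_measure \<rho> a =
     density \<rho> (\<lambda>x. indicator {a<..} x / emeasure \<rho> {a<..})"

end

theory Submission
  imports Defs "HOL-Real_Asymp.Real_Asymp"
begin

text \<open>Split the law of \<open>X(t)\<close> as \<open>\<nu>\<^sub>t\<close> convolved with a compound Poisson law
  collecting the jumps above \<open>a\<close>; \<open>\<nu>\<^sub>t\<close> keeps the Gaussian part, the negative
  jumps and the compensated jumps in \<open>(0, a]\<close>. Write \<open>Y\<close> for the process with laws
  \<open>\<nu>\<^sub>t\<close> and \<open>S\<^sub>n\<close> for the sum of \<open>n\<close> big jumps. The light tail
  makes the event \<open>X(1) > u\<close> with a bounded number of big jumps negligible, so the number
  \<open>n\<close> of big jumps is large. As big jumps are positive, the maximum of \<open>X\<close> up to time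
  \<open>1 - \<delta>\<close> is at most \<open>S\<^sub>j\<close> plus the maximum of \<open>Y\<close>, where
  \<open>j\<close> is the number of big jumps before \<open>1 - \<delta>\<close>, while after \<open>1 -
  \<delta>\<close> it is at most \<open>S\<^sub>n\<close> plus the maximum of \<open>Y\<close> there. For
  \<open>\<delta> = n powr (-1/2)\<close> the first bound is compared by Ottaviani's inequality with the event for
  \<open>n - 1\<close> or \<open>n + k\<close> jumps (a constant shift of the level is made up by \<open>k\<close>
  extra jumps), at a price polynomial in \<open>n\<close>, which is beaten because it is very unlikely that fewer than
  \<open>k + 1\<close> jumps fall in a time interval of length \<open>\<delta>\<close>. In the second bound
  \<open>Y\<close> drops by at most an \<open>\<epsilon>\<close> of order \<open>n powr (-1/8)\<close> with high
  probability, and passing from the level \<open>u - \<epsilon>\<close> to \<open>u\<close> costs a factor tending to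
  \<open>1\<close>, because Gaussian smoothing makes the tail log-convex up to a quadratic term and a constant shift
  costs only a factor polynomial in \<open>n\<close>. All of this is done on a time grid, where only the laws of the
  increments matter, so no decomposition of the paths is needed.\<close>

section \<open>Convolution powers and compound Poisson laws\<close>

text \<open>The split of the Levy exponent serves two needs. \<open>Y\<close> has no upward jump
  above \<open>a\<close>, so its right tail has exponential moments of every order; its downward
  jumps have finite total rate \<open>\<kappa>\<close>, so with probability at least
  \<open>exp (- \<kappa> * \<delta>)\<close> none occurs in a window of length
  \<open>\<delta>\<close>. The obstacle is the last window: after giving up
  \<open>\<epsilon>\<close> in the level, tails for the same number of jumps must stay comparable up
  to a factor near 1. Extra jumps only repair a full shift by \<open>C\<close>, and they cost the
  ratio \<open>q n / q (n + k)\<close> of Poisson weights, which is polynomial in \<open>n\<close>.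
  The Gaussian factor allows interpolation: a shift by \<open>\<theta> * C\<close> costs only the
  power \<open>\<theta>\<close> of that ratio. The exponents fit together because in a window of
  length \<open>n powr (-1/2)\<close> the motion of \<open>Y\<close> is of order
  \<open>n powr (-1/4)\<close>, far less than \<open>\<theta> = n powr (-1/8)\<close>, while
  \<open>\<theta>\<close> times \<open>ln n\<close> still vanishes; and about \<open>sqrt n\<close>
  of the \<open>n\<close> jumps are expected in the window, so that finding at most \<open>k\<close>
  there has probability near \<open>exp (- sqrt n)\<close>.\<close>

lemma real_distributionI: "prob_space M \<Longrightarrow> sets M = sets borel \<Longrightarrow> real_distribution M"
  by (simp add: real_distribution_def real_distribution_axioms_def)

lemma real_distribution_return: "real_distribution (return borel (x::real))"
  by (intro real_distributionI prob_space_return) auto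

lemma real_distribution_finite: "real_distribution M \<Longrightarrow> finite_measure M"
  unfolding real_distribution_def using prob_space.finite_measure by blast

lemma real_distribution_sets: "real_distribution M \<Longrightarrow> sets M = sets borel"
  using real_distribution.events_eq_borel by blast

lemma real_distribution_conv:
  assumes "real_distribution M" "real_distribution N"
  shows "real_distribution (M \<star> N)"
proof -
  interpret M: real_distribution M by fact
  interpret N: real_distribution N by fact
  interpret pair_prob_space M N ..
  show ?thesis
    unfolding convolution_def
    by (intro real_distributionI prob_space_distr) auto
qed

lemma nn_integral_conv:
  assumes "real_distribution M" "real_distribution N" "f \<in> borel_measurable borel"
  shows "(\<integral>\<^sup>+x. f x \<partial>(M \<star> N)) = (\<integral>\<^sup>+x. \<integral>\<^sup>+y. f (x + y) \<partial>N \<partial>M)"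
  using assms by (intro nn_integral_convolution real_distribution_finite real_distribution_sets)

lemma convolution_commute:
  assumes "real_distribution M" "real_distribution N"
  shows "(M \<star> N) = (N \<star> M)"
  using assms by (intro convolution_commutative real_distribution_finite real_distribution_sets)

lemma convolution_assoc:
  assumes "real_distribution L" "real_distribution M" "real_distribution N"
  shows "((L \<star> M) \<star> N) = (L \<star> (M \<star> N))"
  using assms
  by (intro convolution_associative[symmetric] real_distribution_finite real_distribution_sets)

lemma convolution_return_0:
  assumes "real_distribution M"
  shows "(M \<star> return borel 0) = M" "(return borel 0 \<star> M) = M"
proof -
  interpret M: real_distribution M by fact
  show "(M \<star> return borel 0) = M"
  proof (rule measure_eqI)
    fix A assume "A \<in> sets (M \<star> return borel 0)"
    then have [measurable]: "A \<in> sets borel" by simp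
    have "emeasure (M \<star> return borel 0) A = (\<integral>\<^sup>+x. indicator A x \<partial>(M \<star> return borel 0))"
      by simp
    also have "\<dots> = (\<integral>\<^sup>+x. indicator A x \<partial>M)"
      by (subst nn_integral_conv)
        (auto simp: assms real_distribution_return nn_integral_return)
    finally show "emeasure (M \<star> return borel 0) A = emeasure M A" by simp
  qed simp
  then show "(return borel 0 \<star> M) = M"
    using convolution_commute[OF assms real_distribution_return] by simp
qed

lemma char_convolution:
  assumes "real_distribution M" "real_distribution N"
  shows "char (M \<star> N) t = char M t * char N t"
proof -
  interpret M: real_distribution M by fact
  interpret N: real_distribution N by fact
  interpret P: pair_prob_space M N ..
  have "char (M \<star> N) t = (CLINT z|M \<Otimes>\<^sub>M N. iexp (t * (fst z + snd z)))"
    unfolding char_def convolution_def by (subst integral_distr) (auto simp: case_prod_beta)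
  also have "\<dots> = (CLINT x|M. CLINT y|N. iexp (t * (x + y)))"
  proof -
    have "integrable (M \<Otimes>\<^sub>M N) (\<lambda>z. iexp (t * (fst z + snd z)))"
      by (rule P.integrable_iexp) auto
    from P.integral_fst'[OF this] show ?thesis by simp
  qed
  also have "\<dots> = (CLINT x|M. iexp (t * x) * char N t)"
    unfolding char_def by (simp add: ring_distribs exp_add)
  also have "\<dots> = char M t * char N t"
    unfolding char_def by simp
  finally show ?thesis .
qed

lemma char_return: "char (return borel c) t = iexp (t * c)"
  unfolding char_def by (subst integral_return) auto

primrec conv_pow :: "real measure \<Rightarrow> nat \<Rightarrow> real measure" where
  "conv_pow \<mu> 0 = return borel 0"
| "conv_pow \<mu> (Suc n) = (\<mu> \<star> conv_pow \<mu> n)"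

lemma real_distribution_conv_pow:
  "real_distribution \<mu> \<Longrightarrow> real_distribution (conv_pow \<mu> n)"
  by (induction n) (auto intro: real_distribution_return real_distribution_conv)

lemma conv_pow_add:
  "real_distribution \<mu> \<Longrightarrow> conv_pow \<mu> (i + j) = (conv_pow \<mu> i \<star> conv_pow \<mu> j)"
  by (induction i) (simp_all add: convolution_return_0 convolution_assoc real_distribution_conv_pow)

lemma char_conv_pow: "real_distribution \<mu> \<Longrightarrow> char (conv_pow \<mu> n) t = char \<mu> t ^ n"
  by (induction n) (simp_all add: char_convolution real_distribution_conv_pow char_return)

lemma AE_convolution:
  assumes "real_distribution M" "real_distribution N" and [measurable]: "Measurable.pred borel P"
    and AE: "AE x in M. AE y in N. P (x + y)"
  shows "AE z in M \<star> N. P z"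
proof -
  interpret M: real_distribution M by fact
  interpret N: real_distribution N by fact
  interpret pair_prob_space M N ..
  have "AE z in M \<Otimes>\<^sub>M N. P (fst z + snd z)"
  proof (rule AE_pair_measure)
    show "{z \<in> space (M \<Otimes>\<^sub>M N). P (fst z + snd z)} \<in> sets (M \<Otimes>\<^sub>M N)" by measurable
  qed (use AE in simp)
  then show ?thesis
    unfolding convolution_def by (subst AE_distr_iff) (auto simp: case_prod_beta)
qed

lemma AE_conv_pow:
  assumes \<mu>: "real_distribution \<mu>" and P: "Measurable.pred borel P" and AE: "AE x in \<mu>. P x"
    and "P 0" and add: "\<And>x y. P x \<Longrightarrow> P y \<Longrightarrow> P (x + y)"
  shows "AE x in conv_pow \<mu> n. P x"
proof (induction n)
  case 0
  show ?case unfolding conv_pow.simps by (subst AE_return) (use P \<open>P 0\<close> in auto)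
next
  case (Suc n)
  have "AE x in \<mu>. AE y in conv_pow \<mu> n. P (x + y)"
    using AE by eventually_elim (use Suc add in \<open>auto elim!: eventually_mono\<close>)
  then show ?case
    unfolding conv_pow.simps by (intro AE_convolution \<mu> P real_distribution_conv_pow)
qed

section \<open>Poisson weights and compound Poisson mixtures\<close>

text \<open>A total function of the rate, because rate \<open>0\<close> occurs: for a walk of
  \<open>0\<close> steps and for an empty part of the time interval.\<close>

definition pois :: "real \<Rightarrow> nat \<Rightarrow> real" where
  "pois r n = r ^ n / fact n * exp (- r)"

definition cpois :: "real \<Rightarrow> real measure \<Rightarrow> real measure" where
  "cpois r \<mu> = measure_pmf (poisson_pmf r) \<bind> conv_pow \<mu>"

lemma conv_pow_kernel:
  assumes "real_distribution \<mu>"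
  shows "conv_pow \<mu> \<in> measurable (measure_pmf p) (subprob_algebra borel)"
  using real_distribution_conv_pow[OF assms]
  by (auto simp: measurable_def space_subprob_algebra
      real_distribution_sets[OF real_distribution_conv_pow[OF assms]]
      intro!: prob_space_imp_subprob_space real_distribution.axioms(1))

lemma real_distribution_cpois:
  assumes "real_distribution \<mu>"
  shows "real_distribution (cpois r \<mu>)"
proof (rule real_distributionI)
  show "prob_space (cpois r \<mu>)"
    unfolding cpois_def
    using real_distribution_conv_pow[OF assms]
    by (intro measure_pmf.prob_space_bind[OF _ conv_pow_kernel[OF assms]])
      (auto simp: real_distribution_def)
  show "sets (cpois r \<mu>) = sets borel"
    unfolding cpois_def
    by (intro sets_bind) (simp_all add: real_distribution_sets[OF real_distribution_conv_pow[OF assms]])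
qed

lemma AE_cpois:
  assumes \<mu>: "real_distribution \<mu>" and P: "Measurable.pred borel P" and AE: "AE x in \<mu>. P x"
    and "P 0" "\<And>x y. P x \<Longrightarrow> P y \<Longrightarrow> P (x + y)"
  shows "AE x in cpois r \<mu>. P x"
  unfolding cpois_def AE_bind[OF conv_pow_kernel[OF \<mu>] P]
  by (intro AE_I2 AE_conv_pow assms)

lemma nn_integral_cpois:
  assumes "real_distribution \<mu>" "r > 0" "f \<in> borel_measurable borel"
  shows "(\<integral>\<^sup>+x. f x \<partial>cpois r \<mu>) = (\<Sum>n. ennreal (pois r n) * (\<integral>\<^sup>+x. f x \<partial>conv_pow \<mu> n))"
proof -
  have "(\<integral>\<^sup>+x. f x \<partial>cpois r \<mu>) = (\<integral>\<^sup>+n. \<integral>\<^sup>+x. f x \<partial>conv_pow \<mu> n \<partial>measure_pmf (poisson_pmf r))"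
    unfolding cpois_def by (rule nn_integral_bind[OF assms(3) conv_pow_kernel[OF assms(1)]])
  also have "\<dots> = (\<integral>\<^sup>+n. ennreal (pois r n) * (\<integral>\<^sup>+x. f x \<partial>conv_pow \<mu> n) \<partial>count_space UNIV)"
    by (simp add: nn_integral_measure_pmf pois_def assms(2))
  finally show ?thesis by (simp add: nn_integral_count_space_nat)
qed

lemma pois_nonneg: "r \<ge> 0 \<Longrightarrow> pois r n \<ge> 0"
  by (simp add: pois_def)

lemma pois_sums: "pois r sums 1"
proof -
  have "(\<lambda>n. (r ^ n /\<^sub>R fact n) * exp (- r)) sums (exp r * exp (-r))"
    by (intro sums_mult2 exp_converges)
  moreover have "exp r * exp (- r) = 1" by (simp add: exp_minus)
  ultimately show ?thesis by (simp add: pois_def[abs_def] divide_inverse mult_ac)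
qed

text \<open>The series is obtained for \<open>ennreal\<close> integrals, where it converges without
  conditions; boundedness of \<open>f\<close> then allows the return to real numbers.\<close>

lemma integral_cpois_nonneg:
  fixes f :: "real \<Rightarrow> real"
  assumes "real_distribution \<mu>" "r > 0" "f \<in> borel_measurable borel"
    and f: "\<And>x. 0 \<le> f x" "\<And>x. f x \<le> B"
  shows "(\<lambda>n. pois r n * (LINT x|conv_pow \<mu> n. f x)) sums (LINT x|cpois r \<mu>. f x)"
proof -
  have int: "integrable N f" if "real_distribution N" for N
  proof -
    interpret N: real_distribution N by fact
    show ?thesis using f assms(3)
      by (intro N.integrable_const_bound[of _ B]) (auto simp: abs_le_iff intro: order_trans[of _ 0])
  qed
  have nn: "(\<integral>\<^sup>+x. f x \<partial>N) = ennreal (LINT x|N. f x)" if "real_distribution N" for N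
    using int[OF that] f by (intro nn_integral_eq_integral) auto
  have pos: "0 \<le> pois r n * (LINT x|conv_pow \<mu> n. f x)" for n
    using assms(2) f by (intro mult_nonneg_nonneg pois_nonneg) (auto intro!: integral_nonneg_AE)
  have "ennreal (LINT x|cpois r \<mu>. f x) = (\<Sum>n. ennreal (pois r n * (LINT x|conv_pow \<mu> n. f x)))"
    using nn_integral_cpois[OF assms(1,2), of f] assms(1,2,3)
    by (simp add: nn real_distribution_cpois real_distribution_conv_pow ennreal_mult' pois_nonneg)
  then show ?thesis
    by (intro sums_ennreal[THEN iffD1] pos)
      (auto simp: intro!: sums_unique2 integral_nonneg_AE f summable_sums)
qed

lemma char_eq_cos_sin:
  assumes "real_distribution M"
  shows "char M t = of_real (LINT x|M. cos (t * x)) + \<i> * of_real (LINT x|M. sin (t * x))"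
proof -
  interpret real_distribution M by fact
  have int: "integrable M (\<lambda>x. cos (t * x))" "integrable M (\<lambda>x. sin (t * x))"
    by (auto intro!: integrable_const_bound[of _ 1])
  have "char M t = (CLINT x|M. of_real (cos (t * x)) + \<i> * of_real (sin (t * x)))"
    unfolding char_def by (intro Bochner_Integration.integral_cong) (auto simp: complex_eq_iff simp del: of_real_mult simp flip: cis_conv_exp)
  also have "\<dots> = (CLINT x|M. of_real (cos (t * x))) + (CLINT x|M. \<i> * of_real (sin (t * x)))"
    using int by (intro Bochner_Integration.integral_add integrable_mult_right) auto
  also have "\<dots> = of_real (LINT x|M. cos (t * x)) + \<i> * of_real (LINT x|M. sin (t * x))"
    by simp
  finally show ?thesis .
qed

lemma char_cpois:
  assumes \<mu>: "real_distribution \<mu>" and r: "r > 0"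
  shows "char (cpois r \<mu>) t = exp (of_real r * (char \<mu> t - 1))"
proof -
  have aux: "(\<lambda>n. pois r n * (LINT x|conv_pow \<mu> n. f x)) sums (LINT x|cpois r \<mu>. f x)"
    if f: "f \<in> borel_measurable borel" "\<And>x. \<bar>f x\<bar> \<le> 1" for f :: "real \<Rightarrow> real"
  proof -
    have shift: "(LINT x|N. 1 + f x) = 1 + (LINT x|N. f x)" if "real_distribution N" for N
    proof -
      interpret N: real_distribution N by fact
      have "integrable N f" using f by (intro N.integrable_const_bound[of _ 1]) auto
      then show ?thesis by (simp add: N.prob_space[unfolded N.space_eq_univ])
    qed
    have *: "-1 \<le> f x" "f x \<le> 1" for x using f(2)[of x] by (auto simp: abs_le_iff)
    \<comment> \<open>The shift by \<open>1\<close> makes the integrand nonnegative with bound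
      \<open>2\<close>; subtracting \<open>pois_sums\<close> removes it again. Cosine and sine are
      then treated separately to reach the complex integral.\<close>
    have "(\<lambda>n. pois r n * (LINT x|conv_pow \<mu> n. 1 + f x)) sums (LINT x|cpois r \<mu>. 1 + f x)"
      using *[THEN add_left_mono[of _ _ 1]] f(1) by (intro integral_cpois_nonneg[where B = 2] \<mu> r) auto
    then have "(\<lambda>n. pois r n + pois r n * (LINT x|conv_pow \<mu> n. f x)) sums (1 + (LINT x|cpois r \<mu>. f x))"
      by (simp add: shift real_distribution_conv_pow real_distribution_cpois \<mu> distrib_left)
    from sums_diff[OF this pois_sums[of r]] show ?thesis by simp
  qed
  have "(\<lambda>n. of_real (pois r n * (LINT x|conv_pow \<mu> n. cos (t * x)))
           + \<i> * of_real (pois r n * (LINT x|conv_pow \<mu> n. sin (t * x)))) sums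
        (of_real (LINT x|cpois r \<mu>. cos (t * x)) + \<i> * of_real (LINT x|cpois r \<mu>. sin (t * x)))"
    by (intro sums_add sums_mult sums_of_real aux) auto
  then have "(\<lambda>n. of_real (pois r n) * char \<mu> t ^ n) sums char (cpois r \<mu>) t"
    by (simp add: char_eq_cos_sin[OF real_distribution_cpois[OF \<mu>]] flip: char_conv_pow[OF \<mu>])
       (simp add: char_eq_cos_sin real_distribution_conv_pow \<mu> algebra_simps)
  moreover have "(\<lambda>n. (of_real r * char \<mu> t) ^ n /\<^sub>R fact n * exp (- of_real r)) sums
      (exp (of_real r * char \<mu> t) * exp (- of_real r))"
    by (intro sums_mult2 exp_converges)
  then have "(\<lambda>n. of_real (pois r n) * char \<mu> t ^ n) sums (exp (of_real r * char \<mu> t) * exp (- of_real r))"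
    by (simp add: pois_def power_mult_distrib scaleR_conv_of_real divide_inverse mult_ac exp_of_real
        flip: of_real_minus)
  ultimately have "char (cpois r \<mu>) t = exp (of_real r * char \<mu> t) * exp (- of_real r)"
    by (rule sums_unique2)
  then show ?thesis by (simp add: algebra_simps flip: exp_add)
qed

section \<open>Exponential moments\<close>

text \<open>Values in \<open>ennreal\<close> spare all integrability conditions;
  \<open>\<theta>\<close> may have either sign.\<close>

definition mgf :: "real measure \<Rightarrow> real \<Rightarrow> ennreal" where
  "mgf M \<theta> = (\<integral>\<^sup>+x. ennreal (exp (\<theta> * x)) \<partial>M)"

lemma mgf_convolution:
  assumes "real_distribution M" "real_distribution N"
  shows "mgf (M \<star> N) \<theta> = mgf M \<theta> * mgf N \<theta>"
proof -
  interpret M: real_distribution M by fact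
  interpret N: real_distribution N by fact
  have "mgf (M \<star> N) \<theta> = (\<integral>\<^sup>+x. \<integral>\<^sup>+y. ennreal (exp (\<theta> * x)) * ennreal (exp (\<theta> * y)) \<partial>N \<partial>M)"
    unfolding mgf_def
    by (subst nn_integral_conv[OF assms])
       (auto simp: ring_distribs exp_add ennreal_mult')
  also have "\<dots> = mgf M \<theta> * mgf N \<theta>"
    unfolding mgf_def by (simp add: nn_integral_cmult nn_integral_multc)
  finally show ?thesis .
qed

lemma mgf_return: "mgf (return borel c) \<theta> = ennreal (exp (\<theta> * c))"
  unfolding mgf_def by (subst nn_integral_return) auto

lemma mgf_conv_pow: "real_distribution \<mu> \<Longrightarrow> mgf (conv_pow \<mu> n) \<theta> = mgf \<mu> \<theta> ^ n"
  by (induction n) (simp_all add: mgf_convolution real_distribution_conv_pow mgf_return)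

lemma mgf_cpois:
  assumes "real_distribution \<mu>" "r > 0" "mgf \<mu> \<theta> = ennreal m" "m \<ge> 0"
  shows "mgf (cpois r \<mu>) \<theta> = ennreal (exp (r * (m - 1)))"
proof -
  have "mgf (cpois r \<mu>) \<theta> = (\<Sum>n. ennreal (pois r n) * mgf (conv_pow \<mu> n) \<theta>)"
    unfolding mgf_def by (rule nn_integral_cpois) (use assms in auto)
  also have "\<dots> = (\<Sum>n. ennreal (pois r n * m ^ n))"
    using assms by (simp add: mgf_conv_pow ennreal_mult' pois_nonneg ennreal_power)
  also have "\<dots> = ennreal (exp (r * (m - 1)))"
  proof (rule suminf_ennreal_eq)
    have "(\<lambda>n. (r * m) ^ n /\<^sub>R fact n * exp (- r)) sums (exp (r * m) * exp (- r))"
      by (intro sums_mult2 exp_converges)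
    then show "(\<lambda>n. pois r n * m ^ n) sums exp (r * (m - 1))"
      by (simp add: pois_def power_mult_distrib divide_inverse algebra_simps flip: exp_add)
  qed (use assms in \<open>simp add: pois_nonneg\<close>)
  finally show ?thesis .
qed

section \<open>Running maxima of random walks with marked jumps\<close>

lemma pois_0: "pois 0 n = (if n = 0 then 1 else 0)"
  by (simp add: pois_def)

text \<open>Superposition of independent Poisson counts, which is the binomial theorem.\<close>

lemma pois_add: "(\<Sum>i\<le>n. pois a i * pois b (n - i)) = pois (a + b) n"
proof -
  have "pois a i * pois b (n - i) = of_nat (n choose i) * a ^ i * b ^ (n - i) * (exp (- (a + b)) / fact n)"
    if "i \<le> n" for i
  proof -
    have e: "exp (- (a + b)) = exp (- a) * exp (- b)" by (simp add: exp_add[symmetric])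
    show ?thesis using that unfolding pois_def e by (simp add: binomial_fact)
  qed
  then have "(\<Sum>i\<le>n. pois a i * pois b (n - i)) =
      (\<Sum>i\<le>n. of_nat (n choose i) * a ^ i * b ^ (n - i) * (exp (- (a + b)) / fact n))"
    by (intro sum.cong) auto
  also have "\<dots> = (a + b) ^ n * (exp (- (a + b)) / fact n)"
    by (simp only: binomial_ring sum_distrib_right)
  finally show ?thesis by (simp add: pois_def)
qed

lemma pois_add_ennreal:
  assumes "a \<ge> 0" "b \<ge> 0"
  shows "(\<Sum>i\<le>n. ennreal (pois a i) * ennreal (pois b (n - i))) = ennreal (pois (a + b) n)"
proof -
  have "(\<Sum>i\<le>n. ennreal (pois a i) * ennreal (pois b (n - i))) = (\<Sum>i\<le>n. ennreal (pois a i * pois b (n - i)))"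
    using assms by (simp add: ennreal_mult' pois_nonneg)
  also have "\<dots> = ennreal (pois (a + b) n)"
    using assms by (subst sum_ennreal) (auto simp: pois_nonneg pois_add)
  finally show ?thesis .
qed

lemma suminf_pois:
  assumes "r \<ge> 0"
  shows "(\<Sum>n. ennreal (pois r n)) = 1"
proof -
  have "(\<Sum>n. ennreal (pois r n)) = ennreal 1"
    by (rule suminf_ennreal_eq[OF _ pois_sums]) (rule pois_nonneg[OF assms])
  then show ?thesis by simp
qed

lemma suminf_ennreal_swap:
  fixes a :: "nat \<Rightarrow> nat \<Rightarrow> ennreal"
  shows "(\<Sum>i. \<Sum>n. a i n) = (\<Sum>n. \<Sum>i. a i n)"
proof -
  have "(\<Sum>i. \<Sum>n. a i n) = (\<integral>\<^sup>+i. (\<Sum>n. a i n) \<partial>count_space UNIV)"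
    by (simp add: nn_integral_count_space_nat)
  also have "\<dots> = (\<Sum>n. \<integral>\<^sup>+i. a i n \<partial>count_space UNIV)"
    by (intro nn_integral_suminf) auto
  finally show ?thesis by (simp add: nn_integral_count_space_nat)
qed

lemma suminf_ennreal_triangle:
  fixes a :: "nat \<Rightarrow> nat \<Rightarrow> ennreal"
  shows "(\<Sum>i. \<Sum>n. a i n) = (\<Sum>n. \<Sum>i\<le>n. a i (n - i))"
proof -
  have "(\<Sum>n. a i n) = (\<Sum>n. if i \<le> n then a i (n - i) else 0)" for i
  proof -
    have "(\<Sum>n. if i \<le> n then a i (n - i) else 0) =
        (\<Sum>n. if i \<le> n + i then a i (n + i - i) else 0) + (\<Sum>n<i. if i \<le> n then a i (n - i) else 0)"
      by (rule suminf_offset) auto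
    then show ?thesis by simp
  qed
  then have "(\<Sum>i. \<Sum>n. a i n) = (\<Sum>i. \<Sum>n. if i \<le> n then a i (n - i) else 0)"
    by simp
  also have "\<dots> = (\<Sum>n. \<Sum>i. if i \<le> n then a i (n - i) else 0)"
    by (rule suminf_ennreal_swap)
  also have "\<dots> = (\<Sum>n. \<Sum>i\<le>n. a i (n - i))"
    by (intro suminf_cong, subst suminf_finite[of "{..n}" for n]) auto
  finally show ?thesis .
qed

lemma nn_integral_convolution_cpois:
  assumes "real_distribution \<nu>" "real_distribution \<mu>" "r > 0" "f \<in> borel_measurable borel"
  shows "(\<integral>\<^sup>+x. f x \<partial>(\<nu> \<star> cpois r \<mu>)) = (\<Sum>n. ennreal (pois r n) * (\<integral>\<^sup>+x. f x \<partial>(\<nu> \<star> conv_pow \<mu> n)))"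
proof -
  note [measurable] = assms(4)
  interpret real_distribution \<nu> by fact
  interpret C: real_distribution "conv_pow \<mu> n" for n by (intro real_distribution_conv_pow assms)
  have "(\<integral>\<^sup>+x. f x \<partial>(\<nu> \<star> cpois r \<mu>)) = (\<integral>\<^sup>+x. \<integral>\<^sup>+y. f (x + y) \<partial>cpois r \<mu> \<partial>\<nu>)"
    by (intro nn_integral_conv real_distribution_cpois assms)
  also have "\<dots> = (\<integral>\<^sup>+x. (\<Sum>n. ennreal (pois r n) * (\<integral>\<^sup>+y. f (x + y) \<partial>conv_pow \<mu> n)) \<partial>\<nu>)"
    by (subst nn_integral_cpois) (use assms in auto)
  also have "\<dots> = (\<Sum>n. \<integral>\<^sup>+x. ennreal (pois r n) * (\<integral>\<^sup>+y. f (x + y) \<partial>conv_pow \<mu> n) \<partial>\<nu>)"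
    by (rule nn_integral_suminf) measurable
  also have "\<dots> = (\<Sum>n. ennreal (pois r n) * (\<integral>\<^sup>+x. \<integral>\<^sup>+y. f (x + y) \<partial>conv_pow \<mu> n \<partial>\<nu>))"
    by (subst nn_integral_cmult) auto
  also have "\<dots> = (\<Sum>n. ennreal (pois r n) * (\<integral>\<^sup>+x. f x \<partial>(\<nu> \<star> conv_pow \<mu> n)))"
    by (subst nn_integral_conv)
       (use assms in \<open>auto intro: real_distribution_conv_pow\<close>)
  finally show ?thesis .
qed

section \<open>Exceedance probabilities of a random walk\<close>

text \<open>The probability that a walk with step law \<open>\<nu>\<close>, started at
  \<open>x\<close>, is above \<open>u\<close> at one of the times \<open>0\<close> to
  \<open>m\<close>. Conditioning on the first step expresses it through the step law alone, so no
  path space is involved.\<close>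

primrec maxp :: "real measure \<Rightarrow> real \<Rightarrow> nat \<Rightarrow> real \<Rightarrow> ennreal" where
  "maxp \<nu> u 0 x = indicator {u<..} x"
| "maxp \<nu> u (Suc m) x = (if u < x then 1 else \<integral>\<^sup>+y. maxp \<nu> u m (x + y) \<partial>\<nu>)"

lemma measurable_maxp [measurable]:
  assumes "real_distribution \<nu>"
  shows "maxp \<nu> u m \<in> borel_measurable borel"
proof (induction m)
  case (Suc m)
  interpret real_distribution \<nu> by fact
  note Suc[measurable]
  show ?case by simp
qed simp

lemma maxp_gt: "u < x \<Longrightarrow> maxp \<nu> u m x = 1"
  by (cases m) auto

lemma maxp_le_1: "real_distribution \<nu> \<Longrightarrow> maxp \<nu> u m x \<le> 1"
proof (induction m arbitrary: x)
  case (Suc m)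
  interpret real_distribution \<nu> by fact
  have "(\<integral>\<^sup>+y. maxp \<nu> u m (x + y) \<partial>\<nu>) \<le> (\<integral>\<^sup>+y. 1 \<partial>\<nu>)"
    using Suc by (intro nn_integral_mono) auto
  then show ?case using emeasure_space_1 by (simp del: space_eq_univ)
qed (simp add: indicator_def)

lemma maxp_Suc_ge:
  assumes "real_distribution \<nu>"
  shows "(\<integral>\<^sup>+y. maxp \<nu> u m (x + y) \<partial>\<nu>) \<le> maxp \<nu> u (Suc m) x"
proof -
  interpret real_distribution \<nu> by fact
  have "(\<integral>\<^sup>+y. maxp \<nu> u m (x + y) \<partial>\<nu>) \<le> (\<integral>\<^sup>+y. 1 \<partial>\<nu>)"
    using maxp_le_1[OF assms] by (intro nn_integral_mono) auto
  then show ?thesis using emeasure_space_1 by (simp del: space_eq_univ)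
qed

lemma maxp_mono_Suc:
  assumes "real_distribution \<nu>"
  shows "maxp \<nu> u m x \<le> maxp \<nu> u (Suc m) x"
proof (induction m arbitrary: x)
  case 0
  show ?case by (simp add: indicator_def)
next
  case (Suc m)
  then show ?case by (auto intro!: nn_integral_mono simp del: maxp.simps simp: maxp.simps(2)[of _ _ m] maxp.simps(2)[of _ _ "Suc m"])
qed

lemma maxp_mono: "real_distribution \<nu> \<Longrightarrow> m \<le> m' \<Longrightarrow> maxp \<nu> u m x \<le> maxp \<nu> u m' x"
  by (rule lift_Suc_mono_le[of "\<lambda>m. maxp \<nu> u m x"]) (simp_all add: maxp_mono_Suc del: maxp.simps)

text \<open>Ottaviani's inequality without a stopping time. As long as the start is at most
  \<open>u\<close>, both sides pass through the first step; once it is above \<open>u\<close>, the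
  end of the walk stays above \<open>u - e\<close> unless the remaining steps lose more than
  \<open>e\<close>.\<close>

lemma maxp_ottaviani:
  assumes \<nu>: "real_distribution \<nu>"
    and c: "\<And>k. k \<le> m \<Longrightarrow> c \<le> emeasure (conv_pow \<nu> k) {-e..}"
  shows "c * maxp \<nu> u m x \<le> (\<integral>\<^sup>+y. indicator {u - e<..} (x + y) \<partial>conv_pow \<nu> m)"
proof -
  have gt: "c * maxp \<nu> u m x \<le> (\<integral>\<^sup>+y. indicator {u - e<..} (x + y) \<partial>conv_pow \<nu> m)"
    if "u < x" "c \<le> emeasure (conv_pow \<nu> m) {-e..}" for m x
  proof -
    interpret C: real_distribution "conv_pow \<nu> m" by (intro real_distribution_conv_pow \<nu>)
    have "emeasure (conv_pow \<nu> m) {-e..} = (\<integral>\<^sup>+y. indicator {-e..} y \<partial>conv_pow \<nu> m)"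
      by simp
    also have "\<dots> \<le> (\<integral>\<^sup>+y. indicator {u - e<..} (x + y) \<partial>conv_pow \<nu> m)"
      using that by (intro nn_integral_mono) (auto simp: indicator_def)
    finally show ?thesis using that by (simp add: maxp_gt)
  qed
  show ?thesis
    using c
  proof (induction m arbitrary: x)
    case 0
    then show ?case
      using gt[of x 0] by (cases "u < x") auto
  next
    case (Suc m)
    interpret real_distribution \<nu> by fact
    show ?case
    proof (cases "u < x")
      case True
      then show ?thesis using gt[of x "Suc m"] Suc.prems[of "Suc m"] by simp
    next
      case False
      then have "c * maxp \<nu> u (Suc m) x = (\<integral>\<^sup>+y. c * maxp \<nu> u m (x + y) \<partial>\<nu>)"
        using measurable_maxp[OF \<nu>] by (subst nn_integral_cmult) auto
      also have "\<dots> \<le> (\<integral>\<^sup>+y. \<integral>\<^sup>+z. indicator {u - e<..} (x + y + z) \<partial>conv_pow \<nu> m \<partial>\<nu>)"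
        using Suc by (intro nn_integral_mono Suc.IH) auto
      also have "\<dots> = (\<integral>\<^sup>+y. indicator {u - e<..} (x + y) \<partial>conv_pow \<nu> (Suc m))"
        by (simp, subst nn_integral_conv)
           (auto simp: \<nu> real_distribution_conv_pow add.assoc)
      finally show ?thesis .
    qed
  qed
qed

section \<open>Walks whose steps carry a Poisson number of nonnegative jumps\<close>

locale jump_walk =
  fixes \<nu> \<mu> :: "real measure" and r :: real
  assumes \<nu>: "real_distribution \<nu>" and \<mu>: "real_distribution \<mu>" and r: "r > 0"
    and \<mu>_nonneg: "AE x in \<mu>. 0 \<le> x"
begin

lemmas \<mu>n = real_distribution_conv_pow[OF \<mu>] and \<nu>n = real_distribution_conv_pow[OF \<nu>]

sublocale \<mu>n: real_distribution "conv_pow \<mu> n" for n by (rule \<mu>n)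
sublocale \<nu>: real_distribution \<nu> by (rule \<nu>)

lemmas measurable_maxp' [measurable] = measurable_maxp[OF \<nu>]

text \<open>Weight of the paths with \<open>n\<close> jumps in \<open>m\<close> steps whose running maximum, started at \<open>x\<close>, exceeds \<open>u\<close>.\<close>
primrec jmax :: "real \<Rightarrow> nat \<Rightarrow> real \<Rightarrow> nat \<Rightarrow> ennreal" where
  "jmax u 0 x n = (if n = 0 then indicator {u<..} x else 0)"
| "jmax u (Suc m) x n = (if u < x then ennreal (pois (real (Suc m) * r) n)
     else (\<Sum>i\<le>n. ennreal (pois r i) * (\<integral>\<^sup>+y. jmax u m (x + y) (n - i) \<partial>(\<nu> \<star> conv_pow \<mu> i))))"

lemma step: "real_distribution (\<nu> \<star> conv_pow \<mu> i)"
  by (intro real_distribution_conv \<nu> \<mu>n)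

sublocale step: real_distribution "\<nu> \<star> conv_pow \<mu> i" for i by (rule step)

lemma measurable_jmax [measurable]: "(\<lambda>x. jmax u m x n) \<in> borel_measurable borel"
proof (induction m arbitrary: n)
  case (Suc m)
  note Suc[measurable]
  show ?case by simp
qed simp

lemma conv_pow_nonneg: "AE x in conv_pow \<mu> n. 0 \<le> x"
  by (rule AE_conv_pow[OF \<mu> _ \<mu>_nonneg]) auto

lemma maxp_conv_pow_gt:
  assumes "u < x"
  shows "(\<integral>\<^sup>+z. maxp \<nu> u m (x + z) \<partial>conv_pow \<mu> n) = 1"
proof -
  have "(\<integral>\<^sup>+z. maxp \<nu> u m (x + z) \<partial>conv_pow \<mu> n) = (\<integral>\<^sup>+z. 1 \<partial>conv_pow \<mu> n)"
    using conv_pow_nonneg[of n]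
    by (intro nn_integral_cong_AE, eventually_elim) (use assms in \<open>auto intro!: maxp_gt\<close>)
  then show ?thesis using \<mu>n.emeasure_space_1[of n] by (simp del: \<mu>n.space_eq_univ)
qed

lemma nn_integral_convolution_assoc:
  assumes [measurable]: "f \<in> borel_measurable borel"
    and "real_distribution L" "real_distribution M" "real_distribution N" "real_distribution K"
    and eq: "((L \<star> M) \<star> N) = (K \<star> J)" "real_distribution J"
  shows "(\<integral>\<^sup>+y. \<integral>\<^sup>+z. f (x + y + z) \<partial>N \<partial>(L \<star> M)) = (\<integral>\<^sup>+z. \<integral>\<^sup>+y. f (x + z + y) \<partial>J \<partial>K)"
proof -
  have "(\<integral>\<^sup>+y. \<integral>\<^sup>+z. f (x + y + z) \<partial>N \<partial>(L \<star> M)) = (\<integral>\<^sup>+w. f (x + w) \<partial>((L \<star> M) \<star> N))"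
    by (subst nn_integral_conv)
       (auto intro: assms real_distribution_conv simp: add.assoc)
  also have "\<dots> = (\<integral>\<^sup>+z. \<integral>\<^sup>+y. f (x + z + y) \<partial>J \<partial>K)"
    unfolding eq by (subst nn_integral_conv)
       (auto intro: assms real_distribution_conv simp: add.assoc)
  finally show ?thesis .
qed

text \<open>Convolution commutes, so the jumps of the first step can be added to the starting point
  together with the \<open>j\<close> later ones; the jump-free part of that step becomes one more
  step of the \<open>\<nu>\<close>-walk.\<close>

lemma step_maxp:
  "(\<integral>\<^sup>+y. \<integral>\<^sup>+z. maxp \<nu> u m (x + y + z) \<partial>conv_pow \<mu> j \<partial>(\<nu> \<star> conv_pow \<mu> i))
     \<le> (\<integral>\<^sup>+z. maxp \<nu> u (Suc m) (x + z) \<partial>conv_pow \<mu> (i + j))"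
proof -
  have "((\<nu> \<star> conv_pow \<mu> i) \<star> conv_pow \<mu> j) = (conv_pow \<mu> (i + j) \<star> \<nu>)"
    by (simp add: convolution_assoc \<nu> \<mu>n conv_pow_add[OF \<mu>] convolution_commute[of \<nu>]
        real_distribution_conv)
  then have "(\<integral>\<^sup>+y. \<integral>\<^sup>+z. maxp \<nu> u m (x + y + z) \<partial>conv_pow \<mu> j \<partial>(\<nu> \<star> conv_pow \<mu> i))
      = (\<integral>\<^sup>+z. \<integral>\<^sup>+y. maxp \<nu> u m (x + z + y) \<partial>\<nu> \<partial>conv_pow \<mu> (i + j))"
    by (intro nn_integral_convolution_assoc \<nu> \<mu>n measurable_maxp)
  also have "\<dots> \<le> (\<integral>\<^sup>+z. maxp \<nu> u (Suc m) (x + z) \<partial>conv_pow \<mu> (i + j))"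
    by (intro nn_integral_mono maxp_Suc_ge \<nu>)
  finally show ?thesis .
qed

text \<open>Making all \<open>n\<close> jumps at time \<open>0\<close> can only raise the running
  maximum, since jumps are nonnegative. Nonnegativity enters when the start is already above
  \<open>u\<close>: the start stays above \<open>u\<close> after the jumps are added.\<close>

lemma jmax_le:
  "jmax u m x n \<le> ennreal (pois (real m * r) n) * (\<integral>\<^sup>+z. maxp \<nu> u m (x + z) \<partial>conv_pow \<mu> n)"
proof (induction m arbitrary: x n)
  case 0
  show ?case by (auto simp: pois_0 nn_integral_return)
next
  case (Suc m x n)
  show ?case
  proof (cases "u < x")
    case True
    then show ?thesis by (simp only: maxp_conv_pow_gt) simp
  next
    case False
    have "jmax u (Suc m) x n \<le> (\<Sum>i\<le>n. ennreal (pois r i) * (\<integral>\<^sup>+y. ennreal (pois (real m * r) (n - i))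
        * (\<integral>\<^sup>+z. maxp \<nu> u m (x + y + z) \<partial>conv_pow \<mu> (n - i)) \<partial>(\<nu> \<star> conv_pow \<mu> i)))"
      using False by (simp, intro sum_mono mult_left_mono nn_integral_mono Suc.IH) auto
    also have "\<dots> = (\<Sum>i\<le>n. ennreal (pois r i) * ennreal (pois (real m * r) (n - i))
        * (\<integral>\<^sup>+y. \<integral>\<^sup>+z. maxp \<nu> u m (x + y + z) \<partial>conv_pow \<mu> (n - i) \<partial>(\<nu> \<star> conv_pow \<mu> i)))"
      by (subst nn_integral_cmult) (auto simp: mult.assoc)
    also have "\<dots> \<le> (\<Sum>i\<le>n. ennreal (pois r i) * ennreal (pois (real m * r) (n - i))
        * (\<integral>\<^sup>+z. maxp \<nu> u (Suc m) (x + z) \<partial>conv_pow \<mu> (i + (n - i))))"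
      by (intro sum_mono mult_left_mono step_maxp) auto
    also have "\<dots> = ennreal (pois (r + real m * r) n) * (\<integral>\<^sup>+z. maxp \<nu> u (Suc m) (x + z) \<partial>conv_pow \<mu> n)"
      using r by (simp add: sum_distrib_right del: maxp.simps flip: pois_add_ennreal cong: sum.cong_simp)
    finally show ?thesis by (simp add: algebra_simps del: maxp.simps jmax.simps)
  qed
qed

text \<open>If \<open>u\<close> is exceeded within the first \<open>m1\<close> steps, only the
  \<open>j\<close> jumps made there matter and are moved to time \<open>0\<close>; the other
  \<open>n - j\<close> contribute their weight. Otherwise it is exceeded in the last
  \<open>m2\<close> steps, and all \<open>n\<close> jumps are moved ahead of that block.\<close>

lemma jmax_split:
  "jmax u (m1 + m2) x n \<le>
     (\<Sum>j\<le>n. ennreal (pois (real m1 * r) j) * ennreal (pois (real m2 * r) (n - j))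
        * (\<integral>\<^sup>+z. maxp \<nu> u m1 (x + z) \<partial>conv_pow \<mu> j))
   + ennreal (pois (real (m1 + m2) * r) n)
      * (\<integral>\<^sup>+w. maxp \<nu> u m2 (x + w) \<partial>(conv_pow \<nu> m1 \<star> conv_pow \<mu> n))"
proof (induction m1 arbitrary: x n)
  case 0
  have "jmax u m2 x n \<le> ennreal (pois (real m2 * r) n) * (\<integral>\<^sup>+z. maxp \<nu> u m2 (x + z) \<partial>conv_pow \<mu> n)"
    by (rule jmax_le)
  then show ?case
    by (simp add: convolution_return_0 \<mu>n) (meson add_increasing zero_le)
next
  case (Suc m1 x n)
  show ?case
  proof (cases "u < x")
    case True
    have "(\<Sum>j\<le>n. ennreal (pois (real (Suc m1) * r) j) * ennreal (pois (real m2 * r) (n - j))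
        * (\<integral>\<^sup>+z. maxp \<nu> u (Suc m1) (x + z) \<partial>conv_pow \<mu> j)) = ennreal (pois (real (Suc m1 + m2) * r) n)"
      using r by (simp only: maxp_conv_pow_gt[OF True] mult_1_right pois_add_ennreal[of "real (Suc m1) * r" "real m2 * r"]
         zero_le_mult_iff of_nat_0_le_iff less_imp_le simp_thms of_nat_add distrib_right)
    then show ?thesis using True by (simp del: maxp.simps add: add_increasing2)
  next
    case False
    let ?A = "\<lambda>x n. (\<Sum>j\<le>n. ennreal (pois (real m1 * r) j) * ennreal (pois (real m2 * r) (n - j))
        * (\<integral>\<^sup>+z. maxp \<nu> u m1 (x + z) \<partial>conv_pow \<mu> j))"
    let ?B = "\<lambda>x n. ennreal (pois (real (m1 + m2) * r) n)
      * (\<integral>\<^sup>+w. maxp \<nu> u m2 (x + w) \<partial>(conv_pow \<nu> m1 \<star> conv_pow \<mu> n))"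
    let ?I = "\<lambda>l. \<integral>\<^sup>+z. maxp \<nu> u (Suc m1) (x + z) \<partial>conv_pow \<mu> l"
    let ?J = "\<integral>\<^sup>+w. maxp \<nu> u m2 (x + w) \<partial>(conv_pow \<nu> (Suc m1) \<star> conv_pow \<mu> n)"
    let ?SA = "(\<Sum>i\<le>n. ennreal (pois r i) * (\<integral>\<^sup>+y. ?A (x + y) (n - i) \<partial>(\<nu> \<star> conv_pow \<mu> i)))"
    let ?SB = "(\<Sum>i\<le>n. ennreal (pois r i) * (\<integral>\<^sup>+y. ?B (x + y) (n - i) \<partial>(\<nu> \<star> conv_pow \<mu> i)))"
    interpret K: real_distribution "conv_pow \<nu> m1 \<star> conv_pow \<mu> l" for l
      by (intro real_distribution_conv \<nu>n \<mu>n)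
    have "jmax u (Suc m1 + m2) x n \<le>
       (\<Sum>i\<le>n. ennreal (pois r i) * (\<integral>\<^sup>+y. ?A (x + y) (n - i) + ?B (x + y) (n - i) \<partial>(\<nu> \<star> conv_pow \<mu> i)))"
      by (simp only: add_Suc jmax.simps False if_False) (intro sum_mono mult_left_mono nn_integral_mono Suc.IH; simp)
    also have "\<dots> = ?SA
        + ?SB"
      by (subst nn_integral_add) (auto simp: sum.distrib distrib_left)
    finally have split: "jmax u (Suc m1 + m2) x n \<le>
        ?SA
        + ?SB" .
    have A: "?SA
       \<le> (\<Sum>j\<le>n. ennreal (pois (real (Suc m1) * r) j) * ennreal (pois (real m2 * r) (n - j)) * ?I j)"
    proof -
      have "?SA
        = (\<Sum>i\<le>n. \<Sum>j\<le>n - i. ennreal (pois r i) * ennreal (pois (real m1 * r) j) * ennreal (pois (real m2 * r) (n - i - j))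
            * (\<integral>\<^sup>+y. \<integral>\<^sup>+z. maxp \<nu> u m1 (x + y + z) \<partial>conv_pow \<mu> j \<partial>(\<nu> \<star> conv_pow \<mu> i)))"
        by (subst nn_integral_sum, measurable, subst nn_integral_cmult, measurable)
           (simp only: sum_distrib_left mult.assoc)
      also have "\<dots> \<le> (\<Sum>i\<le>n. \<Sum>j\<le>n - i. ennreal (pois r i) * ennreal (pois (real m1 * r) j) * ennreal (pois (real m2 * r) (n - i - j))
            * ?I (i + j))"
        by (intro sum_mono mult_left_mono step_maxp) auto
      also have "\<dots> = (\<Sum>(i, j)\<in>{(i, j). i + j \<le> n}. ennreal (pois r i) * ennreal (pois (real m1 * r) j) * ennreal (pois (real m2 * r) (n - (i + j)))
            * ?I (i + j))"
        by (subst sum.Sigma) (force intro!: sum.cong)+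
      \<comment> \<open>Regrouping by the number \<open>l = i + j\<close> of jumps in the first
        \<open>Suc m1\<close> steps lets the Poisson weights of the first step and of the next
        \<open>m1\<close> steps combine.\<close>
      also have "\<dots> = (\<Sum>l\<le>n. \<Sum>i\<le>l. ennreal (pois r i) * ennreal (pois (real m1 * r) (l - i)) * ennreal (pois (real m2 * r) (n - (i + (l - i))))
            * ?I (i + (l - i)))"
        by (rule sum.triangle_reindex_eq)
      also have "\<dots> = (\<Sum>l\<le>n. (\<Sum>i\<le>l. ennreal (pois r i) * ennreal (pois (real m1 * r) (l - i))) * ennreal (pois (real m2 * r) (n - l)) * ?I l)"
        by (simp add: sum_distrib_right del: maxp.simps)
      also have "\<dots> = (\<Sum>l\<le>n. ennreal (pois (r + real m1 * r) l) * ennreal (pois (real m2 * r) (n - l)) * ?I l)"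
        using r by (subst pois_add_ennreal) auto
      finally show ?thesis by (simp only: of_nat_Suc distrib_right mult_1_left)
    qed
    have B: "?SB
       = ennreal (pois (real (Suc m1 + m2) * r) n) * ?J"
    proof -
      \<comment> \<open>Whichever part of the \<open>n\<close> jumps falls in the first step, the
        position before the last block has the same law, so the integral factors out of the sum over
        \<open>i\<close>.\<close>
      have conv: "((\<nu> \<star> conv_pow \<mu> i) \<star> (conv_pow \<nu> m1 \<star> conv_pow \<mu> (n - i)))
          = (conv_pow \<nu> (Suc m1) \<star> conv_pow \<mu> n)" if "i \<le> n" for i
      proof -
        have "((\<nu> \<star> conv_pow \<mu> i) \<star> (conv_pow \<nu> m1 \<star> conv_pow \<mu> (n - i)))
          = (\<nu> \<star> ((conv_pow \<mu> i \<star> conv_pow \<nu> m1) \<star> conv_pow \<mu> (n - i)))"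
          by (simp add: convolution_assoc \<nu> \<mu>n \<nu>n real_distribution_conv)
        also have "\<dots> = (\<nu> \<star> (conv_pow \<nu> m1 \<star> (conv_pow \<mu> i \<star> conv_pow \<mu> (n - i))))"
          by (simp add: convolution_assoc \<nu> \<mu>n \<nu>n real_distribution_conv convolution_commute[OF \<mu>n \<nu>n])
        also have "\<dots> = (conv_pow \<nu> (Suc m1) \<star> conv_pow \<mu> n)"
          using that by (simp add: convolution_assoc \<nu> \<mu>n \<nu>n real_distribution_conv flip: conv_pow_add[OF \<mu>])
        finally show ?thesis .
      qed
      have int: "(\<integral>\<^sup>+y. (\<integral>\<^sup>+w. maxp \<nu> u m2 (x + y + w) \<partial>(conv_pow \<nu> m1 \<star> conv_pow \<mu> (n - i))) \<partial>(\<nu> \<star> conv_pow \<mu> i)) = ?J"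
        if "i \<le> n" for i
      proof -
        have "?J = (\<integral>\<^sup>+w. maxp \<nu> u m2 (x + w) \<partial>((\<nu> \<star> conv_pow \<mu> i) \<star> (conv_pow \<nu> m1 \<star> conv_pow \<mu> (n - i))))"
          by (simp only: conv[OF that])
        also have "\<dots> = (\<integral>\<^sup>+y. \<integral>\<^sup>+w. maxp \<nu> u m2 (x + (y + w))
            \<partial>(conv_pow \<nu> m1 \<star> conv_pow \<mu> (n - i)) \<partial>(\<nu> \<star> conv_pow \<mu> i))"
          by (rule nn_integral_conv) (auto intro: real_distribution_conv \<nu> \<mu>n \<nu>n)
        finally show ?thesis by (simp only: add.assoc)
      qed
      have B: "(\<integral>\<^sup>+y. ?B (x + y) (n - i) \<partial>(\<nu> \<star> conv_pow \<mu> i)) = ennreal (pois (real (m1 + m2) * r) (n - i)) * ?J"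
        if "i \<le> n" for i
        unfolding int[OF that, symmetric] by (rule nn_integral_cmult) measurable
      have "?SB
        = (\<Sum>i\<le>n. ennreal (pois r i) * ennreal (pois (real (m1 + m2) * r) (n - i)) * ?J)"
        by (intro sum.cong refl) (simp only: B atMost_iff mult.assoc)
      also have "\<dots> = ennreal (pois (r + real (m1 + m2) * r) n) * ?J"
        using r by (simp only: pois_add_ennreal[symmetric] sum_distrib_right zero_le_mult_iff of_nat_0_le_iff less_imp_le simp_thms)
      finally show ?thesis by (simp only: of_nat_add of_nat_Suc distrib_right mult_1_left add.assoc)
    qed
    show ?thesis using add_mono[OF A order_refl] split unfolding B by (rule order_trans[rotated])
  qed
qed

text \<open>Decomposition by the total number of jumps. The recursion gives a double series over
  jumps in the first step and jumps later, which is resummed along antidiagonals.\<close>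

lemma maxp_eq_suminf_jmax: "maxp (\<nu> \<star> cpois r \<mu>) u m x = (\<Sum>n. jmax u m x n)"
proof (induction m arbitrary: x)
  case 0
  show ?case by (subst suminf_finite[of "{0}"]) auto
next
  case (Suc m)
  show ?case
  proof (cases "u < x")
    case True
    then show ?thesis using r suminf_pois[of "real (Suc m) * r"] by simp
  next
    case False
    then have "maxp (\<nu> \<star> cpois r \<mu>) u (Suc m) x = (\<integral>\<^sup>+y. (\<Sum>n. jmax u m (x + y) n) \<partial>(\<nu> \<star> cpois r \<mu>))"
      by (simp add: Suc.IH)
    also have "\<dots> = (\<Sum>i. ennreal (pois r i) * (\<integral>\<^sup>+y. (\<Sum>n. jmax u m (x + y) n) \<partial>(\<nu> \<star> conv_pow \<mu> i)))"
      by (intro nn_integral_convolution_cpois \<nu> \<mu> r) measurable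
    also have "\<dots> = (\<Sum>i. \<Sum>n. ennreal (pois r i) * (\<integral>\<^sup>+y. jmax u m (x + y) n \<partial>(\<nu> \<star> conv_pow \<mu> i)))"
      by (subst nn_integral_suminf) (auto simp: ennreal_suminf_cmult)
    also have "\<dots> = (\<Sum>n. \<Sum>i\<le>n. ennreal (pois r i) * (\<integral>\<^sup>+y. jmax u m (x + y) (n - i) \<partial>(\<nu> \<star> conv_pow \<mu> i)))"
      by (rule suminf_ennreal_triangle)
    also have "\<dots> = (\<Sum>n. jmax u (Suc m) x n)"
      using False by (intro suminf_cong) simp
    finally show ?thesis .
  qed
qed

end

section \<open>Gaussian smoothing of tails\<close>

definition gauss :: "real \<Rightarrow> real measure" where
  "gauss s = density lborel (normal_density 0 s)"

lemma real_distribution_gauss: "s > 0 \<Longrightarrow> real_distribution (gauss s)"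
  unfolding gauss_def by (intro real_distributionI prob_space_normal_density) auto

lemma char_gauss:
  assumes "s > 0"
  shows "char (gauss s) t = exp (- of_real (s\<^sup>2 * t\<^sup>2 / 2))"
proof -
  interpret prob_space std_normal_distribution
    using real_dist_normal_dist by (simp add: real_distribution_def)
  have "distributed std_normal_distribution lborel (\<lambda>x. x) std_normal_density"
    by (auto simp: distributed_def intro!: distr_id2)
  from normal_density_affine[OF this, of s 0] assms
  have D: "distributed std_normal_distribution lborel (\<lambda>x. s * x) (normal_density 0 s)"
    by simp
  have "gauss s = distr std_normal_distribution lborel (\<lambda>x. s * x)"
    unfolding gauss_def using distributed_distr_eq_density[OF D] by simp
  then have "char (gauss s) t = (CLINT x|std_normal_distribution. iexp (t * (s * x)))"
    unfolding char_def by (simp add: integral_distr)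
  also have "\<dots> = char std_normal_distribution (t * s)"
    unfolding char_def by (simp add: mult.assoc)
  also have "\<dots> = exp (- of_real (s\<^sup>2 * t\<^sup>2 / 2))"
    unfolding char_std_normal_distribution by (simp add: power_mult_distrib mult.commute flip: exp_of_real)
  finally show ?thesis .
qed

lemma mgf_gauss:
  assumes "s > 0"
  shows "mgf (gauss s) t = ennreal (exp (s\<^sup>2 * t\<^sup>2 / 2))"
proof -
  \<comment> \<open>Completing the square: the exponential tilt of a centred Gaussian density is a
    Gaussian density with mean \<open>s\<^sup>2 * t\<close>.\<close>
  have eq: "normal_density 0 s x * exp (t * x) = exp (s\<^sup>2 * t\<^sup>2 / 2) * normal_density (s\<^sup>2 * t) s x" for x
  proof -
    have "- (x - 0)\<^sup>2 / (2 * s\<^sup>2) + t * x = s\<^sup>2 * t\<^sup>2 / 2 + - (x - s\<^sup>2 * t)\<^sup>2 / (2 * s\<^sup>2)"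
      using assms by (simp add: field_simps power2_eq_square)
    then show ?thesis unfolding normal_density_def by (simp add: mult.assoc flip: exp_add)
  qed
  have "mgf (gauss s) t = (\<integral>\<^sup>+x. ennreal (normal_density 0 s x * exp (t * x)) \<partial>lborel)"
    unfolding mgf_def gauss_def by (subst nn_integral_density) (auto simp: ennreal_mult' normal_density_nonneg)
  also have "\<dots> = (\<integral>\<^sup>+x. ennreal (exp (s\<^sup>2 * t\<^sup>2 / 2)) * ennreal (normal_density (s\<^sup>2 * t) s x) \<partial>lborel)"
    unfolding eq by (simp add: ennreal_mult' normal_density_nonneg)
  also have "\<dots> = ennreal (exp (s\<^sup>2 * t\<^sup>2 / 2)) * (\<integral>\<^sup>+x. ennreal (normal_density (s\<^sup>2 * t) s x) \<partial>lborel)"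
    by (rule nn_integral_cmult) auto
  also have "(\<integral>\<^sup>+x. ennreal (normal_density (s\<^sup>2 * t) s x) \<partial>lborel) = 1"
    using prob_space.emeasure_space_1[OF prob_space_normal_density[OF assms, of "s\<^sup>2 * t"]]
    by (simp add: emeasure_density)
  finally show ?thesis by simp
qed

text \<open>The logarithm of the Gaussian density is a quadratic, so the density at \<open>y - \<theta> c\<close> is up to a constant the
  geometric mean, with weights \<open>1 - \<theta>\<close> and \<open>\<theta>\<close>, of those at \<open>y\<close> and \<open>y - c\<close>; Young's inequality linearises this.\<close>
lemma normal_density_shift_le:
  assumes "s > 0" "0 \<le> \<theta>" "\<theta> \<le> 1" "R > 0"
  shows "normal_density 0 s (y - \<theta> * c)
    \<le> exp (\<theta> * c\<^sup>2 / (2 * s\<^sup>2)) * R powr \<theta> * (normal_density 0 s y + \<theta> / R * normal_density 0 s (y - c))"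
proof -
  define A where "A = - y\<^sup>2 / (2 * s\<^sup>2)"
  \<comment> \<open>The term \<open>ln R\<close> tilts the weighted mean: the factor
    \<open>R powr \<theta>\<close> paid in front buys the factor \<open>1 / R\<close> on the density
    at \<open>y - c\<close>.\<close>
  define B where "B = - (y - c)\<^sup>2 / (2 * s\<^sup>2) - ln R"
  define K where "K = 1 / sqrt (2 * pi * s\<^sup>2)"
  have K: "K \<ge> 0" by (simp add: K_def)
  have "- (y - \<theta> * c)\<^sup>2 / (2 * s\<^sup>2) = \<theta> * (1 - \<theta>) * c\<^sup>2 / (2 * s\<^sup>2) + \<theta> * ln R + ((1 - \<theta>) * A + \<theta> * B)"
    using assms unfolding A_def B_def by (simp add: field_simps power2_eq_square)
  also have "\<theta> * (1 - \<theta>) * c\<^sup>2 / (2 * s\<^sup>2) \<le> \<theta> * c\<^sup>2 / (2 * s\<^sup>2)"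
    using assms by (intro divide_right_mono mult_right_mono mult_left_le) auto
  finally have "exp (- (y - \<theta> * c)\<^sup>2 / (2 * s\<^sup>2))
      \<le> exp (\<theta> * c\<^sup>2 / (2 * s\<^sup>2) + \<theta> * ln R + ((1 - \<theta>) * A + \<theta> * B))"
    by simp
  also have "\<dots> = exp (\<theta> * c\<^sup>2 / (2 * s\<^sup>2)) * R powr \<theta> * exp ((1 - \<theta>) * A + \<theta> * B)"
    using assms by (simp add: exp_add powr_def)
  also have "exp ((1 - \<theta>) * A + \<theta> * B) \<le> (1 - \<theta>) * exp A + \<theta> * exp B"
    using assms convex_onD[OF exp_convex, of \<theta> A B] by simp
  also have "\<dots> \<le> exp A + \<theta> * exp B"
    using assms by (simp add: mult_left_le_one_le)
  finally have *: "exp (- (y - \<theta> * c)\<^sup>2 / (2 * s\<^sup>2))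
      \<le> exp (\<theta> * c\<^sup>2 / (2 * s\<^sup>2)) * R powr \<theta> * (exp A + \<theta> * exp B)"
    by (simp add: mult_left_mono)
  have B: "exp B = exp (- (y - c)\<^sup>2 / (2 * s\<^sup>2)) / R"
    using assms by (simp add: B_def exp_diff)
  from mult_left_mono[OF * K] show ?thesis
    unfolding normal_density_def B A_def K_def[symmetric] by (simp add: algebra_simps)
qed

section \<open>Tails and their behaviour under convolution\<close>

definition tail :: "real measure \<Rightarrow> real \<Rightarrow> ennreal" where
  "tail M u = emeasure M {u<..}"

lemma tail_eq_nn_integral: "real_distribution M \<Longrightarrow> tail M u = (\<integral>\<^sup>+x. indicator {u<..} x \<partial>M)"
  by (simp add: tail_def real_distribution_sets)

lemma tail_eq_measure: "real_distribution M \<Longrightarrow> tail M u = ennreal (measure M {u<..})"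
  unfolding tail_def by (intro finite_measure.emeasure_eq_measure real_distribution_finite)

lemma measurable_tail [measurable]: "real_distribution M \<Longrightarrow> tail M \<in> borel_measurable borel"
proof -
  assume "real_distribution M"
  then interpret real_distribution M .
  have "(\<lambda>u. \<integral>\<^sup>+x. indicator {u<..} x \<partial>M) \<in> borel_measurable borel"
  proof -
    have [measurable]: "Measurable.pred (borel \<Otimes>\<^sub>M M) (\<lambda>z. fst z < snd z)" by measurable
    have "(\<lambda>u. \<integral>\<^sup>+x. indicator {z. fst z < snd z} (u, x) \<partial>M) \<in> borel_measurable borel"
      by measurable
    then show ?thesis by (simp add: indicator_def)
  qed
  then show ?thesis by (simp add: tail_eq_nn_integral[OF \<open>real_distribution M\<close>, abs_def] cong: measurable_cong)
qed

lemma tail_convolution: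
  assumes "real_distribution M" "real_distribution N"
  shows "tail (M \<star> N) u = (\<integral>\<^sup>+y. tail M (u - y) \<partial>N)"
proof -
  have "tail (M \<star> N) u = tail (N \<star> M) u" using convolution_commute[OF assms] by simp
  also have "\<dots> = (\<integral>\<^sup>+y. \<integral>\<^sup>+x. indicator {u<..} (y + x) \<partial>M \<partial>N)"
    by (subst tail_eq_nn_integral, intro real_distribution_conv assms,
        rule nn_integral_conv) (auto simp: assms)
  also have "\<dots> = (\<integral>\<^sup>+y. tail M (u - y) \<partial>N)"
    by (intro nn_integral_cong, subst tail_eq_nn_integral[OF assms(1)], intro nn_integral_cong)
       (auto simp: indicator_def)
  finally show ?thesis .
qed

text \<open>Where the \<open>N\<close>-summand \<open>y\<close> leaves more than \<open>v\<close>
  for the other summand, the assumed comparison applies; elsewhere \<open>y\<close> is at least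
  \<open>w - v\<close>. Replacing \<open>v\<close> by \<open>v + 1\<close> there turns this into a
  strict tail.\<close>

lemma measure_convolution_tail_le:
  assumes M: "real_distribution M" and M': "real_distribution M'" and N: "real_distribution N"
    and \<epsilon>: "\<epsilon> \<ge> 0" and v: "\<And>w. v < w \<Longrightarrow> measure M {w<..} \<le> \<epsilon> * measure M' {w<..}"
  shows "measure (M \<star> N) {w<..} \<le> \<epsilon> * measure (M' \<star> N) {w<..} + measure N {w - (v + 1)<..}"
proof -
  interpret M: real_distribution M by fact
  interpret N: real_distribution N by fact
  note [measurable] = measurable_tail[OF M']
  note conv = real_distribution_conv[OF M N] real_distribution_conv[OF M' N]
  have "tail (M \<star> N) w \<le> (\<integral>\<^sup>+y. ennreal \<epsilon> * tail M' (w - y) + indicator {w - (v + 1)<..} y \<partial>N)"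
    unfolding tail_convolution[OF M N]
  proof (rule nn_integral_mono)
    fix y
    show "tail M (w - y) \<le> ennreal \<epsilon> * tail M' (w - y) + indicator {w - (v + 1)<..} y"
    proof (cases "v < w - y")
      case True
      have "tail M (w - y) \<le> ennreal \<epsilon> * tail M' (w - y)"
        using v[OF True] \<epsilon> unfolding tail_eq_measure[OF M] tail_eq_measure[OF M']
        by (subst ennreal_mult'[symmetric]) (auto intro!: ennreal_leI)
      then show ?thesis by (rule order_trans) simp
    next
      case False
      then have "indicator {w - (v + 1)<..} y = (1::ennreal)" by (simp add: indicator_def)
      moreover have "tail M (w - y) \<le> 1" by (simp add: tail_def M.emeasure_le_1)
      ultimately show ?thesis by (simp add: add_increasing)
    qed
  qed
  also have "\<dots> = (\<integral>\<^sup>+y. ennreal \<epsilon> * tail M' (w - y) \<partial>N) + (\<integral>\<^sup>+y. indicator {w - (v + 1)<..} y \<partial>N)"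
    by (rule nn_integral_add) measurable
  also have "\<dots> = ennreal \<epsilon> * tail (M' \<star> N) w + tail N (w - (v + 1))"
    unfolding tail_convolution[OF M' N] tail_eq_nn_integral[OF N] by (subst nn_integral_cmult) auto
  finally show ?thesis
    using \<epsilon> unfolding tail_eq_measure[OF conv(1)] tail_eq_measure[OF conv(2)] tail_eq_measure[OF N]
    by (simp add: ennreal_mult'[symmetric] ennreal_plus[symmetric] del: ennreal_plus)
qed

lemma tail_gauss_shift_le:
  assumes s: "s > 0" and "0 \<le> \<theta>" "\<theta> \<le> 1" "R > 0"
  shows "tail (gauss s) (v - \<theta> * c)
    \<le> ennreal (exp (\<theta> * c\<^sup>2 / (2 * s\<^sup>2)) * R powr \<theta>) * (tail (gauss s) v + ennreal (\<theta> / R) * tail (gauss s) (v - c))"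
proof -
  \<comment> \<open>A translation puts the three tails on the common domain \<open>{v<..}\<close>,
    where the densities are compared pointwise.\<close>
  have shift: "tail (gauss s) (v - d) = (\<integral>\<^sup>+y. ennreal (normal_density 0 s (y - d)) * indicator {v<..} y \<partial>lborel)" for d
  proof -
    have "tail (gauss s) (v - d) = (\<integral>\<^sup>+x. ennreal (normal_density 0 s x) * indicator {v - d<..} x \<partial>lborel)"
      unfolding tail_def gauss_def by (simp add: emeasure_density)
    also have "\<dots> = (\<integral>\<^sup>+y. ennreal (normal_density 0 s (- d + 1 * y)) * indicator {v - d<..} (- d + 1 * y) \<partial>lborel)"
      by (subst nn_integral_real_affine[where c = 1 and t = "- d"]) auto
    also have "\<dots> = (\<integral>\<^sup>+y. ennreal (normal_density 0 s (y - d)) * indicator {v<..} y \<partial>lborel)"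
      by (intro nn_integral_cong) (auto simp: indicator_def)
    finally show ?thesis .
  qed
  let ?K = "exp (\<theta> * c\<^sup>2 / (2 * s\<^sup>2)) * R powr \<theta>"
  have "tail (gauss s) (v - \<theta> * c) \<le> (\<integral>\<^sup>+y. ennreal ?K * (ennreal (normal_density 0 s (y - 0)) * indicator {v<..} y
      + ennreal (\<theta> / R) * (ennreal (normal_density 0 s (y - c)) * indicator {v<..} y)) \<partial>lborel)"
    unfolding shift
  proof (rule nn_integral_mono)
    fix y
    have "ennreal (normal_density 0 s (y - \<theta> * c)) \<le>
        ennreal (?K * (normal_density 0 s y + \<theta> / R * normal_density 0 s (y - c)))"
      by (intro ennreal_leI normal_density_shift_le assms)
    also have "\<dots> = ennreal ?K * (ennreal (normal_density 0 s y) + ennreal (\<theta> / R) * ennreal (normal_density 0 s (y - c)))"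
      using assms by (subst ennreal_mult', simp, subst ennreal_plus, simp, simp, subst ennreal_mult'[of "\<theta> / R"]) auto
    finally show "ennreal (normal_density 0 s (y - \<theta> * c)) * indicator {v<..} y \<le>
       ennreal ?K * (ennreal (normal_density 0 s (y - 0)) * indicator {v<..} y
      + ennreal (\<theta> / R) * (ennreal (normal_density 0 s (y - c)) * indicator {v<..} y))"
      by (simp add: indicator_def)
  qed
  also have "\<dots> = ennreal ?K * (tail (gauss s) (v - 0) + ennreal (\<theta> / R) * tail (gauss s) (v - c))"
    unfolding shift by (simp add: nn_integral_cmult nn_integral_add)
  finally show ?thesis by simp
qed

text \<open>This is why \<open>R\<close> is a fixed number in the Young inequality: the bound is
  linear in the tails and therefore survives averaging over \<open>W\<close>.\<close>

lemma tail_gauss_convolution_shift_le: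
  assumes s: "s > 0" and \<theta>: "0 \<le> \<theta>" "\<theta> \<le> 1" and R: "R > 0" and W: "real_distribution W"
  shows "tail (gauss s \<star> W) (v - \<theta> * c)
    \<le> ennreal (exp (\<theta> * c\<^sup>2 / (2 * s\<^sup>2)) * R powr \<theta>) * (tail (gauss s \<star> W) v + ennreal (\<theta> / R) * tail (gauss s \<star> W) (v - c))"
proof -
  interpret W: real_distribution W by fact
  note G = real_distribution_gauss[OF s]
  note [measurable] = measurable_tail[OF G]
  have "tail (gauss s \<star> W) (v - \<theta> * c) = (\<integral>\<^sup>+y. tail (gauss s) ((v - y) - \<theta> * c) \<partial>W)"
    unfolding tail_convolution[OF G W] by (simp add: algebra_simps)
  also have "\<dots> \<le> (\<integral>\<^sup>+y. ennreal (exp (\<theta> * c\<^sup>2 / (2 * s\<^sup>2)) * R powr \<theta>) *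
      (tail (gauss s) (v - y) + ennreal (\<theta> / R) * tail (gauss s) ((v - y) - c)) \<partial>W)"
    by (intro nn_integral_mono tail_gauss_shift_le s \<theta> R)
  also have "\<dots> = ennreal (exp (\<theta> * c\<^sup>2 / (2 * s\<^sup>2)) * R powr \<theta>) *
      ((\<integral>\<^sup>+y. tail (gauss s) (v - y) \<partial>W) + ennreal (\<theta> / R) * (\<integral>\<^sup>+y. tail (gauss s) ((v - y) - c) \<partial>W))"
    by (simp add: nn_integral_cmult nn_integral_add)
  also have "\<dots> = ennreal (exp (\<theta> * c\<^sup>2 / (2 * s\<^sup>2)) * R powr \<theta>) *
      (tail (gauss s \<star> W) v + ennreal (\<theta> / R) * tail (gauss s \<star> W) (v - c))"
    unfolding tail_convolution[OF G W] by (simp add: algebra_simps)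
  finally show ?thesis .
qed

section \<open>Asymptotics for walks with light jumps\<close>

text \<open>All that is kept of the process. \<open>lower\<close> bounds the drop of
  \<open>Y\<close> over times up to \<open>\<delta>\<close> at the diffusive scale
  \<open>sqrt \<delta>\<close>, with \<open>exp (- \<kappa> * \<delta>)\<close> accounting for
  downward jumps. \<open>light\<close> makes \<open>n\<close> jumps negligible against
  \<open>n + 1\<close>, and \<open>small\<close> makes \<open>Y\<close> alone negligible, even at a
  level lowered by a constant. The factor \<open>gauss s\<close> in \<open>\<nu> 1\<close> is the
  source of smoothing.\<close>

locale light_jumps =
  fixes \<nu> :: "real \<Rightarrow> real measure" and W \<mu> :: "real measure" and s l a \<kappa> B :: real
  assumes \<nu>: "\<And>t. 0 \<le> t \<Longrightarrow> real_distribution (\<nu> t)"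
    and \<nu>_0: "\<nu> 0 = return borel 0"
    and \<nu>_add: "\<And>t t'. 0 \<le> t \<Longrightarrow> 0 \<le> t' \<Longrightarrow> (\<nu> t \<star> \<nu> t') = \<nu> (t + t')"
    and s: "s > 0" and W: "real_distribution W" and \<nu>_1: "\<nu> 1 = (gauss s \<star> W)"
    and \<mu>: "real_distribution \<mu>" and l: "l > 0" and a: "a > 0"
    and \<mu>_ge: "AE x in \<mu>. a \<le> x"
    and \<kappa>: "\<kappa> \<ge> 0" and B: "B \<ge> 0"
    and lower: "\<And>t \<delta> r. 0 \<le> t \<Longrightarrow> t \<le> \<delta> \<Longrightarrow> 0 < \<delta> \<Longrightarrow> \<delta> \<le> 1 \<Longrightarrow> 0 \<le> r \<Longrightarrow>
       exp (- \<kappa> * \<delta>) * (1 - exp (B - r / sqrt \<delta>)) \<le> measure (\<nu> t) {-r..}"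
    and light: "\<And>n \<epsilon>. \<epsilon> > 0 \<Longrightarrow> \<exists>v. \<forall>w>v. measure (conv_pow \<mu> n) {w<..} \<le> \<epsilon> * measure (conv_pow \<mu> (Suc n)) {w<..}"
    and small: "\<And>v \<epsilon>. \<epsilon> > 0 \<Longrightarrow> eventually (\<lambda>u. measure (\<nu> 1) {u - v<..} \<le> \<epsilon> * measure (\<nu> 1 \<star> cpois l \<mu>) {u<..}) at_top"
begin

lemmas \<mu>n = real_distribution_conv_pow[OF \<mu>]

section \<open>Tails for a given number of big jumps\<close>

text \<open>The tail of \<open>X(1)\<close> conditioned on exactly \<open>n\<close> big jumps;
  \<open>T\<close> is the mixture of these with the Poisson weights \<open>q\<close>.\<close>

definition t :: "nat \<Rightarrow> real \<Rightarrow> real" where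
  "t n u = measure (\<nu> 1 \<star> conv_pow \<mu> n) {u<..}"

definition T :: "real \<Rightarrow> real" where
  "T u = measure (\<nu> 1 \<star> cpois l \<mu>) {u<..}"

definition q :: "nat \<Rightarrow> real" where "q = pois l"

lemma law: "real_distribution (\<nu> 1 \<star> conv_pow \<mu> n)"
  by (intro real_distribution_conv \<nu> \<mu>n) simp

lemma tail_t: "tail (\<nu> 1 \<star> conv_pow \<mu> n) u = ennreal (t n u)"
  unfolding t_def by (rule tail_eq_measure[OF law])

lemma t_nonneg: "0 \<le> t n u"
  by (simp add: t_def)

lemma T_nonneg: "0 \<le> T u"
  by (simp add: T_def)

lemma t_antimono: "u \<le> v \<Longrightarrow> t n v \<le> t n u"
proof -
  assume "u \<le> v"
  interpret real_distribution "\<nu> 1 \<star> conv_pow \<mu> n" by (rule law)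
  show ?thesis unfolding t_def using \<open>u \<le> v\<close> by (intro finite_measure_mono) auto
qed

lemma q_pos: "q n > 0"
  using l by (simp add: q_def pois_def)

lemma q_Suc: "q (Suc n) = l / (Suc n) * q n"
  by (simp add: q_def pois_def field_simps)

text \<open>Each big jump is at least \<open>a\<close>, so one more of them makes up for a level
  raised by \<open>a\<close>.\<close>

lemma t_shift: "t n (u - a) \<le> t (Suc n) u"
proof -
  have "(\<nu> 1 \<star> conv_pow \<mu> (Suc n)) = ((\<nu> 1 \<star> conv_pow \<mu> n) \<star> \<mu>)"
    using convolution_assoc[OF \<nu>[of 1] \<mu>n[of n] \<mu>] convolution_commute[OF \<mu> \<mu>n[of n]] by simp
  then have "ennreal (t (Suc n) u) = (\<integral>\<^sup>+y. tail (\<nu> 1 \<star> conv_pow \<mu> n) (u - y) \<partial>\<mu>)"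
    unfolding tail_t[symmetric] by (simp add: tail_convolution law \<mu>)
  moreover have "(\<integral>\<^sup>+y. ennreal (t n (u - a)) \<partial>\<mu>) \<le> (\<integral>\<^sup>+y. tail (\<nu> 1 \<star> conv_pow \<mu> n) (u - y) \<partial>\<mu>)"
    unfolding tail_t using \<mu>_ge
    by (intro nn_integral_mono_AE, eventually_elim) (auto intro!: ennreal_leI t_antimono)
  moreover have "(\<integral>\<^sup>+y. ennreal (t n (u - a)) \<partial>\<mu>) = ennreal (t n (u - a))"
    using prob_space.emeasure_space_1[OF real_distribution.axioms(1)[OF \<mu>]] by simp
  ultimately have "ennreal (t n (u - a)) \<le> ennreal (t (Suc n) u)" by metis
  then show ?thesis by (simp add: t_nonneg)
qed

lemma t_shift_mult: "t n (u - real k * a) \<le> t (n + k) u"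
proof (induction k arbitrary: u)
  case (Suc k)
  have "t n (u - real (Suc k) * a) = t n (u - a - real k * a)" by (simp add: algebra_simps)
  also have "\<dots> \<le> t (n + k) (u - a)" by (rule Suc)
  also have "\<dots> \<le> t (n + Suc k) u" using t_shift[of "n + k" u] by simp
  finally show ?case .
qed simp

lemma t_mono: "n \<le> n' \<Longrightarrow> t n u \<le> t n' u"
proof (rule lift_Suc_mono_le[of "\<lambda>n. t n u"])
  fix n show "t n u \<le> t (Suc n) u"
    using t_antimono[of "u - a" u n] t_shift[of n u] a by simp
qed

lemma T_sums: "(\<lambda>n. q n * t n u) sums T u"
proof -
  interpret X: real_distribution "\<nu> 1 \<star> cpois l \<mu>"
    by (intro real_distribution_conv \<nu> real_distribution_cpois \<mu>) simp
  have *: "ennreal (T u) = (\<Sum>n. ennreal (q n * t n u))"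
  proof -
    have "ennreal (T u) = (\<integral>\<^sup>+x. indicator {u<..} x \<partial>(\<nu> 1 \<star> cpois l \<mu>))"
      by (simp add: T_def X.emeasure_eq_measure)
    also have "\<dots> = (\<Sum>n. ennreal (pois l n) * (\<integral>\<^sup>+x. indicator {u<..} x \<partial>(\<nu> 1 \<star> conv_pow \<mu> n)))"
      by (intro nn_integral_convolution_cpois \<nu> \<mu> l) auto
    also have "\<dots> = (\<Sum>n. ennreal (q n * t n u))"
      using l by (simp add: tail_eq_nn_integral[OF law, symmetric] tail_t q_def ennreal_mult' pois_nonneg)
    finally show ?thesis .
  qed
  have pos: "0 \<le> q n * t n u" for n using q_pos[of n] t_nonneg[of n u] by simp
  show ?thesis
    using * by (intro sums_ennreal[THEN iffD1]) (auto simp: pos T_nonneg summable_sums)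
qed

lemma q_t_le_T: "q n * t n u \<le> T u"
  using sum_le_suminf[OF sums_summable[OF T_sums], of "{n}" u] q_pos t_nonneg sums_unique[OF T_sums]
  by (simp add: less_imp_le)

lemma conv_pow_\<nu>: "0 \<le> h \<Longrightarrow> conv_pow (\<nu> h) m = \<nu> (real m * h)"
  by (induction m) (simp_all add: \<nu>_0 \<nu>_add distrib_right)

section \<open>Ottaviani bounds paid for with extra jumps\<close>

text \<open>\<open>k\<close> is taken so that \<open>k\<close> jumps are worth at least
  \<open>B + 1\<close>. With \<open>C = k * a\<close>, the bound \<open>lower\<close> for
  \<open>\<delta> = 1\<close> and \<open>r = C\<close> gives probability at least
  \<open>1 / D\<close> that \<open>Y\<close> has dropped by at most \<open>C\<close> at any given
  time up to \<open>1\<close>.\<close>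

definition k :: nat where "k = nat \<lceil>(B + 1) / a\<rceil>"
definition C :: real where "C = real k * a"
definition D :: real where "D = exp \<kappa> / (1 - exp (- 1))"

lemma C_ge: "B + 1 \<le> C"
proof -
  have "(B + 1) / a \<le> real k" unfolding k_def using B a by (simp add: of_nat_nat)
  then show ?thesis using a by (simp add: C_def field_simps)
qed

lemma k_pos: "k > 0"
  using C_ge B by (cases k) (auto simp: C_def)

lemma D_pos: "D > 0"
  by (simp add: D_def)

lemma lower_C: "0 \<le> t' \<Longrightarrow> t' \<le> 1 \<Longrightarrow> 1 / D \<le> measure (\<nu> t') {-C..}"
proof -
  assume t': "0 \<le> t'" "t' \<le> 1"
  have "1 / D = exp (- \<kappa> * 1) * (1 - exp (- 1))" by (simp add: D_def exp_minus field_simps)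
  also have "\<dots> \<le> exp (- \<kappa> * 1) * (1 - exp (B - C / sqrt 1))"
    using C_ge by (intro mult_left_mono) auto
  also have "\<dots> \<le> measure (\<nu> t') {-C..}"
    using t' C_ge B by (intro lower) auto
  finally show ?thesis .
qed

lemma T_pos: "T u > 0"
proof -
  \<comment> \<open>With this many jumps of size at least \<open>a\<close> the level
    \<open>u\<close> is passed whenever \<open>Y\<close> ends no lower than
    \<open>- C\<close>.\<close>
  obtain n :: nat where n: "(u + C) / a < real n" using reals_Archimedean2 by blast
  then have n: "u - real n * a < - C" using a by (simp add: field_simps)
  interpret real_distribution "\<nu> 1" by (rule \<nu>) simp
  have "0 < 1 / D" using D_pos by simp
  also have "\<dots> \<le> measure (\<nu> 1) {-C..}" by (rule lower_C) auto
  also have "\<dots> \<le> t 0 (u - real n * a)"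
    unfolding t_def using n by (simp add: convolution_return_0 \<nu>) (intro finite_measure_mono, auto)
  also have "\<dots> \<le> t n u" using t_shift_mult[of 0 u n] by simp
  finally have "0 < q n * t n u" using q_pos by simp
  then show ?thesis using q_t_le_T[of n u] by simp
qed

text \<open>Ottaviani's inequality averaged over a random start \<open>N\<close>. The hypothesis on
  the laws says that start and all \<open>m\<close> steps together give \<open>X(1)\<close> with
  \<open>n\<close> big jumps, so the right side is a tail of the family \<open>t\<close>.\<close>

lemma ottaviani:
  assumes h: "0 \<le> h" and N: "real_distribution N" and c: "c > 0"
    and le: "\<And>i. i \<le> m \<Longrightarrow> c \<le> measure (\<nu> (real i * h)) {-e..}"
    and law: "(N \<star> \<nu> (real m * h)) = (\<nu> 1 \<star> conv_pow \<mu> n)"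
  shows "(\<integral>\<^sup>+z. maxp (\<nu> h) u m z \<partial>N) \<le> ennreal (t n (u - e) / c)"
proof -
  interpret N: real_distribution N by fact
  note [measurable] = measurable_maxp[OF \<nu>[OF h]]
  have "ennreal c * (\<integral>\<^sup>+z. maxp (\<nu> h) u m z \<partial>N) = (\<integral>\<^sup>+z. ennreal c * maxp (\<nu> h) u m z \<partial>N)"
    by (rule nn_integral_cmult[symmetric]) measurable
  also have "\<dots> \<le> (\<integral>\<^sup>+z. \<integral>\<^sup>+y. indicator {u - e<..} (z + y) \<partial>conv_pow (\<nu> h) m \<partial>N)"
  proof (intro nn_integral_mono maxp_ottaviani \<nu> h)
    fix i assume "i \<le> m"
    interpret real_distribution "\<nu> (real i * h)" using h by (intro \<nu>) auto
    show "ennreal c \<le> emeasure (conv_pow (\<nu> h) i) {-e..}"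
      using le[OF \<open>i \<le> m\<close>] by (simp add: conv_pow_\<nu> h emeasure_eq_measure)
  qed
  also have "\<dots> = (\<integral>\<^sup>+z. indicator {u - e<..} z \<partial>(\<nu> 1 \<star> conv_pow \<mu> n))"
    unfolding conv_pow_\<nu>[OF h] law[symmetric]
    by (rule nn_integral_conv[symmetric]) (use N h in \<open>auto intro: \<nu>\<close>)
  also have "\<dots> = ennreal (t n (u - e))"
    by (simp add: tail_eq_nn_integral[OF light_jumps.law, symmetric, OF light_jumps_axioms] tail_t)
  finally have "ennreal (1 / c) * (ennreal c * (\<integral>\<^sup>+z. maxp (\<nu> h) u m z \<partial>N)) \<le> ennreal (1 / c) * ennreal (t n (u - e))"
    by (rule mult_left_mono) simp
  then show ?thesis using c
    by (simp add: mult.assoc[symmetric] ennreal_mult'[symmetric] ennreal_mult''[symmetric])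
qed

text \<open>The walk is first prolonged to all \<open>m\<close> steps, so that it ends at time
  \<open>1\<close>; Ottaviani then costs the factor \<open>D\<close> and the level shift
  \<open>C\<close>, which \<open>k\<close> extra jumps absorb.\<close>

lemma maxp_jump_le:
  assumes "m > 0" "m1 \<le> m"
  shows "(\<integral>\<^sup>+z. maxp (\<nu> (1 / real m)) u m1 z \<partial>conv_pow \<mu> j) \<le> ennreal (D * t (j + k) u)"
proof -
  have "(\<integral>\<^sup>+z. maxp (\<nu> (1 / real m)) u m1 z \<partial>conv_pow \<mu> j) \<le> (\<integral>\<^sup>+z. maxp (\<nu> (1 / real m)) u m z \<partial>conv_pow \<mu> j)"
    using assms by (intro nn_integral_mono maxp_mono \<nu>) auto
  also have "\<dots> \<le> ennreal (t j (u - C) / (1 / D))"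
    using assms D_pos
    by (intro ottaviani \<mu>n lower_C) (auto simp: convolution_commute \<nu> \<mu>n)
  also have "\<dots> \<le> ennreal (D * t (j + k) u)"
    using t_shift_mult[of j u k] D_pos by (intro ennreal_leI) (auto simp: C_def mult.commute)
  finally show ?thesis .
qed

lemma jump_walk: "m > 0 \<Longrightarrow> jump_walk (\<nu> (1 / real m)) \<mu> (l / real m)"
  using \<mu>_ge a
  by (intro jump_walk.intro \<nu> \<mu>) (auto simp: l elim!: eventually_mono)

abbreviation jm :: "real \<Rightarrow> nat \<Rightarrow> nat \<Rightarrow> ennreal" where
  "jm u m n \<equiv> jump_walk.jmax (\<nu> (1 / real m)) \<mu> (l / real m) u m 0 n"

text \<open>A crude bound, lossy by \<open>D\<close> and \<open>k\<close>, for the finitely many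
  small \<open>n\<close>: there \<open>t (n + k) u\<close> is negligible against \<open>T u\<close>
  anyway.\<close>

lemma jm_le_t:
  assumes "m > 0"
  shows "jm u m n \<le> ennreal (q n * (D * t (n + k) u))"
proof -
  interpret J: jump_walk "\<nu> (1 / real m)" \<mu> "l / real m" by (rule jump_walk[OF assms])
  have "jm u m n \<le> ennreal (pois (real m * (l / real m)) n) * (\<integral>\<^sup>+z. maxp (\<nu> (1 / real m)) u m (0 + z) \<partial>conv_pow \<mu> n)"
    by (rule J.jmax_le)
  also have "\<dots> \<le> ennreal (pois (real m * (l / real m)) n) * ennreal (D * t (n + k) u)"
    using maxp_jump_le[OF assms order_refl] by (intro mult_left_mono) auto
  also have "\<dots> = ennreal (q n * (D * t (n + k) u))"
    using assms l D_pos t_nonneg by (simp add: q_def ennreal_mult' pois_nonneg)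
  finally show ?thesis .
qed

text \<open>Serves for those \<open>n\<close> that are too large compared with the grid size; their
  total Poisson weight can be made as small as desired.\<close>

lemma jm_le_q: "m > 0 \<Longrightarrow> jm u m n \<le> ennreal (q n)"
proof -
  assume m: "m > 0"
  interpret J: jump_walk "\<nu> (1 / real m)" \<mu> "l / real m" by (rule jump_walk[OF m])
  have "jm u m n \<le> ennreal (pois (real m * (l / real m)) n) * (\<integral>\<^sup>+z. maxp (\<nu> (1 / real m)) u m (0 + z) \<partial>conv_pow \<mu> n)"
    by (rule J.jmax_le)
  also have "\<dots> \<le> ennreal (pois (real m * (l / real m)) n) * (\<integral>\<^sup>+z. 1 \<partial>conv_pow \<mu> n)"
    by (intro mult_left_mono nn_integral_mono maxp_le_1 \<nu>) auto
  also have "\<dots> = ennreal (q n)"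
    using m l J.\<mu>n.emeasure_space_1 by (simp add: q_def del: J.\<mu>n.space_eq_univ)
  finally show ?thesis .
qed

text \<open>The early block gets the crude bound with \<open>k\<close> extra jumps; only the last
  block gets a bound with the same \<open>n\<close>, with drop \<open>e\<close> and price
  \<open>1 / c\<close>.\<close>

lemma jm_split:
  assumes m: "m > 0" "m1 + m2 = m" and c: "c > 0"
    and le: "\<And>i. i \<le> m2 \<Longrightarrow> c \<le> measure (\<nu> (real i / real m)) {-e..}"
  shows "jm u m n \<le> ennreal ((\<Sum>j\<le>n. pois (real m1 / real m * l) j * pois (real m2 / real m * l) (n - j) * (D * t (j + k) u))
     + q n * (t n (u - e) / c))"
proof -
  let ?s = "(\<Sum>j\<le>n. pois (real m1 / real m * l) j * pois (real m2 / real m * l) (n - j) * (D * t (j + k) u))"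
  let ?e = "(\<Sum>j\<le>n. ennreal (pois (real m1 / real m * l) j) * ennreal (pois (real m2 / real m * l) (n - j)) * ennreal (D * t (j + k) u))"
  interpret J: jump_walk "\<nu> (1 / real m)" \<mu> "l / real m" by (rule jump_walk[OF m(1)])
  have p: "0 \<le> pois (real i / real m * l) j" for i j using l by (intro pois_nonneg) auto
  have "jm u m n \<le> (\<Sum>j\<le>n. ennreal (pois (real m1 * (l / real m)) j) * ennreal (pois (real m2 * (l / real m)) (n - j))
        * (\<integral>\<^sup>+z. maxp (\<nu> (1 / real m)) u m1 (0 + z) \<partial>conv_pow \<mu> j))
   + ennreal (pois (real (m1 + m2) * (l / real m)) n)
      * (\<integral>\<^sup>+w. maxp (\<nu> (1 / real m)) u m2 (0 + w) \<partial>(conv_pow (\<nu> (1 / real m)) m1 \<star> conv_pow \<mu> n))"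
    using J.jmax_split[of u m1 m2 0 n] unfolding m(2) .
  also have "\<dots> \<le> ?e
      + ennreal (q n) * ennreal (t n (u - e) / c)"
  proof (intro add_mono sum_mono)
    fix j
    show "ennreal (pois (real m1 * (l / real m)) j) * ennreal (pois (real m2 * (l / real m)) (n - j))
        * (\<integral>\<^sup>+z. maxp (\<nu> (1 / real m)) u m1 (0 + z) \<partial>conv_pow \<mu> j)
      \<le> ennreal (pois (real m1 / real m * l) j) * ennreal (pois (real m2 / real m * l) (n - j)) * ennreal (D * t (j + k) u)"
      using maxp_jump_le[of m m1 j u] m by (simp add: mult_left_mono)
  next
    have "(\<integral>\<^sup>+w. maxp (\<nu> (1 / real m)) u m2 w \<partial>(conv_pow (\<nu> (1 / real m)) m1 \<star> conv_pow \<mu> n)) \<le> ennreal (t n (u - e) / c)"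
    proof (rule ottaviani)
      have "((\<nu> (real m1 / real m) \<star> conv_pow \<mu> n) \<star> \<nu> (real m2 / real m))
        = ((\<nu> (real m1 / real m) \<star> \<nu> (real m2 / real m)) \<star> conv_pow \<mu> n)"
        by (simp add: convolution_assoc \<nu> \<mu>n convolution_commute[OF \<mu>n \<nu>])
      also have "(\<nu> (real m1 / real m) \<star> \<nu> (real m2 / real m)) = \<nu> 1"
        using m by (subst \<nu>_add) (auto simp: add_divide_distrib[symmetric] simp flip: of_nat_add)
      finally show "((conv_pow (\<nu> (1 / real m)) m1 \<star> conv_pow \<mu> n) \<star> \<nu> (real m2 * (1 / real m))) = (\<nu> 1 \<star> conv_pow \<mu> n)"
        by (simp add: conv_pow_\<nu>)
      show "real_distribution (conv_pow (\<nu> (1 / real m)) m1 \<star> conv_pow \<mu> n)"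
        by (intro real_distribution_conv real_distribution_conv_pow \<nu> \<mu>) simp
    qed (use c le in auto)
    then show "ennreal (pois (real (m1 + m2) * (l / real m)) n)
      * (\<integral>\<^sup>+w. maxp (\<nu> (1 / real m)) u m2 (0 + w) \<partial>(conv_pow (\<nu> (1 / real m)) m1 \<star> conv_pow \<mu> n))
      \<le> ennreal (q n) * ennreal (t n (u - e) / c)"
      using m by (simp add: q_def mult_left_mono)
  qed
  also have "\<dots> = ennreal (?s
     + q n * (t n (u - e) / c))"
  proof -
    have "?e
      = (\<Sum>j\<le>n. ennreal (pois (real m1 / real m * l) j * pois (real m2 / real m * l) (n - j) * (D * t (j + k) u)))"
      using p D_pos t_nonneg by (intro sum.cong refl) (simp add: ennreal_mult')
    also have "\<dots> = ennreal ?s"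
      using p D_pos t_nonneg by (intro sum_ennreal) (auto intro!: mult_nonneg_nonneg less_imp_le)
    finally have eq: "?e
      = ennreal ?s" .
    have "0 \<le> ?s"
      by (intro sum_nonneg mult_nonneg_nonneg p t_nonneg less_imp_le[OF D_pos])
    moreover have "0 \<le> q n * (t n (u - e) / c)"
      using c by (intro mult_nonneg_nonneg divide_nonneg_pos t_nonneg less_imp_le[OF q_pos])
    ultimately show ?thesis
      unfolding eq ennreal_mult'[OF less_imp_le[OF q_pos], symmetric] by (rule ennreal_plus[symmetric])
  qed
  finally show ?thesis .
qed

section \<open>Smoothing of levels and thinning of jump counts\<close>

text \<open>The Gaussian factor relates the level \<open>u - \<theta> * C\<close> to the levels
  \<open>u\<close> and \<open>u - C\<close>; the full shift by \<open>C\<close> is traded for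
  \<open>k\<close> jumps. \<open>R\<close> stays free so that it can be matched to the ratio of
  Poisson weights.\<close>

lemma t_smoothing:
  assumes "0 \<le> \<theta>" "\<theta> \<le> 1" "R > 0"
  shows "t n (u - \<theta> * C) \<le> exp (\<theta> * C\<^sup>2 / (2 * s\<^sup>2)) * R powr \<theta> * (t n u + \<theta> / R * t (n + k) u)"
proof -
  have law': "(\<nu> 1 \<star> conv_pow \<mu> n) = (gauss s \<star> (W \<star> conv_pow \<mu> n))"
    unfolding \<nu>_1 by (intro convolution_assoc real_distribution_gauss s W \<mu>n)
  have "ennreal (t n (u - \<theta> * C)) \<le> ennreal (exp (\<theta> * C\<^sup>2 / (2 * s\<^sup>2)) * R powr \<theta>) * (ennreal (t n u) + ennreal (\<theta> / R) * ennreal (t n (u - C)))"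
    unfolding tail_t[symmetric] law'
    by (intro tail_gauss_convolution_shift_le s assms real_distribution_conv W \<mu>n)
  also have "\<dots> = ennreal (exp (\<theta> * C\<^sup>2 / (2 * s\<^sup>2)) * R powr \<theta> * (t n u + \<theta> / R * t n (u - C)))"
  proof -
    have p: "0 \<le> \<theta> / R" "0 \<le> exp (\<theta> * C\<^sup>2 / (2 * s\<^sup>2)) * R powr \<theta>" using assms by auto
    show ?thesis
      by (simp only: ennreal_mult'[OF p(1)] ennreal_mult'[OF p(2)] ennreal_plus[OF t_nonneg mult_nonneg_nonneg[OF p(1) t_nonneg]])
  qed
  finally have "t n (u - \<theta> * C) \<le> exp (\<theta> * C\<^sup>2 / (2 * s\<^sup>2)) * R powr \<theta> * (t n u + \<theta> / R * t n (u - C))"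
    using assms t_nonneg by (subst (asm) ennreal_le_iff) (auto intro!: mult_nonneg_nonneg add_nonneg_nonneg)
  also have "\<dots> \<le> exp (\<theta> * C\<^sup>2 / (2 * s\<^sup>2)) * R powr \<theta> * (t n u + \<theta> / R * t (n + k) u)"
    using assms t_shift_mult[of n u k] by (intro mult_left_mono add_left_mono) (auto simp: C_def)
  finally show ?thesis .
qed


text \<open>Given \<open>n\<close> jumps, the number \<open>j\<close> before the last window is
  binomial with parameter \<open>x\<close>. If more than \<open>k\<close> jumps are left for the
  window, then \<open>j + k\<close> is at most \<open>n - 1\<close>, and a whole jump is gained; the
  other \<open>k + 1\<close> values of \<open>j\<close> are exponentially unlikely.\<close>

lemma split_sum_le:
  assumes x: "0 \<le> x" "x \<le> 1" and n: "k < n" and \<delta>: "\<delta> \<le> 1 - x"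
  shows "(\<Sum>j\<le>n. pois (x * l) j * pois ((1 - x) * l) (n - j) * t (j + k) u)
    \<le> q n * t (n - 1) u + q n * (real (k + 1) * real n ^ k * exp (- \<delta> * real (n - k))) * t (n + k) u"
proof -
  let ?w = "\<lambda>j. pois (x * l) j * pois ((1 - x) * l) (n - j)"
  have w0: "0 \<le> ?w j" for j using x l by (intro mult_nonneg_nonneg pois_nonneg) auto
  have w_sum: "(\<Sum>j\<le>n. ?w j) = q n"
    using pois_add[of "x * l" "(1 - x) * l" n] by (simp add: q_def algebra_simps)
  have w_le: "?w j \<le> q n * (real n ^ k * exp (- \<delta> * real (n - k)))" if j: "n - k \<le> j" "j \<le> n" for j
  proof -
    have "?w j = q n * (real (n choose j) * x ^ j * (1 - x) ^ (n - j))"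
    proof -
      have "exp (- l) = exp (- (x * l)) * exp (- ((1 - x) * l))" by (simp add: exp_add[symmetric] algebra_simps)
      moreover have "l ^ n = l ^ j * l ^ (n - j)" using j by (simp add: power_add[symmetric])
      ultimately show ?thesis using j
        unfolding pois_def q_def by (simp only: power_mult_distrib) (simp add: binomial_fact)
    qed
    also have "\<dots> \<le> q n * (real n ^ k * exp (- \<delta> * real (n - k)))"
    proof (intro mult_left_mono less_imp_le[OF q_pos])
      \<comment> \<open>At most \<open>k\<close> jumps fall in the last window, so the binomial
        coefficient is a polynomial of degree at most \<open>k\<close> in \<open>n\<close>.\<close>
      have "real (n choose j) = real (n choose (n - j))" using j by (simp add: binomial_symmetric[of j n])
      also have "\<dots> \<le> real (n ^ (n - j))" using binomial_le_pow[of "n - j" n] by (simp del: of_nat_power)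
      also have "\<dots> \<le> real n ^ k" using j n by (simp add: power_increasing)
      finally have 1: "real (n choose j) \<le> real n ^ k" .
      have "x ^ j * (1 - x) ^ (n - j) \<le> x ^ (n - k) * 1"
        using x j by (intro mult_mono power_decreasing power_le_one) auto
      also have "x ^ (n - k) \<le> exp (- \<delta>) ^ (n - k)"
        using x \<delta> exp_ge_add_one_self[of "- \<delta>"] by (intro power_mono) auto
      also have "\<dots> = exp (- \<delta> * real (n - k))" by (simp add: exp_of_nat_mult[symmetric] mult.commute)
      finally have 2: "x ^ j * (1 - x) ^ (n - j) \<le> exp (- \<delta> * real (n - k))" by simp
      show "real (n choose j) * x ^ j * (1 - x) ^ (n - j) \<le> real n ^ k * exp (- \<delta> * real (n - k))"
        unfolding mult.assoc using 1 2 x by (intro mult_mono) auto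
    qed
    finally show ?thesis .
  qed
  \<comment> \<open>The cut at \<open>n - k\<close> is where \<open>j + k\<close> reaches
    \<open>n\<close>.\<close>
  have "(\<Sum>j\<le>n. ?w j * t (j + k) u) = (\<Sum>j\<in>{..<n - k}. ?w j * t (j + k) u) + (\<Sum>j\<in>{n - k..n}. ?w j * t (j + k) u)"
    by (subst sum.union_disjoint[symmetric]) (auto intro!: sum.cong)
  also have "(\<Sum>j\<in>{..<n - k}. ?w j * t (j + k) u) \<le> (\<Sum>j\<in>{..<n - k}. ?w j * t (n - 1) u)"
    by (intro sum_mono mult_left_mono t_mono w0) auto
  also have "\<dots> \<le> (\<Sum>j\<le>n. ?w j * t (n - 1) u)"
    by (intro sum_mono2 mult_nonneg_nonneg[OF w0 t_nonneg]) auto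
  also have "\<dots> = q n * t (n - 1) u"
    unfolding w_sum[symmetric] by (simp add: sum_distrib_right)
  also have "(\<Sum>j\<in>{n - k..n}. ?w j * t (j + k) u)
      \<le> (\<Sum>j\<in>{n - k..n}. q n * (real n ^ k * exp (- \<delta> * real (n - k))) * t (n + k) u)"
    using q_pos by (intro sum_mono mult_mono w_le t_mono t_nonneg) (auto simp: less_imp_le)
  also have "\<dots> = q n * (real (k + 1) * real n ^ k * exp (- \<delta> * real (n - k))) * t (n + k) u"
    using n by (simp add: mult_ac)
  finally show ?thesis by simp
qed

lemma q_ratio_le: "q n \<le> (real (n + k) / l) ^ k * q (n + k)"
proof -
  have "q n \<le> (real (n + i) / l) ^ i * q (n + i)" for i
  proof (induction i)
    case (Suc i)
    have "q n \<le> (real (n + i) / l) ^ i * q (n + i)" by (rule Suc)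
    also have "q (n + i) = real (n + Suc i) / l * q (n + Suc i)"
      using l q_Suc[of "n + i"] by (simp add: field_simps)
    also have "(real (n + i) / l) ^ i * (real (n + Suc i) / l * q (n + Suc i))
      \<le> (real (n + Suc i) / l) ^ i * (real (n + Suc i) / l * q (n + Suc i))"
      using l q_pos by (intro mult_right_mono power_mono divide_right_mono) (auto simp: less_imp_le)
    finally show ?case by (simp add: mult_ac)
  qed simp
  then show ?thesis .
qed

section \<open>Choice of the scales and their limits\<close>

text \<open>\<open>\<theta> n * C\<close> is the drop allowed in the last window, and
  \<open>c n\<close> is what \<open>lower\<close> guarantees for it over a time of at most twice
  \<open>n powr (-1/2)\<close>. \<open>R n\<close> bounds \<open>q n / q (n + k)\<close>.
  \<open>A1\<close> and \<open>A2\<close> collect the prices of the terms with \<open>n\<close> and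
  with \<open>n + k\<close> jumps; they tend to \<open>1\<close> and to \<open>0\<close>.\<close>

definition \<theta> :: "nat \<Rightarrow> real" where "\<theta> n = real n powr (-1/8)"
definition R :: "nat \<Rightarrow> real" where "R n = (real (n + k) / l) ^ k"
definition c :: "nat \<Rightarrow> real" where
  "c n = exp (- \<kappa> * (2 * real n powr (-1/2))) * (1 - exp (B - \<theta> n * C / sqrt (2 * real n powr (-1/2))))"
definition A1 :: "nat \<Rightarrow> real" where
  "A1 n = exp (\<theta> n * C\<^sup>2 / (2 * s\<^sup>2)) * R n powr \<theta> n / c n"
definition A2 :: "nat \<Rightarrow> real" where
  "A2 n = D * R n * (real (k + 1) * real n ^ k * exp (- (real n powr (-1/2)) * real (n - k))) + A1 n * \<theta> n"

lemma C_pos: "C > 0" using C_ge B by simp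

lemma c_tendsto: "c \<longlonglongrightarrow> 1"
  unfolding c_def[abs_def] \<theta>_def using C_pos by real_asymp

lemma A1_tendsto: "A1 \<longlonglongrightarrow> 1"
proof -
  have "(\<lambda>n. exp (\<theta> n * C\<^sup>2 / (2 * s\<^sup>2)) * R n powr \<theta> n) \<longlonglongrightarrow> 1"
  proof -
    have "(\<lambda>n. exp (\<theta> n * C\<^sup>2 / (2 * s\<^sup>2))) \<longlonglongrightarrow> 1"
      unfolding \<theta>_def using C_pos s by real_asymp
    moreover have "(\<lambda>n. R n powr \<theta> n) \<longlonglongrightarrow> 1"
    proof -
      have "(\<lambda>n. exp (real k * (\<theta> n * ln (real (n + k) / l)))) \<longlonglongrightarrow> exp (real k * 0)"
      proof (intro tendsto_intros)
        show "(\<lambda>n. \<theta> n * ln (real (n + k) / l)) \<longlonglongrightarrow> 0"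
          unfolding \<theta>_def using l by real_asymp
      qed
      moreover have "R n powr \<theta> n = exp (real k * (\<theta> n * ln (real (n + k) / l)))" for n
        using l k_pos unfolding R_def by (simp add: powr_def ln_realpow)
      ultimately show ?thesis by simp
    qed
    ultimately show ?thesis using tendsto_mult by fastforce
  qed
  from tendsto_divide[OF this c_tendsto] show ?thesis unfolding A1_def[abs_def] by simp
qed

lemma A2_tendsto: "A2 \<longlonglongrightarrow> 0"
proof -
  let ?w = "\<lambda>n. exp (- (real n powr (-1/2)) * (real n - real k))"
  let ?b = "\<lambda>n. (real (k + 1) * real n ^ k * exp (- (real n powr (-1/2)) * real (n - k)))"
  \<comment> \<open>In exponential form the polynomial factors contribute \<open>k\<close> times
    logarithms, against a negative term of order \<open>sqrt n\<close>.\<close>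
  let ?e = "\<lambda>n. exp (real k * ln (real n + real k) + real k * ln (real n) - (real n powr (-1/2)) * (real n - real k))"
  have first: "(\<lambda>n. D * R n * ?b n) \<longlonglongrightarrow> 0"
  proof (rule Lim_null_comparison[where g = "\<lambda>n. D * (real (k + 1) * ((real (n + k) / l) ^ k * real n ^ k * ?w n))"])
    show "eventually (\<lambda>n. norm (D * R n * ?b n)
      \<le> D * (real (k + 1) * ((real (n + k) / l) ^ k * real n ^ k * ?w n))) sequentially"
      using eventually_ge_at_top[of k]
      by eventually_elim (use D_pos l in \<open>simp add: R_def of_nat_diff abs_mult\<close>)
    have "(\<lambda>n. (real (n + k) / l) ^ k * real n ^ k * ?w n) \<longlonglongrightarrow> 0"
    proof (rule Lim_null_comparison[where g = "\<lambda>n. (1 / l) ^ k * ?e n"])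
      show "(\<lambda>n. (1 / l) ^ k * ?e n) \<longlonglongrightarrow> 0"
        by (intro tendsto_mult_right_zero) real_asymp
      show "eventually (\<lambda>n. norm ((real (n + k) / l) ^ k * real n ^ k * ?w n)
        \<le> (1 / l) ^ k * ?e n) sequentially"
        using eventually_gt_at_top[of 0]
      proof eventually_elim
        case (elim n)
        have "exp (real k * ln (real n + real k)) = (real n + real k) ^ k" "exp (real k * ln (real n)) = real n ^ k"
          using elim by (simp_all add: exp_of_nat_mult)
        then have "?e n
            = (real n + real k) ^ k * real n ^ k * ?w n"
          by (simp only: diff_conv_add_uminus exp_add mult_minus_left)
        then show ?case using l by (simp only:) (simp add: power_divide abs_mult)
      qed
    qed
    then show "(\<lambda>n. D * (real (k + 1) * ((real (n + k) / l) ^ k * real n ^ k * ?w n))) \<longlonglongrightarrow> 0"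
      by (intro tendsto_mult_right_zero)
  qed
  have "(\<lambda>n. A1 n * \<theta> n) \<longlonglongrightarrow> 1 * 0"
  proof (intro tendsto_mult A1_tendsto)
    show "\<theta> \<longlonglongrightarrow> 0" unfolding \<theta>_def[abs_def] by real_asymp
  qed
  from tendsto_add[OF first this] show ?thesis unfolding A2_def[abs_def] by simp
qed

end

context light_jumps
begin

text \<open>The coefficients tend to \<open>1\<close>, \<open>0\<close> and \<open>0\<close>, so
  summing over \<open>n\<close> costs asymptotically nothing. \<open>4 \<le> n\<close> keeps twice
  the window inside the unit interval, and \<open>n \<le> m\<close> makes the grid finer than the
  window.\<close>

lemma jm_bound:
  assumes n: "k < n" "4 \<le> n" and c: "c n > 0" and m: "n \<le> m"
  shows "jm u m n \<le> ennreal (A1 n * (q n * t n u) + D * l / real n * (q (n - 1) * t (n - 1) u) + A2 n * (q (n + k) * t (n + k) u))"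
    (is "_ \<le> ennreal ?r")
proof -
  define \<delta> where "\<delta> = real n powr (-1/2)"
  \<comment> \<open>Rounding up keeps the window at least \<open>\<delta>\<close> long; since
    \<open>m * \<delta>\<close> is at least \<open>1\<close>, it at most doubles it, which is the
    origin of the factor 2 in \<open>c\<close>.\<close>
  define m2 where "m2 = nat \<lceil>real m * \<delta>\<rceil>"
  define m1 where "m1 = m - m2"
  define x where "x = real m1 / real m"
  have m0: "m > 0" using n m by simp
  have \<delta>_pos: "\<delta> > 0" using n by (simp add: \<delta>_def)
  have \<delta>_eq: "\<delta> = 1 / sqrt (real n)"
    unfolding \<delta>_def using powr_minus_divide[of "real n" "1/2"] by (simp only: minus_divide_left powr_half_sqrt of_nat_0_le_iff)
  have "sqrt (real n) \<ge> sqrt 4" using n by (intro real_sqrt_le_mono) simp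
  then have \<delta>_le: "2 * \<delta> \<le> 1" using n by (simp add: \<delta>_eq divide_le_eq)
  have m\<delta>: "real m * \<delta> \<ge> 1"
  proof -
    have "1 \<le> sqrt (real n)" using n by simp
    also have "\<dots> = real n * \<delta>" using n by (simp add: \<delta>_eq real_div_sqrt)
    also have "\<dots> \<le> real m * \<delta>" using m \<delta>_pos by (intro mult_right_mono) auto
    finally show ?thesis .
  qed
  have m2_lo: "real m * \<delta> \<le> real m2" unfolding m2_def by (simp add: of_nat_nat real_nat_ceiling_ge)
  have "real m2 \<le> real m * \<delta> + 1" unfolding m2_def using m\<delta> by (simp add: of_nat_nat)
  then have m2_hi: "real m2 \<le> real m * (2 * \<delta>)" using m\<delta> by simp
  also have "\<dots> \<le> real m" using \<delta>_le mult_left_mono[OF \<delta>_le, of "real m"] by simp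
  finally have m2_m: "m2 \<le> m" by simp
  have m12: "m1 + m2 = m" using m2_m by (simp add: m1_def)
  have x: "0 \<le> x" "x \<le> 1" using m0 by (auto simp: x_def m1_def)
  have x': "1 - x = real m2 / real m" using m0 m2_m by (simp add: x_def m1_def of_nat_diff field_simps)
  have \<delta>_x: "\<delta> \<le> 1 - x" unfolding x' using m2_lo m0 by (simp add: field_simps)
  have \<theta>: "0 \<le> \<theta> n" "\<theta> n \<le> 1" using n powr_mono[of "-1/8" 0 "real n"] by (auto simp: \<theta>_def)
  have R: "R n > 0" using n l by (simp add: R_def)
  have qn: "q n \<le> R n * q (n + k)" using q_ratio_le unfolding R_def .
  have A1: "A1 n \<ge> 0" using c by (simp add: A1_def)
  let ?s = "(\<Sum>j\<le>n. pois (real m1 / real m * l) j * pois (real m2 / real m * l) (n - j) * (D * t (j + k) u))"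

  have "jm u m n \<le> ennreal (?s
     + q n * (t n (u - \<theta> n * C) / c n))"
  proof (rule jm_split[OF m0 m12 c])
    fix i assume i: "i \<le> m2"
    have "real i / real m \<le> 2 * \<delta>"
      using i m2_hi m0 by (simp add: field_simps)
    then show "c n \<le> measure (\<nu> (real i / real m)) {- (\<theta> n * C)..}"
      unfolding c_def \<delta>_def[symmetric] using \<delta>_pos \<delta>_le \<theta> C_pos by (intro lower) auto
  qed
  also have "\<dots> \<le> ennreal ?r"
  proof (rule ennreal_leI)
    let ?b = "real (k + 1) * real n ^ k * exp (- \<delta> * real (n - k))"
    have "?s
      = D * (\<Sum>j\<le>n. pois (x * l) j * pois ((1 - x) * l) (n - j) * t (j + k) u)"
      unfolding x'[symmetric] x_def[symmetric] by (simp add: sum_distrib_left mult_ac)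
    also have "\<dots> \<le> D * (q n * t (n - 1) u + q n * ?b * t (n + k) u)"
      using D_pos by (intro mult_left_mono split_sum_le x n \<delta>_x) auto
    \<comment> \<open>Passing from \<open>q n\<close> to \<open>q (n - 1)\<close> yields the factor
      \<open>l / n\<close>, which makes the gained jump count.\<close>
    also have "\<dots> = D * l / real n * (q (n - 1) * t (n - 1) u) + q n * (D * ?b * t (n + k) u)"
      using q_Suc[of "n - 1"] n by (simp add: algebra_simps)
    also have "q n * (D * ?b * t (n + k) u) \<le> R n * q (n + k) * (D * ?b * t (n + k) u)"
      using D_pos t_nonneg by (intro mult_right_mono[OF qn]) (auto intro!: mult_nonneg_nonneg)
    finally have 1: "?s
      \<le> D * l / real n * (q (n - 1) * t (n - 1) u) + D * R n * ?b * (q (n + k) * t (n + k) u)"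
      by (simp add: mult_ac)
    have "q n * (t n (u - \<theta> n * C) / c n)
      \<le> q n * (exp (\<theta> n * C\<^sup>2 / (2 * s\<^sup>2)) * R n powr \<theta> n * (t n u + \<theta> n / R n * t (n + k) u) / c n)"
      using c by (intro mult_left_mono divide_right_mono t_smoothing \<theta> R less_imp_le[OF q_pos]) auto
    also have "\<dots> = A1 n * (q n * t n u + (q n / R n) * (\<theta> n * t (n + k) u))"
      by (simp add: A1_def field_simps)
    \<comment> \<open>The division by \<open>R n\<close> coming from the smoothing cancels exactly
      the ratio of Poisson weights, so only the small factor \<open>\<theta> n\<close> is
      left.\<close>
    also have "\<dots> \<le> A1 n * (q n * t n u + q (n + k) * (\<theta> n * t (n + k) u))"
      using qn R \<theta> t_nonneg A1 by (intro mult_left_mono add_left_mono mult_right_mono) (auto simp: field_simps)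
    finally have 2: "q n * (t n (u - \<theta> n * C) / c n) \<le> A1 n * (q n * t n u) + A1 n * \<theta> n * (q (n + k) * t (n + k) u)"
      by (simp add: algebra_simps)
    show "?s
        + q n * (t n (u - \<theta> n * C) / c n)
      \<le> ?r"
      using add_mono[OF 1 2] unfolding A2_def \<delta>_def[symmetric] by (simp add: algebra_simps)
  qed
  finally show ?thesis .
qed

section \<open>Summation over the number of big jumps\<close>

text \<open>\<open>n\<close> jumps are negligible against \<open>n + 1\<close> jumps once their sum
  exceeds a fixed \<open>v\<close>; otherwise \<open>Y\<close> has to reach
  \<open>u - (v + 1)\<close>, which \<open>small\<close> excludes. The factor
  \<open>q (Suc n)\<close> in \<open>\<epsilon>'\<close> turns \<open>t (Suc n) u\<close> into a
  part of \<open>T u\<close>.\<close>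

lemma t_small:
  assumes \<epsilon>: "\<epsilon> > 0"
  shows "eventually (\<lambda>u. t n u \<le> \<epsilon> * T u) at_top"
proof -
  define \<epsilon>' where "\<epsilon>' = \<epsilon> / 2 * q (Suc n)"
  have \<epsilon>': "\<epsilon>' > 0" using \<epsilon> q_pos by (simp add: \<epsilon>'_def)
  obtain v where v: "\<And>w. w > v \<Longrightarrow> measure (conv_pow \<mu> n) {w<..} \<le> \<epsilon>' * measure (conv_pow \<mu> (Suc n)) {w<..}"
    using light[OF \<epsilon>', of n] by auto
  have \<nu>1: "real_distribution (\<nu> 1)" by (rule \<nu>) simp
  have step: "t n u \<le> \<epsilon>' * t (Suc n) u + measure (\<nu> 1) {u - (v + 1)<..}" for u
    using measure_convolution_tail_le[OF \<mu>n[of n] \<mu>n[of "Suc n"] \<nu>1 less_imp_le[OF \<epsilon>'] v, where w = u]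
    unfolding t_def convolution_commute[OF \<nu>1 \<mu>n] by blast
  have "eventually (\<lambda>u. measure (\<nu> 1) {u - (v + 1)<..} \<le> \<epsilon> / 2 * T u) at_top"
    unfolding T_def using \<epsilon> by (intro small) simp
  then show ?thesis
  proof eventually_elim
    case (elim u)
    have "\<epsilon>' * t (Suc n) u \<le> \<epsilon> / 2 * T u"
      using q_t_le_T[of "Suc n" u] \<epsilon> by (simp add: \<epsilon>'_def mult.assoc)
    with elim step[of u] show ?case by simp
  qed
qed

theorem maxp_le_tail:
  assumes \<eta>: "\<eta> > 0"
  shows "eventually (\<lambda>u. \<exists>m0. \<forall>m\<ge>m0. maxp (\<nu> (1 / real m) \<star> cpois (l / real m) \<mu>) u m 0 \<le> ennreal ((1 + \<eta>) * T u)) at_top"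
proof -
  \<comment> \<open>Five error terms appear in the sum below, each at most
    \<open>\<eta>' * T u\<close>.\<close>
  define \<eta>' where "\<eta>' = \<eta> / 5"
  have \<eta>': "\<eta>' > 0" using \<eta> by (simp add: \<eta>'_def)
  have "eventually (\<lambda>n. A1 n < 1 + \<eta>') sequentially"
    using A1_tendsto \<eta>' by (intro order_tendstoD) auto
  moreover have "eventually (\<lambda>n. A2 n < \<eta>') sequentially"
    using A2_tendsto \<eta>' by (intro order_tendstoD) auto
  moreover have "eventually (\<lambda>n. c n > 0) sequentially"
    using c_tendsto by (intro order_tendstoD) auto
  moreover have "(\<lambda>n. D * l / real n) \<longlonglongrightarrow> 0" by real_asymp
  then have "eventually (\<lambda>n. D * l / real n < \<eta>') sequentially"
    using \<eta>' by (intro order_tendstoD) auto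
  ultimately have "eventually (\<lambda>n. A1 n < 1 + \<eta>' \<and> A2 n < \<eta>' \<and> c n > 0 \<and> D * l / real n < \<eta>' \<and> k < n \<and> 4 \<le> n) sequentially"
    using eventually_gt_at_top[of k] eventually_ge_at_top[of 4] by eventually_elim auto
  then obtain n0 where n0: "\<And>n. n \<ge> n0 \<Longrightarrow> A1 n < 1 + \<eta>' \<and> A2 n < \<eta>' \<and> c n > 0 \<and> D * l / real n < \<eta>' \<and> k < n \<and> 4 \<le> n"
    unfolding eventually_sequentially by blast
  have n0_pos: "n0 > 0" using n0[of n0] by simp
  have "eventually (\<lambda>u. \<forall>n\<in>{..<n0}. t (n + k) u \<le> \<eta>' / (real n0 * q n * D) * T u) at_top"
    using \<eta>' n0_pos q_pos D_pos by (intro eventually_ball_finite ballI t_small) auto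
  then show ?thesis
  proof eventually_elim
    case (elim u)
    let ?f = "\<lambda>n. q n * t n u"
    have f0: "0 \<le> ?f n" for n using q_pos[of n] t_nonneg[of n u] by simp
    have q1: "q sums 1" unfolding q_def by (rule pois_sums)
    have "(\<lambda>n. \<Sum>i<n. q i) \<longlonglongrightarrow> 1" using q1 unfolding sums_def .
    \<comment> \<open>The Poisson mass beyond \<open>n1\<close> is made small relative to
      \<open>T u\<close>, which is positive. Hence \<open>n1\<close>, and with it the grid
      threshold, depends on \<open>u\<close>.\<close>
    then have "eventually (\<lambda>n. 1 - \<eta>' * T u < (\<Sum>i<n. q i)) sequentially"
      using \<eta>' T_pos by (intro order_tendstoD) auto
    then obtain n1 where n1: "1 - \<eta>' * T u < (\<Sum>i<n1. q i)"
      unfolding eventually_sequentially by blast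
    \<comment> \<open>One summable majorant for three ranges: the first summand serves
      \<open>n < n0\<close>, the middle ones \<open>n0 \<le> n\<close> with \<open>n < n1\<close>,
      and the last one \<open>n1 \<le> n\<close>. The grid bound \<open>n1 \<le> m\<close> gives
      \<open>n \<le> m\<close> in the middle range.\<close>
    define g where "g n = (if n \<in> {..<n0} then \<eta>' * T u / real n0 else 0) + (1 + \<eta>') * ?f n
      + \<eta>' * (if n = 0 then 0 else ?f (n - 1)) + \<eta>' * ?f (n + k) + (q n - (if n \<in> {..<n1} then q n else 0))" for n
    have g0: "g n \<ge> 0" for n
      unfolding g_def using \<eta>' T_nonneg[of u] q_pos[of n] f0[of "n - 1"]
      by (intro add_nonneg_nonneg mult_nonneg_nonneg[OF _ f0]) auto
    have jm_g: "jm u m n \<le> ennreal (g n)" if m: "m \<ge> max n1 1" for m n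
    proof -
      have m0: "m > 0" using m by simp
      consider "n < n0" | "n \<ge> n0" "n < n1" | "n \<ge> n1" by linarith
      then show ?thesis
      proof cases
        case 1
        have "q n * (D * t (n + k) u) \<le> \<eta>' * T u / real n0"
          using elim[rule_format, of n] 1 n0_pos q_pos[of n] D_pos by (simp add: field_simps)
        also have "\<dots> \<le> g n"
          unfolding g_def using 1 \<eta>' q_pos[of n] f0 by (simp add: add_nonneg_nonneg)
        finally show ?thesis
          by (intro order_trans[OF jm_le_t[OF m0] ennreal_leI])
      next
        case 2
        note n = n0[OF 2(1)]
        have "A1 n * ?f n + D * l / real n * ?f (n - 1) + A2 n * ?f (n + k)
          \<le> (1 + \<eta>') * ?f n + \<eta>' * ?f (n - 1) + \<eta>' * ?f (n + k)"
          using n f0 by (intro add_mono mult_right_mono) auto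
        also have "\<dots> \<le> g n"
          unfolding g_def using 2 n by simp
        finally show ?thesis
          using n m 2 by (intro order_trans[OF jm_bound ennreal_leI]) auto
      next
        case 3
        have "q n \<le> g n"
          unfolding g_def using 3 \<eta>' T_nonneg f0 by (simp add: add_nonneg_nonneg)
        then show ?thesis by (intro order_trans[OF jm_le_q[OF m0] ennreal_leI])
      qed
    qed
    have "(\<lambda>n. if n = 0 then 0 else ?f (n - 1)) sums T u"
      using T_sums[of u] sums_Suc[of "\<lambda>n. if n = 0 then 0 else ?f (n - 1)" "T u"] by simp
    moreover have "(\<lambda>n. ?f (n + k)) sums (T u - (\<Sum>i<k. ?f i))"
      by (subst sums_iff_shift) (simp add: T_sums)
    moreover have "(\<lambda>n. if n \<in> {..<n0} then \<eta>' * T u / real n0 else 0) sums (\<Sum>n<n0. \<eta>' * T u / real n0)"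
      by (rule sums_If_finite_set) simp
    moreover have "(\<lambda>n. if n \<in> {..<n1} then q n else 0) sums (\<Sum>n<n1. q n)"
      by (rule sums_If_finite_set) simp
    ultimately have g_sums: "g sums ((\<Sum>n<n0. \<eta>' * T u / real n0) + (1 + \<eta>') * T u + \<eta>' * T u
        + \<eta>' * (T u - (\<Sum>i<k. ?f i)) + (1 - (\<Sum>n<n1. q n)))"
      unfolding g_def[abs_def] by (intro sums_add sums_mult sums_diff q1 T_sums)
    have "(\<Sum>n<n0. \<eta>' * T u / real n0) + (1 + \<eta>') * T u + \<eta>' * T u
        + \<eta>' * (T u - (\<Sum>i<k. ?f i)) + (1 - (\<Sum>n<n1. q n)) \<le> \<eta>' * T u + (1 + \<eta>') * T u + \<eta>' * T u + \<eta>' * T u + \<eta>' * T u"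
      using n0_pos n1 \<eta>' f0 by (intro add_mono order_refl mult_left_mono) (auto intro!: sum_nonneg)
    also have "\<dots> = (1 + \<eta>) * T u" by (simp add: \<eta>'_def field_simps)
    finally have sum_g: "suminf g \<le> (1 + \<eta>) * T u" using sums_unique[OF g_sums] by simp
    show ?case
    proof (intro exI allI impI)
      fix m assume m: "max n1 1 \<le> m"
      interpret J: jump_walk "\<nu> (1 / real m)" \<mu> "l / real m" by (rule jump_walk) (use m in auto)
      have "maxp (\<nu> (1 / real m) \<star> cpois (l / real m) \<mu>) u m 0 = (\<Sum>n. jm u m n)"
        by (rule J.maxp_eq_suminf_jmax)
      also have "\<dots> \<le> (\<Sum>n. ennreal (g n))"
        by (intro suminf_le jm_g m) auto
      also have "\<dots> = ennreal (suminf g)"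
        by (rule suminf_ennreal_eq[OF g0 summable_sums[OF sums_summable[OF g_sums]]])
      also have "\<dots> \<le> ennreal ((1 + \<eta>) * T u)"
        by (rule ennreal_leI[OF sum_g])
      finally show "maxp (\<nu> (1 / real m) \<star> cpois (l / real m) \<mu>) u m 0 \<le> ennreal ((1 + \<eta>) * T u)" .
    qed
  qed
qed

end

section \<open>Existence of compensated compound Poisson laws\<close>

lemma char_eq_integral_minus_one:
  assumes "real_distribution \<mu>"
  shows "char \<mu> s - 1 = (CLINT x|\<mu>. iexp (s * x) - 1)"
proof -
  interpret real_distribution \<mu> by fact
  have "integrable \<mu> (\<lambda>x. iexp (s * x))" by (rule integrable_iexp) auto
  then show ?thesis
    unfolding char_def using prob_space by (subst Bochner_Integration.integral_diff) (auto simp del: space_eq_univ)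
qed

lemma cpois_atom_0:
  assumes \<mu>: "real_distribution \<mu>" and r: "r > 0"
  shows "exp (- r) \<le> measure (cpois r \<mu>) {0}"
proof -
  interpret L: real_distribution "cpois r \<mu>" by (rule real_distribution_cpois[OF \<mu>])
  have "ennreal (exp (- r)) = ennreal (pois r 0) * (\<integral>\<^sup>+x. indicator {0} x \<partial>conv_pow \<mu> 0)"
    by (simp add: pois_def nn_integral_return del: nn_integral_indicator)
  also have "\<dots> \<le> (\<Sum>n. ennreal (pois r n) * (\<integral>\<^sup>+x. indicator {0} x \<partial>conv_pow \<mu> n))"
    using sum_le_suminf[of "\<lambda>n. ennreal (pois r n) * (\<integral>\<^sup>+x. indicator {0} x \<partial>conv_pow \<mu> n)" "{0}"]
    by (simp del: nn_integral_indicator conv_pow.simps)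
  also have "\<dots> = (\<integral>\<^sup>+x. indicator {0} x \<partial>cpois r \<mu>)"
    by (rule nn_integral_cpois[symmetric, OF \<mu> r]) auto
  also have "\<dots> = ennreal (measure (cpois r \<mu>) {0})"
    by (simp add: L.emeasure_eq_measure)
  finally show ?thesis by simp
qed

text \<open>Normalising \<open>K\<close> to a jump law turns its total mass times \<open>t\<close>
  into the Poisson rate. The atom at \<open>0\<close> is the event of no jump.\<close>

lemma compound_poisson_exists:
  assumes fin: "finite_measure K" and sets: "sets K = sets borel" and t: "t > 0"
  obtains L where "real_distribution L"
    "\<And>s. char L s = exp (of_real t * (CLINT x|K. iexp (s * x) - 1))"
    "\<And>\<theta>. integrable K (\<lambda>x. exp (\<theta> * x)) \<Longrightarrow> mgf L \<theta> = ennreal (exp (t * (LINT x|K. exp (\<theta> * x) - 1)))"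
    "exp (- t * measure K UNIV) \<le> measure L {0}"
    "(AE x in K. x \<le> 0) \<Longrightarrow> (AE x in L. x \<le> 0)"
proof -
  interpret K: finite_measure K by fact
  have [measurable_cong]: "sets K = sets borel" by (rule sets)
  have space: "space K = UNIV" using sets_eq_imp_space_eq[OF sets] by simp
  show ?thesis
  \<comment> \<open>The zero measure cannot be normalised; its law is the point mass at
    \<open>0\<close>.\<close>
  proof (cases "measure K UNIV = 0")
    case True
    then have "emeasure K (space K) = 0" by (simp add: K.emeasure_eq_measure space)
    then have "AE x in K. False" by (simp add: AE_iff_measurable[OF sets.top])
    then have 0: "(CLINT x|K. f x) = 0" "(LINT x|K. g x) = 0" for f g
      by (auto intro!: integral_eq_zero_AE)
    show ?thesis
      by (rule that[of "return borel 0"])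
         (auto simp: 0 real_distribution_return char_return mgf_return True measure_return AE_return)
  next
    case False
    define c where "c = measure K UNIV"
    have c: "c > 0" using False measure_nonneg[of K UNIV] by (simp add: c_def less_le)
    define \<mu> where "\<mu> = density K (\<lambda>_. ennreal (1 / c))"
    have "emeasure \<mu> (space \<mu>) = 1"
      unfolding \<mu>_def using c
      by (simp add: emeasure_density space K.emeasure_eq_measure c_def[symmetric] ennreal_mult'[symmetric])
    then have \<mu>: "real_distribution \<mu>"
      by (intro real_distributionI prob_spaceI) (auto simp: \<mu>_def sets)
    interpret \<mu>: real_distribution \<mu> by (rule \<mu>)
    have int_\<mu>: "(LINT x|\<mu>. f x) = (LINT x|K. f x) / c" if "f \<in> borel_measurable borel" for f :: "real \<Rightarrow> real"
      unfolding \<mu>_def using that c by (subst integral_density) auto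
    have cint_\<mu>: "(CLINT x|\<mu>. f x) = (CLINT x|K. f x) / c" if "f \<in> borel_measurable borel" for f :: "real \<Rightarrow> complex"
      unfolding \<mu>_def using that c by (subst integral_density) (auto simp: scaleR_conv_of_real)
    have tc: "t * c > 0" using t c by simp
    show ?thesis
    proof (rule that[of "cpois (t * c) \<mu>"])
      show "real_distribution (cpois (t * c) \<mu>)" by (rule real_distribution_cpois[OF \<mu>])
      show "char (cpois (t * c) \<mu>) s = exp (of_real t * (CLINT x|K. iexp (s * x) - 1))" for s
        unfolding char_cpois[OF \<mu> tc] char_eq_integral_minus_one[OF \<mu>]
        using c by (subst cint_\<mu>) auto
      show "mgf (cpois (t * c) \<mu>) \<theta> = ennreal (exp (t * (LINT x|K. exp (\<theta> * x) - 1)))"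
        if int: "integrable K (\<lambda>x. exp (\<theta> * x))" for \<theta>
      proof -
        have "mgf \<mu> \<theta> = (\<integral>\<^sup>+x. ennreal (1 / c) * ennreal (exp (\<theta> * x)) \<partial>K)"
          unfolding mgf_def \<mu>_def by (subst nn_integral_density) auto
        also have "\<dots> = ennreal (1 / c) * ennreal (LINT x|K. exp (\<theta> * x))"
          using int by (subst nn_integral_cmult) (auto simp: nn_integral_eq_integral)
        also have "\<dots> = ennreal ((LINT x|K. exp (\<theta> * x)) / c)"
          using c by (simp add: ennreal_mult'[symmetric])
        finally have "mgf (cpois (t * c) \<mu>) \<theta> = ennreal (exp (t * c * ((LINT x|K. exp (\<theta> * x)) / c - 1)))"
          using c by (intro mgf_cpois \<mu> tc) (auto intro!: divide_nonneg_pos integral_nonneg_AE)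
        also have "t * c * ((LINT x|K. exp (\<theta> * x)) / c - 1) = t * ((LINT x|K. exp (\<theta> * x)) - c)"
          using c by (simp add: field_simps)
        also have "(LINT x|K. exp (\<theta> * x)) - c = (LINT x|K. exp (\<theta> * x) - 1)"
          using int by (subst Bochner_Integration.integral_diff) (auto simp: c_def space)
        finally show ?thesis .
      qed
      show "exp (- t * measure K UNIV) \<le> measure (cpois (t * c) \<mu>) {0}"
        using cpois_atom_0[OF \<mu> tc] by (simp add: c_def)
      show "AE x in cpois (t * c) \<mu>. x \<le> 0" if "AE x in K. x \<le> 0"
      proof -
        have "AE x in \<mu>. x \<le> 0" unfolding \<mu>_def by (subst AE_density) (use that in auto)
        then show ?thesis by (rule AE_cpois[OF \<mu>, rotated]) auto
      qed
    qed
  qed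
qed

section \<open>Taylor and Chernoff bounds\<close>

lemma exp_minus_one_minus_le:
  fixes y :: real
  shows "exp y - 1 - y \<le> y\<^sup>2 / 2 * exp (max 0 y)"
proof (cases "y \<ge> 0")
  case True
  obtain \<xi> where \<xi>: "\<bar>\<xi>\<bar> \<le> \<bar>y\<bar>" "exp y = (\<Sum>m<2. y ^ m / fact m) + exp \<xi> / fact 2 * y ^ 2"
    using Maclaurin_exp_le[of y 2] by blast
  have "exp y - 1 - y = y\<^sup>2 / 2 * exp \<xi>"
    using \<xi>(2) by (simp add: numeral_2_eq_2)
  also have "\<dots> \<le> y\<^sup>2 / 2 * exp (max 0 y)"
    using \<xi>(1) True by (intro mult_left_mono) auto
  finally show ?thesis .
next
  case False
  \<comment> \<open>At second order the intermediate point is only known to satisfy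
    \<open>\<bar>\<xi>\<bar> \<le> \<bar>y\<bar>\<close>, which would leave a factor above 1. The
    third-order remainder is nonpositive for negative \<open>y\<close>.\<close>
  obtain \<xi> where \<xi>: "exp y = (\<Sum>m<3. y ^ m / fact m) + exp \<xi> / fact 3 * y ^ 3"
    using Maclaurin_exp_le[of y 3] by blast
  have "exp \<xi> / fact 3 * y ^ 3 \<le> 0"
    using False by (intro mult_nonneg_nonpos) (auto simp: power_less_zero_eq_numeral less_imp_le)
  moreover have "(\<Sum>m<3. y ^ m / fact m) = 1 + y + y\<^sup>2 / 2"
    by (simp add: numeral_3_eq_3 power2_eq_square)
  moreover have "max 0 y = 0" using False by simp
  ultimately show ?thesis
    using \<xi> by (simp only: exp_zero mult_1_right)
qed

lemma tail_le_mgf: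
  assumes M: "real_distribution M" and \<theta>: "\<theta> \<ge> 0" and m: "mgf M \<theta> \<le> ennreal m" "0 \<le> m"
  shows "measure M {w..} \<le> m * exp (- \<theta> * w)"
proof -
  interpret real_distribution M by fact
  have "emeasure M {w..} = (\<integral>\<^sup>+x. indicator {w..} x \<partial>M)" by simp
  also have "\<dots> \<le> (\<integral>\<^sup>+x. ennreal (exp (- \<theta> * w)) * ennreal (exp (\<theta> * x)) \<partial>M)"
  proof (rule nn_integral_mono)
    fix x
    show "indicator {w..} x \<le> ennreal (exp (- \<theta> * w)) * ennreal (exp (\<theta> * x))"
    proof (cases "w \<le> x")
      case True
      then have "0 \<le> \<theta> * x - \<theta> * w" using \<theta> by (simp add: mult_left_mono)
      then have "1 \<le> exp (- \<theta> * w) * exp (\<theta> * x)" by (simp flip: exp_add)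
      then have "1 \<le> ennreal (exp (- \<theta> * w) * exp (\<theta> * x))" by simp
      then show ?thesis using True by (simp add: ennreal_mult')
    qed simp
  qed
  also have "\<dots> = ennreal (exp (- \<theta> * w)) * mgf M \<theta>"
    unfolding mgf_def by (rule nn_integral_cmult) auto
  also have "\<dots> \<le> ennreal (exp (- \<theta> * w)) * ennreal m" by (intro mult_left_mono m) simp
  also have "\<dots> = ennreal (m * exp (- \<theta> * w))"
    using m(2) by (subst mult.commute, subst ennreal_mult') auto
  finally show ?thesis
    using m(2) by (simp add: emeasure_eq_measure)
qed

lemma lower_tail_le_mgf:
  assumes M: "real_distribution M" and \<theta>: "\<theta> \<ge> 0" and m: "mgf M (- \<theta>) \<le> ennreal m" "0 \<le> m"
  shows "measure M {..w} \<le> m * exp (\<theta> * w)"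
proof -
  interpret real_distribution M by fact
  let ?N = "distr M borel uminus"
  have N: "real_distribution ?N" by (intro real_distributionI prob_space_distr) auto
  have "measure M {..w} = measure ?N {- w..}"
    by (subst measure_distr) (auto intro!: arg_cong[where f = "measure M"])
  also have "\<dots> \<le> m * exp (- \<theta> * (- w))"
    using m by (intro tail_le_mgf N \<theta>) (simp_all add: mgf_def nn_integral_distr)
  finally show ?thesis by simp
qed

section \<open>Compensated small jumps as a weak limit\<close>

text \<open>\<open>K\<close> may have infinite mass near \<open>0\<close>. Jumps are cut off below
  \<open>1 / real (Suc j)\<close>, and each cut-off law is centred. The exponential moments are
  bounded uniformly in \<open>j\<close>, so a subsequence converges weakly; the characteristic
  functions and the moment bound pass to the limit. For negative \<open>\<theta>\<close> the moment
  bound is purely quadratic, because all jumps are positive.\<close>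

lemma compensated_poisson_exists:
  assumes sets: "sets K = sets borel" and t: "t > 0" and a: "a \<ge> 0"
    and supp: "AE x in K. 0 < x \<and> x \<le> a"
    and sq: "integrable K (\<lambda>x. x\<^sup>2)"
  obtains W where "real_distribution W"
    "\<And>s. char W s = exp (of_real t * (CLINT x|K. iexp (s * x) - 1 - \<i> * of_real (s * x)))"
    "\<And>\<theta>. mgf W \<theta> \<le> ennreal (exp (t * ((LINT x|K. x\<^sup>2) * \<theta>\<^sup>2 * exp (max 0 (\<theta> * a)))))"
proof -
  have [measurable_cong]: "sets K = sets borel" by (rule sets)
  define V where "V = (LINT x|K. x\<^sup>2)"
  have V: "V \<ge> 0" unfolding V_def by (intro integral_nonneg_AE) auto
  define E where "E \<theta> = exp (t * (V * \<theta>\<^sup>2 * exp (max 0 (\<theta> * a))))" for \<theta>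
  define A where "A j = {1 / real (Suc j)<..}" for j
  define Kj where "Kj j = density K (\<lambda>x. ennreal (indicator (A j) x))" for j
  have [measurable]: "A j \<in> sets borel" for j by (simp add: A_def)
  have sets_Kj: "sets (Kj j) = sets borel" for j by (simp add: Kj_def sets)
  have int_K: "(LINT x|Kj j. f x) = (LINT x|K. indicator (A j) x * f x)" if "f \<in> borel_measurable borel" for f :: "real \<Rightarrow> real" and j
    unfolding Kj_def using that by (subst integral_density) auto
  have cint_K: "(CLINT x|Kj j. f x) = (CLINT x|K. indicator (A j) x *\<^sub>R f x)" if "f \<in> borel_measurable borel" for f :: "real \<Rightarrow> complex" and j
    unfolding Kj_def using that by (subst integral_density) auto
  have integrable_Kj: "integrable (Kj j) f \<longleftrightarrow> integrable K (\<lambda>x. indicator (A j) x *\<^sub>R f x)"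
    if "f \<in> borel_measurable borel" for f :: "real \<Rightarrow> 'b::{banach, second_countable_topology}" and j
    unfolding Kj_def using that by (subst integrable_density) auto
  \<comment> \<open>Markov's inequality for the second moment: jumps in \<open>A j\<close> satisfy
    \<open>1 \<le> (real (Suc j))\<^sup>2 * x\<^sup>2\<close>.\<close>
  have fin: "finite_measure (Kj j)" for j
  proof
    have "emeasure (Kj j) (space (Kj j)) = (\<integral>\<^sup>+x. ennreal (indicator (A j) x) \<partial>K)"
      unfolding Kj_def by (simp add: emeasure_density) 
    also have "\<dots> \<le> (\<integral>\<^sup>+x. ennreal ((real (Suc j))\<^sup>2 * x\<^sup>2) \<partial>K)"
    proof (intro nn_integral_mono ennreal_leI)
      fix x
      show "indicator (A j) x \<le> (real (Suc j))\<^sup>2 * x\<^sup>2"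
      proof (cases "x \<in> A j")
        case True
        then have "1 \<le> real (Suc j) * x" by (simp add: A_def field_simps)
        then have "1 \<le> (real (Suc j) * x)\<^sup>2" by (simp add: one_le_power)
        then show ?thesis using True by (simp add: power_mult_distrib)
      qed simp
    qed
    also have "\<dots> = ennreal (LINT x|K. (real (Suc j))\<^sup>2 * x\<^sup>2)"
      using sq by (intro nn_integral_eq_integral) auto
    finally show "emeasure (Kj j) (space (Kj j)) \<noteq> \<infinity>" using ennreal_less_top by (auto simp: top_unique)
  qed
  define b where "b j = (LINT x|Kj j. x)" for j
  have supp_j: "AE x in Kj j. 0 < x \<and> x \<le> a" for j
    unfolding Kj_def by (subst AE_density, measurable) (rule eventually_mono[OF supp], simp)
  have bdd: "integrable (Kj j) f" if "f \<in> borel_measurable borel" "\<And>x. 0 < x \<Longrightarrow> x \<le> a \<Longrightarrow> norm (f x) \<le> c"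
    for f :: "real \<Rightarrow> 'b::{banach, second_countable_topology}" and c j
  proof (rule finite_measure.integrable_const_bound[OF fin])
    show "AE x in Kj j. norm (f x) \<le> c"
      by (rule eventually_mono[OF supp_j]) (use that(2) in auto)
    show "f \<in> borel_measurable (Kj j)" using that(1) by (simp add: measurable_cong_sets[OF sets_Kj refl])
  qed
  have int_x: "integrable (Kj j) (\<lambda>x. x)" for j by (rule bdd[of _ a]) auto
  have int_exp: "integrable (Kj j) (\<lambda>x. exp (\<theta> * x))" for j \<theta>
  proof (rule bdd[of _ "exp (\<bar>\<theta>\<bar> * a)"])
    fix x :: real assume x: "0 < x" "x \<le> a"
    have "\<theta> * x \<le> \<bar>\<theta>\<bar> * x" using x by (intro mult_right_mono) auto
    also have "\<dots> \<le> \<bar>\<theta>\<bar> * a" using x by (intro mult_left_mono) auto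
    finally show "norm (exp (\<theta> * x)) \<le> exp (\<bar>\<theta>\<bar> * a)" by simp
  qed simp
  have "\<exists>L. real_distribution L \<and>
      (\<forall>s. char L s = exp (of_real t * (CLINT x|K. indicator (A j) x *\<^sub>R (iexp (s * x) - 1 - \<i> * of_real (s * x))))) \<and>
      (\<forall>\<theta>. mgf L \<theta> \<le> ennreal (E \<theta>))" for j
  proof -
    obtain L where L: "real_distribution L"
      "\<And>s. char L s = exp (of_real t * (CLINT x|Kj j. iexp (s * x) - 1))"
      "\<And>\<theta>. integrable (Kj j) (\<lambda>x. exp (\<theta> * x)) \<Longrightarrow> mgf L \<theta> = ennreal (exp (t * (LINT x|Kj j. exp (\<theta> * x) - 1)))"
      using compound_poisson_exists[OF fin sets_Kj t] by metis
    have c: "integrable (Kj j) (\<lambda>x. iexp (s * x) - 1)" for s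
      by (rule bdd[of _ 2]) (auto intro!: order_trans[OF norm_triangle_ineq4])
    \<comment> \<open>The point mass subtracts the mean of the cut-off law and so supplies the
      compensating term of the exponent.\<close>
    let ?L = "return borel (- t * b j) \<star> L"
    have "char ?L s = exp (of_real t * (CLINT x|K. indicator (A j) x *\<^sub>R (iexp (s * x) - 1 - \<i> * of_real (s * x))))" for s
    proof -
      have ix: "integrable (Kj j) (\<lambda>x. \<i> * complex_of_real (s * x))"
        using int_x[of j] by (intro integrable_mult_right) auto
      have "char ?L s = exp (of_real t * ((CLINT x|Kj j. iexp (s * x) - 1) - \<i> * of_real (s * b j)))"
        by (simp add: char_convolution real_distribution_return L char_return algebra_simps flip: exp_add)
      also have "\<i> * of_real (s * b j) = (CLINT x|Kj j. \<i> * complex_of_real (s * x))"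
        unfolding b_def by simp
      also have "(CLINT x|Kj j. iexp (s * x) - 1) - (CLINT x|Kj j. \<i> * complex_of_real (s * x))
          = (CLINT x|Kj j. iexp (s * x) - 1 - \<i> * of_real (s * x))"
        by (rule Bochner_Integration.integral_diff[symmetric, OF c ix])
      also have "\<dots> = (CLINT x|K. indicator (A j) x *\<^sub>R (iexp (s * x) - 1 - \<i> * of_real (s * x)))"
        by (rule cint_K) auto
      finally show ?thesis .
    qed
    moreover have "mgf ?L \<theta> \<le> ennreal (E \<theta>)" for \<theta>
    proof -
      have "mgf ?L \<theta> = ennreal (exp (\<theta> * (- t * b j))) * ennreal (exp (t * (LINT x|Kj j. exp (\<theta> * x) - 1)))"
        by (simp add: mgf_convolution real_distribution_return L(1) mgf_return L(3)[OF int_exp])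
      also have "\<dots> = ennreal (exp (\<theta> * (- t * b j)) * exp (t * (LINT x|Kj j. exp (\<theta> * x) - 1)))"
        by (rule ennreal_mult'[symmetric]) simp
      also have "exp (\<theta> * (- t * b j)) * exp (t * (LINT x|Kj j. exp (\<theta> * x) - 1))
          = exp (t * ((LINT x|Kj j. exp (\<theta> * x) - 1) - \<theta> * b j))"
        by (simp add: right_diff_distrib mult.left_commute flip: exp_add)
      also have "(LINT x|Kj j. exp (\<theta> * x) - 1) - \<theta> * b j = (LINT x|Kj j. exp (\<theta> * x) - 1 - \<theta> * x)"
      proof -
        have "integrable (Kj j) (\<lambda>x. exp (\<theta> * x) - 1)"
          by (intro Bochner_Integration.integrable_diff int_exp finite_measure.integrable_const fin)
        moreover have "integrable (Kj j) (\<lambda>x. \<theta> * x)" using int_x by simp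
        ultimately have "(LINT x|Kj j. (exp (\<theta> * x) - 1) - \<theta> * x) = (LINT x|Kj j. exp (\<theta> * x) - 1) - (LINT x|Kj j. \<theta> * x)"
          by (rule Bochner_Integration.integral_diff)
        then show ?thesis unfolding b_def by (simp only: integral_mult_right_zero)
      qed
      also have "\<dots> = (LINT x|K. indicator (A j) x * (exp (\<theta> * x) - 1 - \<theta> * x))"
        by (rule int_K) auto
      also have "\<dots> \<le> (LINT x|K. \<theta>\<^sup>2 * exp (max 0 (\<theta> * a)) * x\<^sup>2)"
      proof (rule integral_mono_AE)
        show "integrable K (\<lambda>x. indicator (A j) x * (exp (\<theta> * x) - 1 - \<theta> * x))"
        proof -
          have "integrable (Kj j) (\<lambda>x. exp (\<theta> * x) - 1 - \<theta> * x)"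
            using int_x by (intro Bochner_Integration.integrable_diff int_exp finite_measure.integrable_const fin) simp
          then show ?thesis by (subst (asm) integrable_Kj) auto
        qed
        show "integrable K (\<lambda>x. \<theta>\<^sup>2 * exp (max 0 (\<theta> * a)) * x\<^sup>2)" using sq by simp
        show "AE x in K. indicator (A j) x * (exp (\<theta> * x) - 1 - \<theta> * x) \<le> \<theta>\<^sup>2 * exp (max 0 (\<theta> * a)) * x\<^sup>2"
          using supp
        proof eventually_elim
          case (elim x)
          have "0 \<le> exp (\<theta> * x) - 1 - \<theta> * x" using exp_ge_add_one_self[of "\<theta> * x"] by linarith
          then have "indicator (A j) x * (exp (\<theta> * x) - 1 - \<theta> * x) \<le> exp (\<theta> * x) - 1 - \<theta> * x"
            by (simp add: indicator_def)
          also have "\<dots> \<le> (\<theta> * x)\<^sup>2 / 2 * exp (max 0 (\<theta> * x))" by (rule exp_minus_one_minus_le)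
          also have "\<dots> \<le> (\<theta> * x)\<^sup>2 * exp (max 0 (\<theta> * a))"
          proof (rule mult_mono)
            have "max 0 (\<theta> * x) \<le> max 0 (\<theta> * a)"
            proof (cases "\<theta> \<ge> 0")
              case True
              then have "\<theta> * x \<le> \<theta> * a" using elim by (intro mult_left_mono) auto
              then show ?thesis by simp
            next
              case False
              then have "\<theta> * x \<le> 0" using elim by (intro mult_nonpos_nonneg) auto
              then show ?thesis by simp
            qed
            then show "exp (max 0 (\<theta> * x)) \<le> exp (max 0 (\<theta> * a))" by simp
          qed auto
          finally show ?case by (simp add: power_mult_distrib mult_ac)
        qed
      qed
      also have "\<dots> = V * \<theta>\<^sup>2 * exp (max 0 (\<theta> * a))" by (simp add: V_def mult_ac)
      finally show ?thesis
        unfolding E_def using t by (simp add: ennreal_leI mult_left_mono)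
    qed
    ultimately show ?thesis
      by (intro exI[of _ ?L]) (auto intro: real_distribution_conv real_distribution_return L)
  qed
  then obtain L where L: "\<And>j. real_distribution (L j)"
    and L_char: "\<And>j s. char (L j) s = exp (of_real t * (CLINT x|K. indicator (A j) x *\<^sub>R (iexp (s * x) - 1 - \<i> * of_real (s * x))))"
    and L_mgf: "\<And>j \<theta>. mgf (L j) \<theta> \<le> ennreal (E \<theta>)"
    by metis
  have E_pos: "E \<theta> > 0" for \<theta> by (simp add: E_def)
  \<comment> \<open>Chernoff bounds with \<open>\<theta> = 1\<close> and
    \<open>\<theta> = -1\<close>, both independent of the index.\<close>
  have tight: "tight L"
    unfolding tight_def
  proof (intro conjI allI impI L)
    fix \<epsilon> :: real assume \<epsilon>: "\<epsilon> > 0"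
    have "((\<lambda>w. (E 1 + E (-1)) * exp (- w)) \<longlongrightarrow> (E 1 + E (-1)) * 0) at_top"
      by (intro tendsto_intros filterlim_compose[OF exp_at_bot] filterlim_uminus_at_bot_at_top)
    then have "eventually (\<lambda>w. (E 1 + E (-1)) * exp (- w) < \<epsilon>) at_top"
      using \<epsilon> by (intro order_tendstoD) auto
    then have "eventually (\<lambda>w. (E 1 + E (-1)) * exp (- w) < \<epsilon> \<and> w > 0) at_top"
      using eventually_gt_at_top[of 0] by eventually_elim auto
    then obtain w where w: "(E 1 + E (-1)) * exp (- w) < \<epsilon>" "w > 0"
      by (auto dest: eventually_happens)
    show "\<exists>c d. c < d \<and> (\<forall>n. 1 - \<epsilon> < measure (L n) {c<..d})"
    proof (rule exI[of _ "- w"], rule exI[of _ w], intro conjI allI)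
      show "- w < w" using w by simp
      fix n
      interpret Ln: real_distribution "L n" by (rule L)
      have "1 = measure (L n) ({..- w} \<union> {- w<..w} \<union> {w<..})"
        using Ln.prob_space w by (subst arg_cong[of _ UNIV "measure (L n)"]) auto
      also have "\<dots> \<le> measure (L n) {..- w} + measure (L n) {- w<..w} + measure (L n) {w<..}"
        by (intro order_trans[OF measure_Un_le] add_mono order_refl) auto
      also have "measure (L n) {w<..} \<le> measure (L n) {w..}"
        by (intro Ln.finite_measure_mono) auto
      also have "\<dots> \<le> E 1 * exp (- 1 * w)"
        by (intro tail_le_mgf L L_mgf less_imp_le E_pos) simp
      also have "measure (L n) {..- w} \<le> E (-1) * exp (1 * (- w))"
        by (intro lower_tail_le_mgf L L_mgf less_imp_le E_pos) simp
      finally show "1 - \<epsilon> < measure (L n) {- w<..w}" using w by (simp add: algebra_simps)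
    qed
  qed
  obtain r W where r: "strict_mono r" and W: "real_distribution W" and conv: "weak_conv_m (L \<circ> id \<circ> r) W"
    using tight_imp_convergent_subsubsequence[OF tight, of id] by (auto simp: strict_mono_def)
  interpret W: real_distribution W by (rule W)
  have conv: "weak_conv_m (\<lambda>j. L (r j)) W" using conv by (simp add: comp_def)
  show ?thesis
  proof (rule that[OF W])
    fix s
    let ?h = "\<lambda>x. iexp (s * x) - 1 - \<i> * of_real (s * x)"
    have "(\<lambda>j. CLINT x|K. indicator (A j) x *\<^sub>R ?h x) \<longlonglongrightarrow> (CLINT x|K. ?h x)"
    proof (rule integral_dominated_convergence[where w = "\<lambda>x. s\<^sup>2 * x\<^sup>2"])
      show "integrable K (\<lambda>x. s\<^sup>2 * x\<^sup>2)" using sq by simp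
      show "AE x in K. (\<lambda>j. indicator (A j) x *\<^sub>R ?h x) \<longlonglongrightarrow> ?h x"
        using supp
      proof eventually_elim
        case (elim x)
        have "(\<lambda>j. 1 / real (Suc j)) \<longlonglongrightarrow> 0" by real_asymp
        then have "eventually (\<lambda>j. 1 / real (Suc j) < x) sequentially"
          using elim by (intro order_tendstoD) auto
        then have "eventually (\<lambda>j. indicator (A j) x *\<^sub>R ?h x = ?h x) sequentially"
          by eventually_elim (simp add: A_def)
        then show ?case by (rule tendsto_eventually)
      qed
      fix j
      show "AE x in K. norm (indicator (A j) x *\<^sub>R ?h x) \<le> s\<^sup>2 * x\<^sup>2"
      proof (rule AE_I2)
        fix x
        have "norm (?h x) \<le> \<bar>s * x\<bar> ^ Suc 1 / fact (Suc 1)"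
          using iexp_approx1[of "s * x" 1] by (simp add: algebra_simps)
        also have "\<dots> \<le> s\<^sup>2 * x\<^sup>2" by (simp add: power_mult_distrib flip: power2_eq_square)
        finally have "norm (?h x) \<le> s\<^sup>2 * x\<^sup>2" .
        then show "norm (indicator (A j) x *\<^sub>R ?h x) \<le> s\<^sup>2 * x\<^sup>2" by (simp add: indicator_def)
      qed
    qed auto
    then have "(\<lambda>j. char (L j) s) \<longlonglongrightarrow> exp (of_real t * (CLINT x|K. ?h x))"
      unfolding L_char by (intro tendsto_intros)
    then have "(\<lambda>j. char (L (r j)) s) \<longlonglongrightarrow> exp (of_real t * (CLINT x|K. ?h x))"
      using LIMSEQ_subseq_LIMSEQ[OF _ r] by (fastforce simp: comp_def)
    moreover have "(\<lambda>j. char (L (r j)) s) \<longlonglongrightarrow> char W s"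
      by (intro levy_continuity1 L W conv)
    ultimately show "char W s = exp (of_real t * (CLINT x|K. ?h x))"
      using LIMSEQ_unique by blast
  next
    fix \<theta>
    \<comment> \<open>Weak convergence only handles bounded continuous integrands, so the
      exponential is capped at \<open>n\<close>; monotone convergence removes the cap.\<close>
    have le: "(\<integral>\<^sup>+x. ennreal (min (exp (\<theta> * x)) (real n)) \<partial>W) \<le> ennreal (E \<theta>)" for n
    proof -
      let ?f = "\<lambda>x. min (exp (\<theta> * x)) (real n)"
      have int: "integrable M ?f" if "real_distribution M" for M
      proof -
        interpret M: real_distribution M by fact
        show ?thesis by (intro M.integrable_const_bound[of _ "real n"]) (auto simp: abs_le_iff min_def intro: order_trans[of _ 0])
      qed
      have "(\<lambda>j. LINT x|L (r j). ?f x) \<longlonglongrightarrow> (LINT x|W. ?f x)"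
        by (rule weak_conv_imp_integral_bdd_continuous_conv[OF L W conv, where B = "real n"])
           (auto intro!: continuous_intros simp: abs_of_nonneg)
      moreover have "(LINT x|L (r j). ?f x) \<le> E \<theta>" for j
      proof -
        have "ennreal (LINT x|L (r j). ?f x) = (\<integral>\<^sup>+x. ennreal (?f x) \<partial>L (r j))"
          by (intro nn_integral_eq_integral[symmetric] int L) auto
        also have "\<dots> \<le> mgf (L (r j)) \<theta>"
          unfolding mgf_def by (intro nn_integral_mono ennreal_leI) auto
        also have "\<dots> \<le> ennreal (E \<theta>)" by (rule L_mgf)
        finally show ?thesis using E_pos[of \<theta>] by (simp add: less_imp_le)
      qed
      ultimately have "(LINT x|W. ?f x) \<le> E \<theta>"
        by (intro LIMSEQ_le_const2) auto
      then have "ennreal (LINT x|W. ?f x) \<le> ennreal (E \<theta>)" by (rule ennreal_leI)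
      then show ?thesis
        by (subst nn_integral_eq_integral[OF int[OF W]]) auto
    qed
    have "mgf W \<theta> = (\<integral>\<^sup>+x. (SUP n. ennreal (min (exp (\<theta> * x)) (real n))) \<partial>W)"
      unfolding mgf_def
    proof (rule nn_integral_cong)
      fix x
      obtain n :: nat where "exp (\<theta> * x) < real n" using reals_Archimedean2 by blast
      then show "ennreal (exp (\<theta> * x)) = (SUP n. ennreal (min (exp (\<theta> * x)) (real n)))"
        by (intro antisym SUP_upper2[of n] SUP_least ennreal_leI) auto
    qed
    also have "\<dots> = (SUP n. \<integral>\<^sup>+x. ennreal (min (exp (\<theta> * x)) (real n)) \<partial>W)"
      by (rule nn_integral_monotone_convergence_SUP) (auto simp: incseq_def le_fun_def intro!: ennreal_leI)
    also have "\<dots> \<le> ennreal (E \<theta>)" by (intro SUP_least le)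
    finally show "mgf W \<theta> \<le> ennreal (exp (t * ((LINT x|K. x\<^sup>2) * \<theta>\<^sup>2 * exp (max 0 (\<theta> * a)))))"
      by (simp add: E_def V_def)
  qed
qed

section \<open>Decomposition of the law\<close>

lemma levy_measure_integrable_min:
  assumes "levy_measure \<rho>"
  shows "integrable \<rho> (\<lambda>x. min 1 (x\<^sup>2))"
proof (rule integrableI_nonneg)
  have [measurable_cong]: "sets \<rho> = sets borel" using assms by (simp add: levy_measure_def)
  show "(\<lambda>x. min 1 (x\<^sup>2)) \<in> borel_measurable \<rho>" by measurable
qed (use assms in \<open>auto simp: levy_measure_def\<close>)

lemma levy_measure_finite_gt:
  assumes "levy_measure \<rho>" and e: "e > 0"
  shows "emeasure \<rho> {e<..} < \<infinity>"
proof -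
  have [measurable_cong]: "sets \<rho> = sets borel" using assms by (simp add: levy_measure_def)
  let ?m = "min 1 (e\<^sup>2)"
  have m: "?m > 0" using e by simp
  have "emeasure \<rho> {e<..} = (\<integral>\<^sup>+x. indicator {e<..} x \<partial>\<rho>)" by simp
  also have "\<dots> \<le> (\<integral>\<^sup>+x. ennreal (1 / ?m) * ennreal (min 1 (x\<^sup>2)) \<partial>\<rho>)"
  proof (rule nn_integral_mono)
    fix x
    show "indicator {e<..} x \<le> ennreal (1 / ?m) * ennreal (min 1 (x\<^sup>2))"
    proof (cases "e < x")
      case True
      then have "e\<^sup>2 \<le> x\<^sup>2" using e by (intro power_mono) auto
      then have "1 \<le> 1 / ?m * min 1 (x\<^sup>2)" using m by (simp add: field_simps)
      then have "ennreal 1 \<le> ennreal (1 / ?m * min 1 (x\<^sup>2))" by (rule ennreal_leI)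
      also have "\<dots> = ennreal (1 / ?m) * ennreal (min 1 (x\<^sup>2))" using m by (intro ennreal_mult') simp
      finally show ?thesis using True by simp
    qed simp
  qed
  also have "\<dots> = ennreal (1 / ?m) * (\<integral>\<^sup>+x. ennreal (min 1 (x\<^sup>2)) \<partial>\<rho>)"
    by (rule nn_integral_cmult) measurable
  also have "\<dots> < \<infinity>"
    using assms by (simp add: levy_measure_def ennreal_mult_less_top)
  finally show ?thesis .
qed

locale levy_triplet =
  fixes \<gamma> \<sigma> a :: real and \<rho> :: "real measure"
  assumes levy: "levy_measure \<rho>" and \<sigma>: "\<sigma> > 0" and a: "a > 0"
    and neg: "emeasure \<rho> {..<0} < \<infinity>" and pos: "emeasure \<rho> {a<..} > 0"
begin

lemma sets_\<rho> [measurable_cong]: "sets \<rho> = sets borel"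
  using levy by (simp add: levy_measure_def)

definition part :: "real set \<Rightarrow> real measure" where
  "part A = density \<rho> (\<lambda>x. ennreal (indicator A x))"

lemma sets_part: "sets (part A) = sets borel"
  by (simp add: part_def sets_\<rho>)

lemma integral_part:
  fixes f :: "real \<Rightarrow> 'b::{banach, second_countable_topology}"
  assumes "A \<in> sets borel" "f \<in> borel_measurable borel"
  shows "integral\<^sup>L (part A) f = integral\<^sup>L \<rho> (\<lambda>x. indicator A x *\<^sub>R f x)"
  unfolding part_def using assms by (subst integral_density) auto

lemma integrable_part:
  fixes f :: "real \<Rightarrow> 'b::{banach, second_countable_topology}"
  assumes "A \<in> sets borel" "f \<in> borel_measurable borel"
  shows "integrable (part A) f \<longleftrightarrow> integrable \<rho> (\<lambda>x. indicator A x *\<^sub>R f x)"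
  unfolding part_def using assms by (subst integrable_density) auto

lemma emeasure_part: "A \<in> sets borel \<Longrightarrow> emeasure (part A) UNIV = emeasure \<rho> A"
  unfolding part_def by (subst emeasure_density) (auto simp: ennreal_indicator sets_\<rho>)

lemma space_\<rho>: "space \<rho> = UNIV"
  using sets_eq_imp_space_eq[OF sets_\<rho>] by simp

lemma space_part: "space (part A) = UNIV"
  using sets_eq_imp_space_eq[OF sets_part] by simp

section \<open>Splitting the Levy exponent\<close>

definition l :: real where "l = measure \<rho> {a<..}"
definition \<kappa> :: real where "\<kappa> = measure \<rho> {..<0}"
definition \<mu> :: "real measure" where "\<mu> = levy_tail_measure \<rho> a"
definition K :: "real measure" where "K = part {0<..a}"
definition V :: real where "V = (LINT x|K. x\<^sup>2)"
text \<open>Compensating on \<open>{0<..a}\<close> instead of \<open>{-1..1}\<close> changes the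
  exponent by a drift with this integrand. It vanishes on \<open>(0, min 1 a]\<close>, and on the
  negative side it is bounded with support of finite mass, hence integrable.\<close>

definition comp :: "real \<Rightarrow> real" where "comp x = x * (indicator {0<..a} x - indicator {-1..1} x)"
definition g :: real where "g = \<gamma> + (LINT x|\<rho>. comp x)"

lemma emeasure_gt: "emeasure \<rho> {a<..} = ennreal l"
  unfolding l_def using levy_measure_finite_gt[OF levy a] by (intro emeasure_eq_ennreal_measure) auto

lemma l_pos: "l > 0"
  using pos unfolding emeasure_gt by simp

lemma \<mu>_eq: "\<mu> = density \<rho> (\<lambda>x. ennreal (indicator {a<..} x / l))"
proof -
  have "indicator {a<..} x / ennreal l = ennreal (indicator {a<..} x / l)" for x :: real
    using l_pos divide_ennreal[of "indicator {a<..} x" l] by (simp add: ennreal_indicator)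
  then show ?thesis unfolding \<mu>_def levy_tail_measure_def emeasure_gt by simp
qed

lemma \<mu>: "real_distribution \<mu>"
proof (rule real_distributionI)
  show "sets \<mu> = sets borel" by (simp add: \<mu>_eq sets_\<rho>)
  show "prob_space \<mu>"
  proof
    have "emeasure \<mu> (space \<mu>) = (\<integral>\<^sup>+x. ennreal (indicator {a<..} x / l) \<partial>\<rho>)"
      unfolding \<mu>_eq by (simp add: emeasure_density space_\<rho>)
    also have "\<dots> = (\<integral>\<^sup>+x. ennreal (1 / l) * indicator {a<..} x \<partial>\<rho>)"
      by (intro nn_integral_cong) (simp add: indicator_def)
    also have "\<dots> = ennreal (1 / l) * emeasure \<rho> {a<..}"
      by (subst nn_integral_cmult) auto
    also have "\<dots> = 1" unfolding emeasure_gt using l_pos by (simp add: ennreal_mult'[symmetric])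
    finally show "emeasure \<mu> (space \<mu>) = 1" .
  qed
qed

lemma \<mu>_gt: "AE x in \<mu>. a < x"
  unfolding \<mu>_eq by (subst AE_density) (auto simp: indicator_def)

lemma integrable_indicator_neg: "integrable \<rho> (indicator {..<0} :: real \<Rightarrow> real)"
  using neg by (intro integrable_real_indicator) auto

lemma integrable_indicator_gt: "e > 0 \<Longrightarrow> integrable \<rho> (indicator {e<..} :: real \<Rightarrow> real)"
  using levy_measure_finite_gt[OF levy] by (intro integrable_real_indicator) auto

lemma sets_K: "sets K = sets borel"
  unfolding K_def by (rule sets_part)

lemma K_supp: "AE x in K. 0 < x \<and> x \<le> a"
  unfolding K_def part_def by (subst AE_density) (auto simp: indicator_def)

lemma sq_le: "indicator {0<..a} x * x\<^sup>2 \<le> max 1 (a\<^sup>2) * min 1 (x\<^sup>2)"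
proof (cases "0 < x \<and> x \<le> a")
  case True
  then have "x\<^sup>2 \<le> a\<^sup>2" by (intro power_mono) auto
  then have "x\<^sup>2 \<le> max 1 (a\<^sup>2) * min 1 (x\<^sup>2)"
    by (cases "x\<^sup>2 \<le> 1") (auto simp: min_def max_def mult_le_cancel_right1 intro: order_trans)
  then show ?thesis using True by simp
qed (auto simp: indicator_def intro!: mult_nonneg_nonneg)

lemma K_sq: "integrable K (\<lambda>x. x\<^sup>2)"
  unfolding K_def
proof (subst integrable_part, measurable, rule Bochner_Integration.integrable_bound)
  show "integrable \<rho> (\<lambda>x. max 1 (a\<^sup>2) * min 1 (x\<^sup>2))"
    using levy_measure_integrable_min[OF levy] by simp
  show "AE x in \<rho>. norm (indicator {0<..a} x *\<^sub>R x\<^sup>2) \<le> norm (max 1 (a\<^sup>2) * min 1 (x\<^sup>2))"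
  proof (rule AE_I2)
    fix x
    have "norm (indicator {0<..a} x *\<^sub>R x\<^sup>2) = indicator {0<..a} x * x\<^sup>2" by (simp add: indicator_def)
    also have "\<dots> \<le> max 1 (a\<^sup>2) * min 1 (x\<^sup>2)" by (rule sq_le)
    finally show "norm (indicator {0<..a} x *\<^sub>R x\<^sup>2) \<le> norm (max 1 (a\<^sup>2) * min 1 (x\<^sup>2))"
      by (simp add: abs_mult)
  qed
qed simp

lemma V_nonneg: "V \<ge> 0"
  unfolding V_def by (intro integral_nonneg_AE) auto

definition \<psi>Y :: "real \<Rightarrow> complex" where
  "\<psi>Y s = \<i> * of_real (g * s) - of_real (\<sigma>\<^sup>2 * s\<^sup>2 / 2)
     + (CLINT x|K. iexp (s * x) - 1 - \<i> * of_real (s * x)) + (CLINT x|part {..<0}. iexp (s * x) - 1)"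

lemma exponent_split: "levy_exponent \<gamma> \<sigma> \<rho> s = \<psi>Y s + of_real l * (char \<mu> s - 1)"
proof -
  let ?f1 = "\<lambda>x. indicator {0<..a} x *\<^sub>R (iexp (s * x) - 1 - \<i> * of_real (s * x))"
  let ?f2 = "\<lambda>x. indicator {..<0} x *\<^sub>R (iexp (s * x) - 1)"
  let ?f3 = "\<lambda>x. indicator {a<..} x *\<^sub>R (iexp (s * x) - 1)"
  let ?f4 = "\<lambda>x. \<i> * complex_of_real (s * comp x)"
  have i1: "integrable \<rho> ?f1"
  proof (rule Bochner_Integration.integrable_bound)
    show "integrable \<rho> (\<lambda>x. s\<^sup>2 * (max 1 (a\<^sup>2) * min 1 (x\<^sup>2)))"
      using levy_measure_integrable_min[OF levy] by simp
    show "AE x in \<rho>. norm (?f1 x) \<le> norm (s\<^sup>2 * (max 1 (a\<^sup>2) * min 1 (x\<^sup>2)))"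
    proof (rule AE_I2)
      fix x
      have "norm (iexp (s * x) - 1 - \<i> * of_real (s * x)) \<le> \<bar>s * x\<bar> ^ Suc 1 / fact (Suc 1)"
        using iexp_approx1[of "s * x" 1] by (simp add: algebra_simps)
      also have "\<dots> \<le> s\<^sup>2 * x\<^sup>2" by (simp add: power_mult_distrib flip: power2_eq_square)
      finally have "norm (?f1 x) \<le> indicator {0<..a} x * (s\<^sup>2 * x\<^sup>2)" by (simp add: indicator_def)
      also have "\<dots> = s\<^sup>2 * (indicator {0<..a} x * x\<^sup>2)" by simp
      also have "\<dots> \<le> s\<^sup>2 * (max 1 (a\<^sup>2) * min 1 (x\<^sup>2))" by (intro mult_left_mono sq_le) simp
      also have "\<dots> \<le> norm (s\<^sup>2 * (max 1 (a\<^sup>2) * min 1 (x\<^sup>2)))" by simp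
      finally show "norm (?f1 x) \<le> norm (s\<^sup>2 * (max 1 (a\<^sup>2) * min 1 (x\<^sup>2)))" .
    qed
  qed measurable
  have le2: "norm (iexp (s * x) - 1) \<le> 2" for x
    using norm_triangle_ineq4[of "iexp (s * x)" 1] by simp
  have i2: "integrable \<rho> ?f2"
  proof (rule Bochner_Integration.integrable_bound)
    show "integrable \<rho> (\<lambda>x. 2 * indicator {..<0} x :: real)" using integrable_indicator_neg by simp
    show "AE x in \<rho>. norm (?f2 x) \<le> norm (2 * indicator {..<0} x :: real)"
      using le2 by (auto simp: indicator_def)
  qed measurable
  have i3: "integrable \<rho> ?f3"
  proof (rule Bochner_Integration.integrable_bound)
    show "integrable \<rho> (\<lambda>x. 2 * indicator {a<..} x :: real)" using integrable_indicator_gt[OF a] by simp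
    show "AE x in \<rho>. norm (?f3 x) \<le> norm (2 * indicator {a<..} x :: real)"
      using le2 by (auto simp: indicator_def)
  qed measurable
  have comp: "integrable \<rho> comp"
  proof (rule Bochner_Integration.integrable_bound)
    show "integrable \<rho> (\<lambda>x. max 1 a * (indicator {..<0} x + indicator {min 1 a<..} x))"
      using integrable_indicator_gt[of "min 1 a"] a integrable_indicator_neg by auto
    show "AE x in \<rho>. norm (comp x) \<le> norm (max 1 a * (indicator {..<0} x + indicator {min 1 a<..} x))"
      using a by (intro AE_I2) (auto simp: comp_def indicator_def abs_mult)
    show "comp \<in> borel_measurable \<rho>" unfolding comp_def[abs_def] by measurable
  qed
  have i4: "integrable \<rho> ?f4" using comp by (intro integrable_mult_right) simp
  \<comment> \<open>No indicator covers \<open>0\<close>, but both sides vanish there, so an atom of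
    \<open>\<rho>\<close> at \<open>0\<close>, which \<open>levy_measure\<close> does not exclude,
    has no effect.\<close>
  have "iexp (s * x) - 1 - \<i> * complex_of_real (s * x * indicator {-1..1} x) = ?f1 x + ?f2 x + ?f3 x + ?f4 x" for x
    using a by (auto simp: indicator_def comp_def)
  then have "(CLINT x|\<rho>. iexp (s * x) - 1 - \<i> * complex_of_real (s * x * indicator {-1..1} x))
     = (CLINT x|\<rho>. ?f1 x + ?f2 x + ?f3 x + ?f4 x)" by presburger
  also have "\<dots> = (CLINT x|\<rho>. ?f1 x) + (CLINT x|\<rho>. ?f2 x) + (CLINT x|\<rho>. ?f3 x) + (CLINT x|\<rho>. ?f4 x)"
    using i1 i2 i3 i4 by (simp only: Bochner_Integration.integral_add Bochner_Integration.integrable_add)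
  also have "(CLINT x|\<rho>. ?f1 x) = (CLINT x|K. iexp (s * x) - 1 - \<i> * of_real (s * x))"
    unfolding K_def by (rule integral_part[symmetric]) auto
  also have "(CLINT x|\<rho>. ?f2 x) = (CLINT x|part {..<0}. iexp (s * x) - 1)"
    by (rule integral_part[symmetric]) auto
  also have "(CLINT x|\<rho>. ?f3 x) = of_real l * (char \<mu> s - 1)"
  proof -
    have "char \<mu> s - 1 = (CLINT x|\<rho>. (indicator {a<..} x / l) *\<^sub>R (iexp (s * x) - 1))"
      unfolding char_eq_integral_minus_one[OF \<mu>] unfolding \<mu>_eq
      using l_pos by (subst integral_density) auto
    also have "\<dots> = (CLINT x|\<rho>. ?f3 x) / of_real l"
      by (simp add: scaleR_conv_of_real flip: integral_divide_zero)
    finally show ?thesis using l_pos by simp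
  qed
  also have "(CLINT x|\<rho>. ?f4 x) = \<i> * of_real (s * (LINT x|\<rho>. comp x))"
    by simp
  finally show ?thesis unfolding levy_exponent_def \<psi>Y_def g_def by (simp add: algebra_simps)
qed

section \<open>Laws of the process without big jumps\<close>

definition U_spec :: "real \<Rightarrow> real measure \<Rightarrow> real measure \<Rightarrow> bool" where
  "U_spec t W N \<longleftrightarrow> real_distribution W \<and> real_distribution N
     \<and> (\<forall>s. char W s = exp (of_real t * (CLINT x|K. iexp (s * x) - 1 - \<i> * of_real (s * x))))
     \<and> (\<forall>\<theta>. mgf W \<theta> \<le> ennreal (exp (t * (V * \<theta>\<^sup>2 * exp (max 0 (\<theta> * a))))))
     \<and> (\<forall>s. char N s = exp (of_real t * (CLINT x|part {..<0}. iexp (s * x) - 1)))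
     \<and> exp (- t * \<kappa>) \<le> measure N {0} \<and> (AE x in N. x \<le> 0)"

lemma U_spec_exists:
  assumes t: "t > 0"
  shows "\<exists>W N. U_spec t W N"
proof -
  obtain W where W: "real_distribution W"
    "\<And>s. char W s = exp (of_real t * (CLINT x|K. iexp (s * x) - 1 - \<i> * of_real (s * x)))"
    "\<And>\<theta>. mgf W \<theta> \<le> ennreal (exp (t * ((LINT x|K. x\<^sup>2) * \<theta>\<^sup>2 * exp (max 0 (\<theta> * a)))))"
    by (rule compensated_poisson_exists[OF sets_K t less_imp_le[OF a] K_supp K_sq], rule that)
  have fin: "finite_measure (part {..<0})"
    using neg by (intro finite_measureI) (auto simp: space_part emeasure_part)
  have meas: "measure (part {..<0}) UNIV = \<kappa>"
    by (simp add: \<kappa>_def measure_def emeasure_part)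
  have "AE x in part {..<0}. x \<le> 0"
    unfolding part_def by (subst AE_density) (auto simp: indicator_def)
  moreover obtain N where "real_distribution N"
    "\<And>s. char N s = exp (of_real t * (CLINT x|part {..<0}. iexp (s * x) - 1))"
    "exp (- t * measure (part {..<0}) UNIV) \<le> measure N {0}"
    "(AE x in part {..<0}. x \<le> 0) \<Longrightarrow> (AE x in N. x \<le> 0)"
  proof (rule compound_poisson_exists[OF fin sets_part t])
    fix N assume N: "real_distribution N"
      "\<And>s. char N s = exp (of_real t * (CLINT x|part {..<0}. iexp (s * x) - 1))"
      "\<And>\<theta>. integrable (part {..<0}) (\<lambda>x. exp (\<theta> * x)) \<Longrightarrow>
          mgf N \<theta> = ennreal (exp (t * (LINT x|part {..<0}. exp (\<theta> * x) - 1)))"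
      "exp (- t * measure (part {..<0}) UNIV) \<le> measure N {0}"
      "(AE x in part {..<0}. x \<le> 0) \<Longrightarrow> (AE x in N. x \<le> 0)"
    show thesis by (rule that[OF N(1) N(2) N(4) N(5)])
  qed
  ultimately show ?thesis using W unfolding U_spec_def V_def meas by blast
qed

text \<open>Existence is proved separately for each \<open>t\<close>, partly by a weak limit, so the
  laws are picked by choice. Consistency in \<open>t\<close> comes afterwards from the
  characteristic functions.\<close>

definition Wt :: "real \<Rightarrow> real measure" where "Wt t = (SOME W. \<exists>N. U_spec t W N)"
definition Nt :: "real \<Rightarrow> real measure" where "Nt t = (SOME N. U_spec t (Wt t) N)"

lemma U_spec: "t > 0 \<Longrightarrow> U_spec t (Wt t) (Nt t)"
proof -
  assume "t > 0"
  from U_spec_exists[OF this] have "\<exists>N. U_spec t (Wt t) N"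
    unfolding Wt_def by (rule someI_ex)
  then show ?thesis unfolding Nt_def by (rule someI_ex)
qed

definition Ut :: "real \<Rightarrow> real measure" where
  "Ut t = (gauss (\<sigma> * sqrt t) \<star> (return borel (g * t) \<star> Wt t))"

text \<open>Time \<open>0\<close> is separate because \<open>gauss 0\<close> is the zero measure and
  nothing is known of \<open>Wt 0\<close> and \<open>Nt 0\<close>.\<close>

definition \<nu> :: "real \<Rightarrow> real measure" where
  "\<nu> t = (if t = 0 then return borel 0 else (Ut t \<star> Nt t))"

lemma Wt: "t > 0 \<Longrightarrow> real_distribution (Wt t)" and Nt: "t > 0 \<Longrightarrow> real_distribution (Nt t)"
  using U_spec[of t] by (simp_all add: U_spec_def)

lemma Ut: "t > 0 \<Longrightarrow> real_distribution (Ut t)"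
  unfolding Ut_def using \<sigma>
  by (intro real_distribution_conv real_distribution_gauss real_distribution_return Wt) auto

lemma \<nu>: "0 \<le> t \<Longrightarrow> real_distribution (\<nu> t)"
  unfolding \<nu>_def by (auto intro!: real_distribution_return real_distribution_conv Ut Nt)

lemma char_\<nu>: "0 \<le> t \<Longrightarrow> char (\<nu> t) s = exp (of_real t * \<psi>Y s)"
proof (cases "t = 0")
  case False
  assume "0 \<le> t"
  with False have t: "t > 0" by simp
  have "char (\<nu> t) s = char (gauss (\<sigma> * sqrt t)) s * (char (return borel (g * t)) s * char (Wt t) s) * char (Nt t) s"
    using t \<sigma> by (simp add: \<nu>_def Ut_def char_convolution real_distribution_conv
        real_distribution_gauss real_distribution_return Wt Nt)
  also have "\<dots> = exp (of_real t * \<psi>Y s)"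
  proof -
    have "char (gauss (\<sigma> * sqrt t)) s = exp (- of_real (t * (\<sigma>\<^sup>2 * s\<^sup>2 / 2)))"
      using t \<sigma> by (simp add: char_gauss power_mult_distrib mult_ac)
    moreover have "char (return borel (g * t)) s = exp (of_real t * (\<i> * of_real (g * s)))"
      by (simp add: char_return mult_ac)
    moreover have "char (Wt t) s = exp (of_real t * (CLINT x|K. iexp (s * x) - 1 - \<i> * of_real (s * x)))"
      "char (Nt t) s = exp (of_real t * (CLINT x|part {..<0}. iexp (s * x) - 1))"
      using U_spec[OF t] by (simp_all only: U_spec_def)
    ultimately show ?thesis
      unfolding \<psi>Y_def by (simp only: exp_add[symmetric] distrib_left right_diff_distrib of_real_mult) (simp add: algebra_simps)
  qed
  finally show ?thesis .
qed (simp add: \<nu>_def char_return)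

text \<open>The characteristic functions multiply and determine the law, so the semigroup property
  holds however \<open>Wt\<close> and \<open>Nt\<close> were chosen.\<close>

lemma \<nu>_add: "0 \<le> t \<Longrightarrow> 0 \<le> t' \<Longrightarrow> (\<nu> t \<star> \<nu> t') = \<nu> (t + t')"
  by (intro Levy_uniqueness ext real_distribution_conv \<nu>)
     (simp_all add: char_convolution \<nu> char_\<nu> distrib_right exp_add)

lemma char_total: "0 < t \<Longrightarrow> char (\<nu> t \<star> cpois (l * t) \<mu>) s = exp (of_real t * levy_exponent \<gamma> \<sigma> \<rho> s)"
  using l_pos
  by (simp add: char_convolution \<nu> char_\<nu> real_distribution_cpois \<mu> char_cpois exponent_split algebra_simps flip: exp_add)

lemma mgf_Ut:
  assumes t: "t > 0"
  shows "mgf (Ut t) \<theta> \<le> ennreal (exp (t * (\<sigma>\<^sup>2 * \<theta>\<^sup>2 / 2 + g * \<theta> + V * \<theta>\<^sup>2 * exp (max 0 (\<theta> * a)))))"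
proof -
  have "mgf (Ut t) \<theta> = ennreal (exp (t * (\<sigma>\<^sup>2 * \<theta>\<^sup>2 / 2))) * (ennreal (exp (t * (g * \<theta>))) * mgf (Wt t) \<theta>)"
    unfolding Ut_def using t \<sigma>
    by (simp add: mgf_convolution real_distribution_conv real_distribution_gauss
        real_distribution_return Wt mgf_gauss mgf_return power_mult_distrib mult_ac)
  also have "\<dots> \<le> ennreal (exp (t * (\<sigma>\<^sup>2 * \<theta>\<^sup>2 / 2))) * (ennreal (exp (t * (g * \<theta>))) * ennreal (exp (t * (V * \<theta>\<^sup>2 * exp (max 0 (\<theta> * a))))))"
    using U_spec[OF t] by (intro mult_left_mono) (auto simp: U_spec_def)
  also have "\<dots> = ennreal (exp (t * (\<sigma>\<^sup>2 * \<theta>\<^sup>2 / 2)) * (exp (t * (g * \<theta>)) * exp (t * (V * \<theta>\<^sup>2 * exp (max 0 (\<theta> * a))))))"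
    by (simp only: ennreal_mult'[OF less_imp_le[OF exp_gt_zero]])
  also have "exp (t * (\<sigma>\<^sup>2 * \<theta>\<^sup>2 / 2)) * (exp (t * (g * \<theta>)) * exp (t * (V * \<theta>\<^sup>2 * exp (max 0 (\<theta> * a)))))
    = exp (t * (\<sigma>\<^sup>2 * \<theta>\<^sup>2 / 2 + g * \<theta> + V * \<theta>\<^sup>2 * exp (max 0 (\<theta> * a))))"
    by (simp only: exp_add[symmetric] distrib_left add.assoc)
  finally show ?thesis .
qed

text \<open>Bounds the logarithm of the exponential moment of \<open>Ut t\<close> at
  \<open>- 1 / sqrt \<delta>\<close>, uniformly for \<open>0 < t\<close>,
  \<open>t \<le> \<delta>\<close> and \<open>\<delta> \<le> 1\<close>.\<close>

definition B :: real where "B = \<sigma>\<^sup>2 / 2 + \<bar>g\<bar> + V"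

lemma B_nonneg: "B \<ge> 0"
  using V_nonneg by (simp add: B_def)

lemma \<kappa>_nonneg: "\<kappa> \<ge> 0"
  by (simp add: \<kappa>_def)

text \<open>Chernoff for \<open>Ut t\<close> with the diffusive parameter
  \<open>\<theta> = 1 / sqrt \<delta>\<close>, for which \<open>t * \<theta>\<^sup>2\<close> and
  \<open>t * \<theta>\<close> are at most \<open>1\<close>. The downward jumps are handled by
  independence: with probability at least \<open>exp (- \<kappa> * \<delta>)\<close> their sum is
  \<open>0\<close>.\<close>

lemma lower:
  assumes t: "0 \<le> t" "t \<le> \<delta>" and \<delta>: "0 < \<delta>" "\<delta> \<le> 1" and r: "0 \<le> r"
  shows "exp (- \<kappa> * \<delta>) * (1 - exp (B - r / sqrt \<delta>)) \<le> measure (\<nu> t) {-r..}"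
proof (cases "t = 0")
  case True
  have "exp (- \<kappa> * \<delta>) * (1 - exp (B - r / sqrt \<delta>)) \<le> exp (- \<kappa> * \<delta>) * 1"
    by (intro mult_left_mono) auto
  also have "\<dots> \<le> 1" using \<kappa>_nonneg \<delta> by simp
  also have "1 = measure (\<nu> t) {- r..}" using True r by (simp add: \<nu>_def measure_return)
  finally show ?thesis .
next
  case False
  with t have t0: "t > 0" by simp
  interpret U: real_distribution "Ut t" by (rule Ut[OF t0])
  interpret N: real_distribution "Nt t" by (rule Nt[OF t0])
  interpret X: real_distribution "\<nu> t" by (rule \<nu>[OF t(1)])
  define \<theta> where "\<theta> = 1 / sqrt \<delta>"
  have \<theta>: "\<theta> > 0" using \<delta> by (simp add: \<theta>_def)
  have t\<theta>2: "t * \<theta>\<^sup>2 \<le> 1" using t \<delta> by (simp add: \<theta>_def power_divide)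
  have t\<theta>: "t * \<theta> \<le> 1"
  proof -
    have "t * \<theta> \<le> \<delta> / sqrt \<delta>" using t \<delta> by (simp add: \<theta>_def divide_right_mono)
    also have "\<dots> = sqrt \<delta>" using \<delta> by (simp add: real_div_sqrt)
    also have "\<dots> \<le> 1" using \<delta> by simp
    finally show ?thesis .
  qed
  have "mgf (Ut t) (- \<theta>) \<le> ennreal (exp (t * (\<sigma>\<^sup>2 * (- \<theta>)\<^sup>2 / 2 + g * (- \<theta>) + V * (- \<theta>)\<^sup>2 * exp (max 0 (- \<theta> * a)))))"
    by (rule mgf_Ut[OF t0])
  also have "\<dots> \<le> ennreal (exp B)"
  proof (intro ennreal_leI, simp only: exp_le_cancel_iff)
    have max: "max 0 (- \<theta> * a) = 0" using \<theta> a by simp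
    have "t * (\<sigma>\<^sup>2 * (- \<theta>)\<^sup>2 / 2 + g * (- \<theta>) + V * (- \<theta>)\<^sup>2 * exp (max 0 (- \<theta> * a)))
        = (t * \<theta>\<^sup>2) * (\<sigma>\<^sup>2 / 2) + (t * \<theta>) * (- g) + (t * \<theta>\<^sup>2) * V"
      unfolding max by (simp add: algebra_simps)
    also have "\<dots> \<le> 1 * (\<sigma>\<^sup>2 / 2) + (t * \<theta>) * \<bar>g\<bar> + 1 * V"
      using t\<theta>2 V_nonneg t0 \<theta> by (intro add_mono mult_right_mono mult_left_mono) auto
    also have "\<dots> \<le> 1 * (\<sigma>\<^sup>2 / 2) + 1 * \<bar>g\<bar> + 1 * V"
      using t\<theta> V_nonneg by (intro add_mono mult_right_mono) auto
    finally show "t * (\<sigma>\<^sup>2 * (- \<theta>)\<^sup>2 / 2 + g * (- \<theta>) + V * (- \<theta>)\<^sup>2 * exp (max 0 (- \<theta> * a))) \<le> B"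
      by (simp add: B_def)
  qed
  finally have "measure (Ut t) {..- r} \<le> exp B * exp (\<theta> * (- r))"
    using \<theta> by (intro lower_tail_le_mgf Ut t0) auto
  also have "\<dots> = exp (B - r / sqrt \<delta>)" by (simp add: \<theta>_def flip: exp_add)
  finally have U1: "measure (Ut t) {..- r} \<le> exp (B - r / sqrt \<delta>)" .
  have "1 = measure (Ut t) ({..- r} \<union> {- r..})"
    using U.prob_space by (subst arg_cong[of _ UNIV "measure (Ut t)"]) auto
  also have "\<dots> \<le> measure (Ut t) {..- r} + measure (Ut t) {- r..}"
    by (rule measure_Un_le) auto
  finally have U2: "1 - exp (B - r / sqrt \<delta>) \<le> measure (Ut t) {- r..}" using U1 by simp
  have "exp (- \<kappa> * \<delta>) \<le> exp (- t * \<kappa>)"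
    using mult_right_mono[OF t(2) \<kappa>_nonneg] by (simp add: mult.commute)
  also have "\<dots> \<le> measure (Nt t) {0}" using U_spec[OF t0] by (simp add: U_spec_def)
  finally have N: "exp (- \<kappa> * \<delta>) \<le> measure (Nt t) {0}" .
  have "ennreal (measure (Nt t) {0} * measure (Ut t) {- r..}) = (\<integral>\<^sup>+x. \<integral>\<^sup>+y. indicator {- r..} x * indicator {0} y \<partial>Nt t \<partial>Ut t)"
    by (simp add: nn_integral_cmult nn_integral_multc U.emeasure_eq_measure N.emeasure_eq_measure ennreal_mult' mult.commute)
  also have "\<dots> \<le> (\<integral>\<^sup>+x. \<integral>\<^sup>+y. indicator {- r..} (x + y) \<partial>Nt t \<partial>Ut t)"
    by (intro nn_integral_mono) (auto simp: indicator_def)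
  also have "\<dots> = (\<integral>\<^sup>+x. indicator {- r..} x \<partial>(Ut t \<star> Nt t))"
    by (intro nn_integral_conv[symmetric] Ut Nt t0) auto
  also have "\<dots> = ennreal (measure (\<nu> t) {- r..})"
  proof -
    have "(Ut t \<star> Nt t) = \<nu> t" using False by (simp add: \<nu>_def)
    then show ?thesis by (simp add: X.emeasure_eq_measure)
  qed
  finally have X: "measure (Nt t) {0} * measure (Ut t) {- r..} \<le> measure (\<nu> t) {- r..}" by simp
  have "exp (- \<kappa> * \<delta>) * (1 - exp (B - r / sqrt \<delta>)) \<le> exp (- \<kappa> * \<delta>) * measure (Ut t) {- r..}"
    by (intro mult_left_mono U2) simp
  also have "\<dots> \<le> measure (Nt t) {0} * measure (Ut t) {- r..}"
    by (intro mult_right_mono N) simp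
  finally show ?thesis using X by simp
qed

text \<open>The downward jumps only help and are dropped. Since \<open>\<theta>\<close> stays free,
  it may later grow with the level and yield decay faster than exponential.\<close>

lemma upper:
  assumes \<theta>: "\<theta> \<ge> 0"
  shows "measure (\<nu> 1) {w<..} \<le> exp (\<sigma>\<^sup>2 * \<theta>\<^sup>2 / 2 + g * \<theta> + V * \<theta>\<^sup>2 * exp (\<theta> * a) - \<theta> * w)"
proof -
  interpret U: real_distribution "Ut 1" by (rule Ut) simp
  interpret N: real_distribution "Nt 1" by (rule Nt) simp
  interpret X: real_distribution "\<nu> 1" by (rule \<nu>) simp
  have law: "\<nu> 1 = (Ut 1 \<star> Nt 1)" by (simp add: \<nu>_def)
  have "ennreal (measure (\<nu> 1) {w<..}) = tail (\<nu> 1) w" by (simp add: tail_def X.emeasure_eq_measure)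
  also have "\<dots> = (\<integral>\<^sup>+y. tail (Ut 1) (w - y) \<partial>Nt 1)"
    unfolding law by (rule tail_convolution[OF Ut Nt]) simp_all
  also have "\<dots> \<le> (\<integral>\<^sup>+y. tail (Ut 1) w \<partial>Nt 1)"
  proof (rule nn_integral_mono_AE)
    have "AE y in Nt 1. y \<le> 0" using U_spec[of 1] by (simp add: U_spec_def)
    then show "AE y in Nt 1. tail (Ut 1) (w - y) \<le> tail (Ut 1) w"
      by eventually_elim (auto simp: tail_def intro!: emeasure_mono)
  qed
  also have "\<dots> = tail (Ut 1) w" using N.emeasure_space_1 by (simp del: N.space_eq_univ)
  also have "\<dots> \<le> ennreal (measure (Ut 1) {w..})"
    unfolding tail_def by (subst U.emeasure_eq_measure) (auto intro!: ennreal_leI U.finite_measure_mono)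
  finally have "measure (\<nu> 1) {w<..} \<le> measure (Ut 1) {w..}" by simp
  also have "\<dots> \<le> exp (1 * (\<sigma>\<^sup>2 * \<theta>\<^sup>2 / 2 + g * \<theta> + V * \<theta>\<^sup>2 * exp (max 0 (\<theta> * a)))) * exp (- \<theta> * w)"
    by (intro tail_le_mgf Ut \<theta> mgf_Ut) auto
  also have "max 0 (\<theta> * a) = \<theta> * a" using \<theta> a by simp
  finally show ?thesis by (simp flip: exp_add)
qed

end

section \<open>Light tails\<close>

lemma tail_le_tail_convolution:
  assumes M: "real_distribution M" and \<mu>: "real_distribution \<mu>" and ge: "AE x in \<mu>. b \<le> x"
  shows "tail M (u - b) \<le> tail (M \<star> \<mu>) u"
proof -
  interpret \<mu>: real_distribution \<mu> by fact
  interpret M: real_distribution M by fact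
  have "tail M (u - b) = (\<integral>\<^sup>+y. tail M (u - b) \<partial>\<mu>)" using \<mu>.emeasure_space_1 by (simp del: \<mu>.space_eq_univ)
  also have "\<dots> \<le> (\<integral>\<^sup>+y. tail M (u - y) \<partial>\<mu>)"
    using ge by (intro nn_integral_mono_AE, eventually_elim) (auto simp: tail_def intro!: emeasure_mono)
  also have "\<dots> = tail (M \<star> \<mu>) u" by (simp add: tail_convolution M \<mu>)
  finally show ?thesis .
qed

lemma tail_convolution_ge:
  assumes M: "real_distribution M" and \<mu>: "real_distribution \<mu>"
  shows "tail M (u - b) * tail \<mu> b \<le> tail (M \<star> \<mu>) u"
proof -
  interpret \<mu>: real_distribution \<mu> by fact
  interpret M: real_distribution M by fact
  have "tail M (u - b) * tail \<mu> b = (\<integral>\<^sup>+y. tail M (u - b) * indicator {b<..} y \<partial>\<mu>)"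
    by (simp add: nn_integral_cmult tail_def)
  also have "\<dots> \<le> (\<integral>\<^sup>+y. tail M (u - y) \<partial>\<mu>)"
    by (intro nn_integral_mono) (auto simp: tail_def indicator_def intro!: emeasure_mono)
  also have "\<dots> = tail (M \<star> \<mu>) u" by (simp add: tail_convolution M \<mu>)
  finally show ?thesis .
qed

text \<open>For bounded jumps the tail of \<open>n\<close> of them vanishes beyond
  \<open>n * A\<close>. Otherwise one factor \<open>\<mu>\<close> is replaced by
  \<open>\<mu> \<star> \<mu>\<close> where its value is large, and the induction hypothesis covers
  the event that the other \<open>n\<close> jumps nearly reach the level alone.\<close>

lemma light_right_tail_conv_pow:
  assumes \<mu>: "real_distribution \<mu>" and nonneg: "AE x in \<mu>. 0 \<le> x" and light: "light_right_tail \<mu>" and \<epsilon>: "\<epsilon> > 0"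
  shows "\<exists>v. \<forall>w>v. measure (conv_pow \<mu> n) {w<..} \<le> \<epsilon> * measure (conv_pow \<mu> (Suc n)) {w<..}"
  using light unfolding light_right_tail_def
proof (elim disjE conjE exE)
  interpret \<mu>: real_distribution \<mu> by fact
  fix A \<alpha> :: real assume A: "0 < A" and le: "AE x in \<mu>. x \<le> A"
  have zero: "tail (conv_pow \<mu> n) w = 0" if "w > real n * A" for w
    using that
  proof (induction n arbitrary: w)
    case 0
    then show ?case by (simp add: tail_def)
  next
    case (Suc n)
    have "tail (conv_pow \<mu> (Suc n)) w = tail (conv_pow \<mu> n \<star> \<mu>) w"
      by (simp add: convolution_commute[OF \<mu> real_distribution_conv_pow[OF \<mu>]])
    also have "\<dots> = (\<integral>\<^sup>+y. tail (conv_pow \<mu> n) (w - y) \<partial>\<mu>)"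
      by (intro tail_convolution real_distribution_conv_pow \<mu>)
    also have "\<dots> = (\<integral>\<^sup>+y. 0 \<partial>\<mu>)"
      using le by (intro nn_integral_cong_AE, eventually_elim) (use Suc in \<open>auto simp: algebra_simps\<close>)
    finally show ?case by simp
  qed
  show ?thesis
  proof (intro exI allI impI)
    fix w assume "real n * A < w"
    from zero[OF this] have "measure (conv_pow \<mu> n) {w<..} = 0"
      by (simp add: tail_def measure_def)
    then show "measure (conv_pow \<mu> n) {w<..} \<le> \<epsilon> * measure (conv_pow \<mu> (Suc n)) {w<..}"
      using \<epsilon> by simp
  qed
next
  interpret \<mu>: real_distribution \<mu> by fact
  assume pos: "\<forall>u>0. 0 < measure \<mu> {u<..}"
    and lim: "((\<lambda>u. measure \<mu> {u<..} / measure (\<mu> \<star> \<mu>) {u<..}) \<longlongrightarrow> 0) at_top"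
  note \<mu>n = real_distribution_conv_pow[OF \<mu>]
  have \<mu>\<mu>: "real_distribution (\<mu> \<star> \<mu>)" by (intro real_distribution_conv \<mu>)
  have one: "\<exists>v>0. \<forall>w>v. measure \<mu> {w<..} \<le> e * measure (\<mu> \<star> \<mu>) {w<..}" if e: "e > 0" for e
  proof -
    have "eventually (\<lambda>u. measure \<mu> {u<..} / measure (\<mu> \<star> \<mu>) {u<..} < e) at_top"
      using lim e by (intro order_tendstoD)
    then obtain v0 where v0: "\<And>u. u \<ge> v0 \<Longrightarrow> measure \<mu> {u<..} / measure (\<mu> \<star> \<mu>) {u<..} < e"
      unfolding eventually_at_top_linorder by blast
    show ?thesis
    proof (intro exI[of _ "max v0 1"] conjI allI impI)
      fix w assume w: "max v0 1 < w"
      \<comment> \<open>The quotient in \<open>light_right_tail\<close> would be \<open>0\<close> by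
        convention if its denominator vanished; the denominator dominates the positive tail of
        \<open>\<mu>\<close>, so it does not.\<close>
      have "ennreal (measure \<mu> {w<..}) \<le> ennreal (measure (\<mu> \<star> \<mu>) {w<..})"
        using tail_le_tail_convolution[OF \<mu> \<mu> nonneg, of w] by (simp add: tail_eq_measure \<mu> \<mu>\<mu>)
      moreover have "0 < measure \<mu> {w<..}" using pos w by simp
      ultimately have "0 < measure (\<mu> \<star> \<mu>) {w<..}" by simp
      then show "measure \<mu> {w<..} \<le> e * measure (\<mu> \<star> \<mu>) {w<..}"
        using v0[of w] w by (simp add: divide_less_eq)
    qed simp
  qed
  show ?thesis
    using \<epsilon>
  proof (induction n arbitrary: \<epsilon>)
    case 0
    show ?case by (intro exI[of _ 0]) (use 0 in \<open>auto simp: measure_return\<close>)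
  next
    case (Suc n)
    obtain v where v: "v > 0" "\<And>w. w > v \<Longrightarrow> measure \<mu> {w<..} \<le> \<epsilon> / 2 * measure (\<mu> \<star> \<mu>) {w<..}"
      using one[of "\<epsilon> / 2"] Suc.prems by auto
    define p where "p = measure \<mu> {v + 1<..}"
    have p: "p > 0" using pos v by (simp add: p_def)
    obtain v' where v': "\<And>w. w > v' \<Longrightarrow> measure (conv_pow \<mu> n) {w<..} \<le> \<epsilon> / 2 * p * measure (conv_pow \<mu> (Suc n)) {w<..}"
      using Suc.IH[of "\<epsilon> / 2 * p"] Suc.prems p by auto
    show ?case
    proof (intro exI[of _ "v' + v + 1"] allI impI)
      fix w assume w: "v' + v + 1 < w"
      have "measure (conv_pow \<mu> (Suc n)) {w<..} \<le>
          \<epsilon> / 2 * measure ((\<mu> \<star> \<mu>) \<star> conv_pow \<mu> n) {w<..} + measure (conv_pow \<mu> n) {w - (v + 1)<..}"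
        unfolding conv_pow.simps using Suc.prems
        by (intro measure_convolution_tail_le[OF \<mu> \<mu>\<mu> \<mu>n[of n]] v(2)) auto
      also have "((\<mu> \<star> \<mu>) \<star> conv_pow \<mu> n) = conv_pow \<mu> (Suc (Suc n))"
        by (simp add: convolution_assoc \<mu> \<mu>n)
      \<comment> \<open>The lowered level is regained by one further jump larger than
        \<open>v + 1\<close>, whose probability \<open>p\<close> was built into the choice of
        \<open>v'\<close>.\<close>
      also have "measure (conv_pow \<mu> n) {w - (v + 1)<..} \<le> \<epsilon> / 2 * (measure (conv_pow \<mu> (Suc n)) {w - (v + 1)<..} * p)"
        using v'[of "w - (v + 1)"] w by (simp only: mult_ac)
      also have "measure (conv_pow \<mu> (Suc n)) {w - (v + 1)<..} * p \<le> measure (conv_pow \<mu> (Suc (Suc n))) {w<..}"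
      proof -
        have "(conv_pow \<mu> (Suc n) \<star> \<mu>) = conv_pow \<mu> (Suc (Suc n))"
          by (simp only: convolution_commute[OF \<mu>n \<mu>] conv_pow.simps(2)[of \<mu> "Suc n"])
        with tail_convolution_ge[OF \<mu>n[of "Suc n"] \<mu>, of w "v + 1"] show ?thesis
          by (simp add: tail_eq_measure[OF \<mu>n] tail_eq_measure[OF \<mu>] p_def ennreal_mult'[symmetric] del: conv_pow.simps)
      qed
      finally show "measure (conv_pow \<mu> (Suc n)) {w<..} \<le> \<epsilon> * measure (conv_pow \<mu> (Suc (Suc n))) {w<..}"
        using Suc.prems by (simp add: mult_left_mono del: conv_pow.simps)
    qed
  qed
qed

text \<open>The dominant terms are \<open>- \<beta> * u * ln u\<close> and
  \<open>\<delta> * u * ln u\<close>. The gap \<open>e = \<beta> - \<delta>\<close> is positive, and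
  the moment term is of smaller order because \<open>\<alpha> < 1\<close>.\<close>

lemma bounded_jumps_tail_negligible:
  fixes \<alpha> \<beta> \<delta> :: real
  assumes "0 < \<alpha>" "\<alpha> < 1" "0 < \<delta>" "0 < e" "\<beta> = \<delta> + e"
  shows "((\<lambda>u. exp (s * (\<beta> * ln u)\<^sup>2 + g * (\<beta> * ln u) + V * (\<beta> * ln u)\<^sup>2 * u powr \<alpha> - \<beta> * ln u * (u - v)
     + (\<delta> * (u + C) + 2) * ln (\<delta> * (u + C) + 2) + (\<delta> * (u + C) + 2) * K)) \<longlongrightarrow> 0) at_top"
  using assms by real_asymp

section \<open>From grid maxima to the supremum of the process\<close>

context levy_triplet
begin

section \<open>Negligibility of the process without big jumps\<close>

lemma tail_conv_pow_ge:
  "ennreal (measure \<mu> {b<..} ^ n) * tail (\<nu> 1) (u - real n * b) \<le> tail (\<nu> 1 \<star> conv_pow \<mu> n) u"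
proof (induction n arbitrary: u)
  case 0
  show ?case by (simp add: convolution_return_0 \<nu>)
next
  case (Suc n)
  have law: "real_distribution (\<nu> 1 \<star> conv_pow \<mu> n)"
    by (intro real_distribution_conv \<nu> real_distribution_conv_pow \<mu>) simp
  have "ennreal (measure \<mu> {b<..} ^ Suc n) * tail (\<nu> 1) (u - real (Suc n) * b)
      = (ennreal (measure \<mu> {b<..} ^ n) * tail (\<nu> 1) (u - b - real n * b)) * tail \<mu> b"
    by (simp add: tail_eq_measure[OF \<mu>] ennreal_mult' algebra_simps)
  also have "\<dots> \<le> tail (\<nu> 1 \<star> conv_pow \<mu> n) (u - b) * tail \<mu> b"
    by (intro mult_right_mono Suc) simp
  also have "\<dots> \<le> tail ((\<nu> 1 \<star> conv_pow \<mu> n) \<star> \<mu>) u"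
    by (rule tail_convolution_ge[OF law \<mu>])
  also have "((\<nu> 1 \<star> conv_pow \<mu> n) \<star> \<mu>) = (\<nu> 1 \<star> conv_pow \<mu> (Suc n))"
    by (simp add: convolution_assoc convolution_commute[OF \<mu>] \<nu> \<mu> real_distribution_conv_pow)
  finally show ?case .
qed

lemma total_tail_ge:
  "pois l n * measure (\<nu> 1 \<star> conv_pow \<mu> n) {u<..} \<le> measure (\<nu> 1 \<star> cpois l \<mu>) {u<..}"
proof -
  have X: "real_distribution (\<nu> 1 \<star> cpois l \<mu>)"
    by (intro real_distribution_conv \<nu> real_distribution_cpois \<mu>) simp
  have Y: "real_distribution (\<nu> 1 \<star> conv_pow \<mu> n)" for n
    by (intro real_distribution_conv \<nu> real_distribution_conv_pow \<mu>) simp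
  have "ennreal (pois l n * measure (\<nu> 1 \<star> conv_pow \<mu> n) {u<..})
      = ennreal (pois l n) * (\<integral>\<^sup>+x. indicator {u<..} x \<partial>(\<nu> 1 \<star> conv_pow \<mu> n))"
    using l_pos unfolding tail_eq_nn_integral[OF Y, symmetric] tail_eq_measure[OF Y]
    by (simp add: ennreal_mult' pois_nonneg)
  also have "\<dots> \<le> (\<Sum>n. ennreal (pois l n) * (\<integral>\<^sup>+x. indicator {u<..} x \<partial>(\<nu> 1 \<star> conv_pow \<mu> n)))"
    using sum_le_suminf[of "\<lambda>n. ennreal (pois l n) * (\<integral>\<^sup>+x. indicator {u<..} x \<partial>(\<nu> 1 \<star> conv_pow \<mu> n))" "{n}"]
    by (simp del: nn_integral_indicator)
  also have "\<dots> = (\<integral>\<^sup>+x. indicator {u<..} x \<partial>(\<nu> 1 \<star> cpois l \<mu>))"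
    by (rule nn_integral_convolution_cpois[symmetric]) (auto simp: \<nu> \<mu> l_pos)
  also have "\<dots> = ennreal (measure (\<nu> 1 \<star> cpois l \<mu>) {u<..})"
    unfolding tail_eq_nn_integral[OF X, symmetric] by (rule tail_eq_measure[OF X])
  finally show ?thesis by simp
qed

text \<open>Jumps that exceed \<open>a\<close> by a fixed margin are needed: they reach
  \<open>u\<close> with fewer jumps than jumps of size \<open>a\<close> would, and this separates
  the two rates of decay below.\<close>

lemma larger_jump: "\<exists>a'>a. measure \<mu> {a'<..} > 0"
proof -
  interpret \<mu>: real_distribution \<mu> by (rule \<mu>)
  have "(\<lambda>n. measure \<mu> {a + 1 / real (Suc n)<..}) \<longlonglongrightarrow> measure \<mu> (\<Union>n. {a + 1 / real (Suc n)<..})"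
    by (rule \<mu>.finite_Lim_measure_incseq) (auto simp: incseq_def intro: le_less_trans[rotated] frac_le)
  also have "(\<Union>n. {a + 1 / real (Suc n)<..}) = {a<..}"
  proof safe
    fix x assume "a < x"
    then obtain n where "1 / real (Suc n) < x - a"
      using reals_Archimedean[of "x - a"] by (auto simp: inverse_eq_divide)
    then show "x \<in> (\<Union>n. {a + 1 / real (Suc n)<..})" by (auto intro!: exI[of _ n])
  next
    fix x n assume "a + 1 / real (Suc n) < x"
    moreover have "1 / real (Suc n) > 0" by simp
    ultimately show "a < x" by linarith
  qed
  also have "measure \<mu> {a<..} = 1"
    using \<mu>_gt by (subst \<mu>.prob_eq_1) auto
  finally have "eventually (\<lambda>n. 0 < measure \<mu> {a + 1 / real (Suc n)<..}) sequentially"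
    by (intro order_tendstoD) auto
  then obtain n where "0 < measure \<mu> {a + 1 / real (Suc n)<..}"
    by (auto dest: eventually_happens)
  then show ?thesis by (intro exI[of _ "a + 1 / real (Suc n)"]) auto
qed

text \<open>About \<open>u / a'\<close> jumps larger than \<open>a'\<close> bring
  \<open>X(1)\<close> above \<open>u\<close>, with a Poisson price of order
  \<open>exp (- (u / a') * ln u)\<close>. Chernoff with parameter \<open>\<beta> * ln u\<close> and
  \<open>\<beta> = 1 / b\<close> gives \<open>exp (- (u / b) * ln u)\<close> for \<open>Y\<close>,
  up to a moment term with \<open>u powr (a / b)\<close>. Taking \<open>b\<close> between
  \<open>a\<close> and \<open>a'\<close> makes the second bound smaller and keeps the moment term of
  lower order than \<open>u\<close>.\<close>

lemma negligible:
  assumes \<epsilon>: "\<epsilon> > 0"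
  shows "eventually (\<lambda>u. measure (\<nu> 1) {u - v<..} \<le> \<epsilon> * measure (\<nu> 1 \<star> cpois l \<mu>) {u<..}) at_top"
proof -
  obtain a' where a': "a' > a" "measure \<mu> {a'<..} > 0" using larger_jump by blast
  define p where "p = measure \<mu> {a'<..}"
  define b where "b = (a + a') / 2"
  define \<delta> where "\<delta> = 1 / a'"
  define \<beta> where "\<beta> = 1 / b"
  define \<alpha> where "\<alpha> = \<beta> * a"
  define e where "e = \<beta> - \<delta>"
  define C where "C = B + 1"
  define K where "K = \<bar>ln (l * p)\<bar>"
  define c0 where "c0 = exp (- \<kappa>) * (1 - exp (- 1))"
  define x where "x u = \<delta> * (u + C) + 2" for u
  define E where "E u = (\<sigma>\<^sup>2 / 2) * (\<beta> * ln u)\<^sup>2 + g * (\<beta> * ln u) + V * (\<beta> * ln u)\<^sup>2 * u powr \<alpha> - \<beta> * ln u * (u - v)" for u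
  let ?y = "\<lambda>u. exp (- (x u * ln (x u)) - x u * K)"
  have p: "p > 0" using a' by (simp add: p_def)
  have b: "a < b" "b < a'" using a' by (auto simp: b_def)
  have pars: "0 < \<alpha>" "\<alpha> < 1" "0 < \<delta>" "0 < e" "\<beta> = \<delta> + e" "\<beta> > 0"
    using a a' b by (auto simp: \<alpha>_def \<delta>_def \<beta>_def e_def frac_less2)
  have c0: "c0 > 0" by (simp add: c0_def)
  have C: "C \<ge> 0" using B_nonneg by (simp add: C_def)
  have low: "c0 \<le> measure (\<nu> 1) {- C..}"
    using lower[of 1 1 C] C by (simp add: c0_def C_def)
  interpret Y: real_distribution "\<nu> 1" by (rule \<nu>) simp
  have T_ge: "c0 * exp (- l) * ?y u \<le> measure (\<nu> 1 \<star> cpois l \<mu>) {u<..}" if u: "u \<ge> 1" for u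
  proof -
    \<comment> \<open>Rounding up and adding \<open>1\<close> makes the jumps exceed
      \<open>u + C\<close> strictly; both together account for the \<open>2\<close> in
      \<open>x u\<close>.\<close>
    define n where "n = nat \<lceil>(u + C) / a'\<rceil> + 1"
    have "(u + C) / a' \<ge> 0" using u C a a' by simp
    then have n_le: "real n \<le> x u"
      unfolding n_def x_def \<delta>_def by (simp add: of_nat_nat) linarith
    have "(u + C) / a' < real n" unfolding n_def by linarith
    then have n_gt: "u - real n * a' < - C" using a a' by (simp add: field_simps)
    have n1: "n \<ge> 1" by (simp add: n_def)
    have "c0 \<le> measure (\<nu> 1) {u - real n * a'<..}"
      using low n_gt by (elim order_trans) (intro Y.finite_measure_mono, auto)
    then have "p ^ n * c0 \<le> p ^ n * measure (\<nu> 1) {u - real n * a'<..}"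
      using p by (intro mult_left_mono) auto
    also have "\<dots> \<le> measure (\<nu> 1 \<star> conv_pow \<mu> n) {u<..}"
    proof -
      have law: "real_distribution (\<nu> 1 \<star> conv_pow \<mu> n)"
        by (intro real_distribution_conv \<nu> real_distribution_conv_pow \<mu>) simp
      have "ennreal (p ^ n * measure (\<nu> 1) {u - real n * a'<..}) \<le> ennreal (measure (\<nu> 1 \<star> conv_pow \<mu> n) {u<..})"
        using tail_conv_pow_ge[of a' n u] p
        by (simp add: tail_eq_measure[OF law] tail_eq_measure[OF \<nu>] p_def ennreal_mult'[symmetric])
      then show ?thesis by simp
    qed
    finally have "pois l n * (p ^ n * c0) \<le> pois l n * measure (\<nu> 1 \<star> conv_pow \<mu> n) {u<..}"
      using l_pos by (intro mult_left_mono pois_nonneg) auto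
    also have "\<dots> \<le> measure (\<nu> 1 \<star> cpois l \<mu>) {u<..}" by (rule total_tail_ge)
    finally have T: "pois l n * (p ^ n * c0) \<le> measure (\<nu> 1 \<star> cpois l \<mu>) {u<..}" .
    have "?y u \<le> (l * p) ^ n / fact n"
    proof -
      have lp: "l * p > 0" using l_pos p by simp
      have "- (x u * K) \<le> real n * ln (l * p)"
      proof -
        have "- ln (l * p) * real n \<le> K * real n" by (intro mult_right_mono) (auto simp: K_def)
        also have "\<dots> \<le> K * x u" using n_le by (intro mult_left_mono) (auto simp: K_def)
        finally show ?thesis by (simp add: mult.commute)
      qed
      then have "exp (- (x u * K)) \<le> exp (real n * ln (l * p))" by simp
      also have "\<dots> = (l * p) ^ n" using lp by (simp add: exp_of_nat_mult)
      finally have 1: "exp (- (x u * K)) \<le> (l * p) ^ n" .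
      \<comment> \<open>The crude bound on the factorial suffices, since only the leading order
        \<open>u * ln u\<close> of the exponent matters.\<close>
      have "fact n \<le> real n ^ n" using fact_le_power[of n, where ?'a = real] by simp
      also have "\<dots> = exp (real n * ln (real n))" using n1 by (simp add: exp_of_nat_mult)
      also have "\<dots> \<le> exp (x u * ln (x u))"
        using n1 n_le by (simp, intro mult_mono) auto
      finally have 2: "fact n \<le> exp (x u * ln (x u))" .
      have "?y u = exp (- (x u * K)) / exp (x u * ln (x u))"
        unfolding exp_diff[symmetric] by simp
      also have "\<dots> \<le> (l * p) ^ n / fact n"
        using 1 2 lp by (intro frac_le) auto
      finally show ?thesis .
    qed
    then have "c0 * exp (- l) * ?y u \<le> c0 * exp (- l) * ((l * p) ^ n / fact n)"
      using c0 by (intro mult_left_mono) auto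
    also have "\<dots> = pois l n * (p ^ n * c0)" by (simp add: pois_def power_mult_distrib)
    finally show ?thesis using T by simp
  qed
  have lim: "((\<lambda>u. exp (E u + x u * ln (x u) + x u * K)) \<longlongrightarrow> 0) at_top"
    unfolding E_def x_def by (rule bounded_jumps_tail_negligible[OF pars(1-5)])
  have "eventually (\<lambda>u. exp (E u + x u * ln (x u) + x u * K) < \<epsilon> * (c0 * exp (- l))) at_top"
    using lim \<epsilon> c0 by (intro order_tendstoD) auto
  then show ?thesis
    using eventually_ge_at_top[of 1]
  proof eventually_elim
    case (elim u)
    have u: "u \<ge> 1" by fact
    have "measure (\<nu> 1) {u - v<..} \<le> exp (E u)"
    proof -
      have "exp (\<beta> * ln u * a) = u powr \<alpha>" using u by (simp add: powr_def \<alpha>_def mult_ac)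
      then show ?thesis
        using upper[of "\<beta> * ln u" "u - v"] u pars unfolding E_def by simp
    qed
    also have "exp (E u) = exp (E u + x u * ln (x u) + x u * K) * ?y u"
      by (simp flip: exp_add)
    also have "\<dots> \<le> \<epsilon> * (c0 * exp (- l)) * ?y u"
      using elim by (intro mult_right_mono) auto
    also have "\<dots> = \<epsilon> * (c0 * exp (- l) * ?y u)" by simp
    also have "\<dots> \<le> \<epsilon> * measure (\<nu> 1 \<star> cpois l \<mu>) {u<..}"
      using \<epsilon> T_ge[OF u] by (intro mult_left_mono) auto
    finally show ?case .
  qed
qed

lemma light_jumps:
  assumes "light_right_tail \<mu>"
  shows "light_jumps \<nu> (return borel g \<star> (Wt 1 \<star> Nt 1)) \<mu> \<sigma> l a \<kappa> B"
proof (rule light_jumps.intro)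
  have AE: "AE x in \<mu>. 0 \<le> x" using \<mu>_gt a by (auto elim!: eventually_mono)
  show "\<nu> 1 = (gauss \<sigma> \<star> (return borel g \<star> (Wt 1 \<star> Nt 1)))"
    using \<sigma> by (simp add: \<nu>_def Ut_def convolution_assoc real_distribution_conv
        real_distribution_gauss real_distribution_return Wt Nt)
  show "\<exists>v. \<forall>w>v. measure (conv_pow \<mu> n) {w<..} \<le> \<epsilon> * measure (conv_pow \<mu> (Suc n)) {w<..}" if "\<epsilon> > 0" for n \<epsilon>
    by (rule light_right_tail_conv_pow[OF \<mu> AE assms that])
  show "AE x in \<mu>. a \<le> x" using \<mu>_gt by (auto elim!: eventually_mono)
  show "real_distribution (return borel g \<star> (Wt 1 \<star> Nt 1))"
    by (intro real_distribution_conv real_distribution_return Wt Nt) simp_all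
qed (use \<nu> \<nu>_add \<sigma> \<mu> l_pos a \<kappa>_nonneg B_nonneg lower negligible in \<open>auto simp: \<nu>_def\<close>)

end

section \<open>Maxima of partial sums\<close>

text \<open>The largest of the partial sums of at most \<open>m\<close> terms starting at index
  \<open>j\<close>, the empty sum included. The first term is split off, exactly as in
  \<open>maxp\<close>, so the two recursions match.\<close>

primrec hmax :: "(nat \<Rightarrow> real) \<Rightarrow> nat \<Rightarrow> nat \<Rightarrow> real" where
  "hmax w j 0 = 0"
| "hmax w j (Suc m) = max 0 (w j + hmax w (Suc j) m)"

lemma less_hmax_iff: "u < x + hmax w j m \<longleftrightarrow> (\<exists>k\<le>m. u < x + (\<Sum>i<k. w (j + i)))"
proof (induction m arbitrary: j x)
  case (Suc m)
  have "u < x + hmax w j (Suc m) \<longleftrightarrow> u < x \<or> u < (x + w j) + hmax w (Suc j) m"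
    by (auto simp: max_def)
  also have "\<dots> \<longleftrightarrow> u < x \<or> (\<exists>k\<le>m. u < x + (\<Sum>i<Suc k. w (j + i)))"
    unfolding Suc.IH by (simp add: sum.lessThan_Suc_shift add.assoc del: sum.lessThan_Suc)
  also have "\<dots> \<longleftrightarrow> (\<exists>k\<le>Suc m. u < x + (\<Sum>i<k. w (j + i)))"
  proof -
    have "(\<exists>k\<le>Suc m. Q k) \<longleftrightarrow> Q 0 \<or> (\<exists>k\<le>m. Q (Suc k))" for Q
      by (metis Suc_le_mono not0_implies_Suc zero_le)
    from this[of "\<lambda>k. u < x + (\<Sum>i<k. w (j + i))"] show ?thesis by simp
  qed
  finally show ?case .
qed simp

lemma hmax_cong: "(\<And>i. j \<le> i \<Longrightarrow> i < j + m \<Longrightarrow> w i = w' i) \<Longrightarrow> hmax w j m = hmax w' j m"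
proof (induction m arbitrary: j)
  case (Suc m)
  have "hmax w (Suc j) m = hmax w' (Suc j) m" by (rule Suc.IH) (use Suc.prems in auto)
  then show ?case using Suc.prems[of j] by simp
qed simp

lemma measurable_hmax:
  "{j..<j + m} \<subseteq> I \<Longrightarrow> (\<lambda>w. hmax w j m) \<in> borel_measurable (PiM I (\<lambda>_. borel))"
proof (induction m arbitrary: j)
  case (Suc m)
  have [measurable]: "(\<lambda>w. hmax w (Suc j) m) \<in> borel_measurable (PiM I (\<lambda>_. borel))"
    by (rule Suc.IH) (use Suc.prems in auto)
  have [measurable]: "(\<lambda>w. w j) \<in> borel_measurable (PiM I (\<lambda>_. borel))"
    by (rule measurable_component_singleton) (use Suc.prems in auto)
  show ?case by simp
qed simp

text \<open>The first increment is independent of the maximum over the later ones, so one step of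
  the recursion is a convolution. The index \<open>j\<close> is arbitrary because the induction
  moves it forward.\<close>

lemma (in prob_space) emeasure_hmax_eq_maxp:
  assumes ind: "indep_vars (\<lambda>_. borel) D (UNIV :: nat set)" and law: "\<And>i. distr M borel (D i) = \<pi>"
  shows "emeasure M {\<omega> \<in> space M. u < x + hmax (\<lambda>i. D i \<omega>) j m} = maxp \<pi> u m x"
proof (induction m arbitrary: j x)
  case 0
  show ?case by (simp add: emeasure_space_1 indicator_def)
next
  case (Suc m)
  have D[measurable]: "D i \<in> borel_measurable M" for i
    using ind by (auto simp: indep_vars_def)
  have \<pi>: "real_distribution \<pi>" unfolding law[of 0, symmetric] by simp
  show ?case
  proof (cases "u < x")
    case True
    then have "{\<omega> \<in> space M. u < x + hmax (\<lambda>i. D i \<omega>) j (Suc m)} = space M" by auto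
    then show ?thesis using True by (simp add: emeasure_space_1)
  next
    case False
    let ?B = "{Suc j..<Suc j + m}"
    let ?H = "\<lambda>\<omega>. hmax (\<lambda>i. D i \<omega>) (Suc j) m"
    have "indep_var (PiM {j} (\<lambda>_. borel)) (\<lambda>\<omega>. restrict (\<lambda>i. D i \<omega>) {j})
        (PiM ?B (\<lambda>_. borel)) (\<lambda>\<omega>. restrict (\<lambda>i. D i \<omega>) ?B)"
      by (rule indep_var_restrict[OF ind]) auto
    then have "indep_var borel ((\<lambda>w. w j) \<circ> (\<lambda>\<omega>. restrict (\<lambda>i. D i \<omega>) {j}))
        borel ((\<lambda>w. hmax w (Suc j) m) \<circ> (\<lambda>\<omega>. restrict (\<lambda>i. D i \<omega>) ?B))"
      by (rule indep_var_compose) (auto intro: measurable_hmax)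
    moreover have "(\<lambda>w. hmax w (Suc j) m) \<circ> (\<lambda>\<omega>. restrict (\<lambda>i. D i \<omega>) ?B) = ?H"
      by (auto simp: fun_eq_iff intro!: hmax_cong)
    ultimately have indep: "indep_var borel (D j) borel ?H"
      by (simp add: comp_def)
    then have H[measurable]: "?H \<in> borel_measurable M" by (rule indep_var_rv2)
    have H_law: "real_distribution (distr M borel ?H)" by simp
    have "{\<omega> \<in> space M. u < x + hmax (\<lambda>i. D i \<omega>) j (Suc m)} = {\<omega> \<in> space M. u - x < D j \<omega> + ?H \<omega>}"
      using False by auto
    then have "emeasure M {\<omega> \<in> space M. u < x + hmax (\<lambda>i. D i \<omega>) j (Suc m)}
        = emeasure (distr M borel (\<lambda>\<omega>. D j \<omega> + ?H \<omega>)) {u - x<..}"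
      by (subst emeasure_distr) (auto intro!: arg_cong[where f = "emeasure M"])
    also have "\<dots> = tail (\<pi> \<star> distr M borel ?H) (u - x)"
      by (subst sum_indep_random_variable[OF indep]) (auto simp: law tail_def)
    also have "\<dots> = (\<integral>\<^sup>+y. tail (distr M borel ?H) (u - x - y) \<partial>\<pi>)"
      by (simp add: convolution_commute[OF \<pi> H_law] tail_convolution[OF H_law \<pi>])
    also have "\<dots> = (\<integral>\<^sup>+y. maxp \<pi> u m (x + y) \<partial>\<pi>)"
    proof (rule nn_integral_cong)
      fix y
      have "tail (distr M borel ?H) (u - x - y) = emeasure M {\<omega> \<in> space M. u < (x + y) + ?H \<omega>}"
        unfolding tail_def by (subst emeasure_distr) (auto intro!: arg_cong[where f = "emeasure M"])
      then show "tail (distr M borel ?H) (u - x - y) = maxp \<pi> u m (x + y)"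
        unfolding Suc.IH .
    qed
    finally show ?thesis using False by simp
  qed
qed

section \<open>Suprema of cadlag paths through dyadic times\<close>

lemma cadlag_bdd_above:
  assumes f: "cadlag_on_nonneg f"
  shows "bdd_above (f ` {0..1})"
proof -
  \<comment> \<open>Bisection reduces the claim to local boundedness, given by the right limit, the
    value and the left limit. The intersection with \<open>{0..}\<close> is kept because
    neighbourhoods of \<open>0\<close> contain negative times, where nothing is known of
    \<open>f\<close>.\<close>
  have "bdd_above (f ` ({0..1} \<inter> {0..}))"
  proof (rule Bolzano[of 0 1 "\<lambda>c d. bdd_above (f ` ({c..d} \<inter> {0..}))"])
    fix c d e :: real assume *: "bdd_above (f ` ({c..d} \<inter> {0..}))" "bdd_above (f ` ({d..e} \<inter> {0..}))"
    have "f ` ({c..e} \<inter> {0..}) \<subseteq> f ` ({c..d} \<inter> {0..}) \<union> f ` ({d..e} \<inter> {0..})"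
      unfolding image_Un[symmetric] by (intro image_mono) auto
    then show "bdd_above (f ` ({c..e} \<inter> {0..}))" using * by (meson bdd_above_Un bdd_above_mono)
  next
    fix t :: real assume t: "0 \<le> t" "t \<le> 1"
    have "(f \<longlongrightarrow> f t) (at_right t)" using f t by (simp add: cadlag_on_nonneg_def)
    then have "eventually (\<lambda>s. f s < f t + 1) (at_right t)" by (intro order_tendstoD) auto
    then obtain d1 where d1: "d1 > t" "\<And>s. t < s \<Longrightarrow> s < d1 \<Longrightarrow> f s < f t + 1"
      unfolding eventually_at_right_field by blast
    obtain l d2 where d2: "d2 < t" "\<And>s. d2 < s \<Longrightarrow> s < t \<Longrightarrow> 0 \<le> s \<Longrightarrow> f s < l"
    proof (cases "t > 0")
      case True
      with f t have "\<exists>l. (f \<longlongrightarrow> l) (at_left t)" unfolding cadlag_on_nonneg_def by blast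
      then obtain l where "(f \<longlongrightarrow> l) (at_left t)" by blast
      then have "eventually (\<lambda>s. f s < l + 1) (at_left t)" by (intro order_tendstoD) auto
      then obtain d2 where "d2 < t" "\<And>s. d2 < s \<Longrightarrow> s < t \<Longrightarrow> f s < l + 1"
        unfolding eventually_at_left_field by blast
      then show ?thesis by (intro that) auto
    next
      case False
      then show ?thesis by (intro that[of "t - 1" 0]) auto
    qed
    show "\<exists>d>0. \<forall>a b. a \<le> t \<and> t \<le> b \<and> b - a < d \<longrightarrow> bdd_above (f ` ({a..b} \<inter> {0..}))"
    proof (intro exI[of _ "min (d1 - t) (t - d2)"] conjI allI impI)
      fix a b assume ab: "a \<le> t \<and> t \<le> b \<and> b - a < min (d1 - t) (t - d2)"
      have "f s \<le> max (f t + 1) l" if "s \<in> {a..b} \<inter> {0..}" for s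
        using that ab d1(2)[of s] d2(2)[of s] by (cases s t rule: linorder_cases) auto
      then show "bdd_above (f ` ({a..b} \<inter> {0..}))" by (intro bdd_aboveI[of _ "max (f t + 1) l"]) auto
    qed (use d1 d2 in auto)
  qed auto
  moreover have "{0..1} \<inter> {0..} = {0..1::real}" by auto
  ultimately show ?thesis by simp
qed

text \<open>By right continuity an exceedance at \<open>t < 1\<close> persists at a dyadic time just
  after \<open>t\<close>. Dyadic grids are nested, so the corresponding events increase.\<close>

lemma cadlag_less_Sup_iff:
  assumes f: "cadlag_on_nonneg f"
  shows "u < Sup (f ` {0..1}) \<longleftrightarrow> (\<exists>j k. k \<le> (2::nat) ^ j \<and> u < f (real k / 2 ^ j))"
proof -
  have "u < Sup (f ` {0..1}) \<longleftrightarrow> (\<exists>t\<in>{0..1}. u < f t)"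
    using cadlag_bdd_above[OF f] by (subst less_cSup_iff) auto
  also have "\<dots> \<longleftrightarrow> (\<exists>j k. k \<le> (2::nat) ^ j \<and> u < f (real k / 2 ^ j))"
  proof safe
    fix t assume t: "t \<in> {0..1}" and u: "u < f t"
    show "\<exists>j k. k \<le> (2::nat) ^ j \<and> u < f (real k / 2 ^ j)"
    \<comment> \<open>No time to the right of \<open>1\<close> is available, but \<open>1\<close> is
      itself dyadic.\<close>
    proof (cases "t = 1")
      case True
      then show ?thesis using u by (intro exI[of _ 0] exI[of _ 1]) auto
    next
      case False
      then have t: "0 \<le> t" "t < 1" using t by auto
      have "(f \<longlongrightarrow> f t) (at_right t)" using f t by (simp add: cadlag_on_nonneg_def)
      then have "eventually (\<lambda>s. u < f s) (at_right t)" using u by (intro order_tendstoD) auto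
      then obtain d where d: "d > t" "\<And>s. t < s \<Longrightarrow> s < d \<Longrightarrow> u < f s"
        unfolding eventually_at_right_field by blast
      define e where "e = min (d - t) (1 - t)"
      have e: "e > 0" using d t by (simp add: e_def)
      obtain j where j: "(1 / 2 :: real) ^ j < e" using real_arch_pow_inv[OF e, of "1/2"] by auto
      define k where "k = nat \<lfloor>t * 2 ^ j\<rfloor> + 1"
      have fl: "0 \<le> t * 2 ^ j" using t by simp
      have k1: "t * 2 ^ j < real k" unfolding k_def using fl by linarith
      have k2: "real k \<le> t * 2 ^ j + 1" unfolding k_def using fl by linarith
      have lo: "t < real k / 2 ^ j" using k1 by (simp add: field_simps)
      have "real k / 2 ^ j \<le> t + (1 / 2) ^ j" using k2 by (simp add: field_simps power_divide)
      also have "\<dots> < t + e" using j by simp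
      finally have hi: "real k / 2 ^ j < t + e" .
      have "t + e \<le> 1" by (simp add: e_def)
      with hi have "real k / 2 ^ j < 1" by linarith
      then have "real k < 2 ^ j" by (simp add: divide_less_eq)
      then have "k \<le> 2 ^ j" by simp
      moreover have "u < f (real k / 2 ^ j)" using lo hi by (intro d) (auto simp: e_def)
      ultimately show ?thesis by blast
    qed
  next
    fix j k :: nat assume k: "k \<le> 2 ^ j" and u: "u < f (real k / 2 ^ j)"
    have "real k \<le> real (2 ^ j)" using k by (simp only: of_nat_le_iff)
    then have "real k / 2 ^ j \<in> {0..1}" by (simp add: field_simps)
    then show "\<exists>t\<in>{0..1}. u < f t" using u by blast
  qed
  finally show ?thesis .
qed


section \<open>Grid maxima of the Levy process and the limit\<close>

lemma levy_process_increments: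
  assumes X: "levy_process M X \<gamma> \<sigma> \<rho>" and h: "h \<ge> 0"
  shows "prob_space.indep_vars M (\<lambda>_. borel) (\<lambda>i \<omega>. X (real (Suc i) * h) \<omega> - X (real i * h) \<omega>) UNIV"
    and "distr M borel (\<lambda>\<omega>. X (real (Suc i) * h) \<omega> - X (real i * h) \<omega>) = distr M borel (X h)"
proof -
  have indep: "\<forall>\<tau>::nat \<Rightarrow> real. 0 \<le> \<tau> 0 \<and> incseq \<tau> \<longrightarrow>
        prob_space.indep_vars M (\<lambda>_. borel) (\<lambda>i \<omega>. X (\<tau> (Suc i)) \<omega> - X (\<tau> i) \<omega>) UNIV"
    using X unfolding levy_process_def by (elim conjE)
  have stat: "\<forall>s t. 0 \<le> s \<and> s \<le> t \<longrightarrow>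
        distr M borel (\<lambda>\<omega>. X t \<omega> - X s \<omega>) = distr M borel (X (t - s))"
    using X unfolding levy_process_def by (elim conjE)
  show "prob_space.indep_vars M (\<lambda>_. borel) (\<lambda>i \<omega>. X (real (Suc i) * h) \<omega> - X (real i * h) \<omega>) UNIV"
    using h by (intro indep[rule_format, of "\<lambda>i. real i * h"]) (auto simp: incseq_def intro: mult_right_mono)
  have "distr M borel (\<lambda>\<omega>. X (real (Suc i) * h) \<omega> - X (real i * h) \<omega>) = distr M borel (X (real (Suc i) * h - real i * h))"
    using h by (intro stat[rule_format]) (auto intro: mult_right_mono)
  then show "distr M borel (\<lambda>\<omega>. X (real (Suc i) * h) \<omega> - X (real i * h) \<omega>) = distr M borel (X h)"
    by (simp add: algebra_simps)
qed

lemma levy_process_grid_max: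
  assumes X: "levy_process M X \<gamma> \<sigma> \<rho>" and h: "h \<ge> 0"
  shows "emeasure M {\<omega> \<in> space M. \<exists>k\<le>m. u < X (real k * h) \<omega>} = maxp (distr M borel (X h)) u m 0"
proof -
  interpret prob_space M using X by (simp add: levy_process_def)
  let ?D = "\<lambda>i \<omega>. X (real (Suc i) * h) \<omega> - X (real i * h) \<omega>"
  have "(\<Sum>i<k. ?D (0 + i) \<omega>) = X (real k * h) \<omega>" if "\<omega> \<in> space M" for k \<omega>
    using that X by (simp add: sum_lessThan_telescope[where f = "\<lambda>i. X (real i * h) \<omega>"] levy_process_def
        del: of_nat_Suc)
  then have "{\<omega> \<in> space M. \<exists>k\<le>m. u < X (real k * h) \<omega>} = {\<omega> \<in> space M. u < 0 + hmax (\<lambda>i. ?D i \<omega>) 0 m}"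
    unfolding less_hmax_iff by (intro Collect_cong conj_cong refl) (simp del: of_nat_Suc)
  also have "emeasure M \<dots> = maxp (distr M borel (X h)) u m 0"
    by (intro emeasure_hmax_eq_maxp levy_process_increments[OF X h])
  finally show ?thesis .
qed

theorem theorem1:
  fixes M :: "'a measure" and X :: "real \<Rightarrow> 'a \<Rightarrow> real"
    and \<gamma> \<sigma> :: real and \<rho> :: "real measure"
  assumes "levy_process M X \<gamma> \<sigma> \<rho>"
    and "\<sigma> > 0"
    and "emeasure \<rho> {0<..} > 0"
    and "emeasure \<rho> {..<0} < \<infinity>"
    and "\<exists>a>0. emeasure \<rho> {a<..} > 0 \<and> light_right_tail (levy_tail_measure \<rho> a)"
  shows "((\<lambda>u. measure M {\<omega> \<in> space M. Sup ((\<lambda>t. X t \<omega>) ` {0..1}) > u}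
               / measure M {\<omega> \<in> space M. X 1 \<omega> > u}) \<longlongrightarrow> 1) at_top"
proof -
  note X = assms(1)
  obtain a where a: "a > 0" "emeasure \<rho> {a<..} > 0" and light: "light_right_tail (levy_tail_measure \<rho> a)"
    using assms(5) by blast
  interpret prob_space M using X by (simp add: levy_process_def)
  interpret L: levy_triplet \<gamma> \<sigma> a \<rho>
    using X assms(2,4) a by unfold_locales (auto simp: levy_process_def)
  interpret J: light_jumps L.\<nu> "return borel L.g \<star> (L.Wt 1 \<star> L.Nt 1)" L.\<mu> \<sigma> L.l a L.\<kappa> L.B
    using light by (intro L.light_jumps) (simp add: L.\<mu>_def)
  have meas [measurable]: "X t \<in> borel_measurable M" if "t \<ge> 0" for t
    using X that by (simp add: levy_process_def)
  \<comment> \<open>Here the abstract laws meet the process: equal characteristic functions identify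
    each one-dimensional law, and grid maxima depend on nothing else.\<close>
  have law: "distr M borel (X t) = (L.\<nu> t \<star> cpois (L.l * t) L.\<mu>)" if t: "t > 0" for t
  proof (rule Levy_uniqueness)
    show "real_distribution (distr M borel (X t))" using t by simp
    show "real_distribution (L.\<nu> t \<star> cpois (L.l * t) L.\<mu>)"
      using t by (intro real_distribution_conv L.\<nu> real_distribution_cpois L.\<mu>) simp
    show "char (distr M borel (X t)) = char (L.\<nu> t \<star> cpois (L.l * t) L.\<mu>)"
      using X t by (auto simp: levy_process_def L.char_total fun_eq_iff)
  qed
  define S where "S u = measure M {\<omega> \<in> space M. Sup ((\<lambda>t. X t \<omega>) ` {0..1}) > u}" for u
  have T_eq: "measure M {\<omega> \<in> space M. X 1 \<omega> > u} = J.T u" for u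
  proof -
    have "measure M {\<omega> \<in> space M. X 1 \<omega> > u} = measure (distr M borel (X 1)) {u<..}"
      by (subst measure_distr) (auto intro!: arg_cong[where f = "measure M"])
    then show ?thesis by (simp add: law J.T_def)
  qed
  define G where "G u m = {\<omega> \<in> space M. \<exists>k\<le>m. u < X (real k * (1 / real m)) \<omega>}" for u and m :: nat
  have G_meas [measurable]: "G u m \<in> sets M" for u m
  proof -
    have "G u m = (\<Union>k\<in>{..m}. {\<omega> \<in> space M. u < X (real k * (1 / real m)) \<omega>})" by (auto simp: G_def)
    also have "\<dots> \<in> sets M" by (intro sets.finite_UN) auto
    finally show ?thesis .
  qed
  have S_event: "{\<omega> \<in> space M. Sup ((\<lambda>t. X t \<omega>) ` {0..1}) > u} = (\<Union>j. G u (2 ^ j))" for u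
  proof -
    have "Sup ((\<lambda>t. X t \<omega>) ` {0..1}) > u \<longleftrightarrow> (\<exists>j k. k \<le> (2::nat) ^ j \<and> u < X (real k / 2 ^ j) \<omega>)"
      if "\<omega> \<in> space M" for \<omega>
      using that X by (intro cadlag_less_Sup_iff) (simp add: levy_process_def)
    then show ?thesis by (auto simp: G_def)
  qed
  have G_inc: "incseq (\<lambda>j. G u (2 ^ j))" for u
  proof (rule incseq_SucI, safe)
    fix j \<omega> assume "\<omega> \<in> G u (2 ^ j)"
    then obtain k where k: "\<omega> \<in> space M" "k \<le> 2 ^ j" "u < X (real k * (1 / real (2 ^ j))) \<omega>"
      by (auto simp: G_def)
    have "real k * (1 / real (2 ^ j)) = real (2 * k) * (1 / real (2 ^ Suc j))" by simp
    with k show "\<omega> \<in> G u (2 ^ Suc j)" unfolding G_def by (intro CollectI conjI exI[of _ "2 * k"]) auto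
  qed
  have G_lim: "(\<lambda>j. measure M (G u (2 ^ j))) \<longlonglongrightarrow> S u" for u
    unfolding S_def S_event by (intro finite_Lim_measure_incseq G_inc) auto
  have lower: "J.T u \<le> S u" for u
    unfolding S_def S_event T_eq[symmetric]
  proof (rule finite_measure_mono)
    have "{\<omega> \<in> space M. u < X 1 \<omega>} \<subseteq> G u (2 ^ 0)"
      by (auto simp: G_def intro!: exI[of _ 1])
    then show "{\<omega> \<in> space M. u < X 1 \<omega>} \<subseteq> (\<Union>j. G u (2 ^ j))" by blast
  qed auto
  \<comment> \<open>The grid is refined with \<open>u\<close> held fixed, so the threshold
    \<open>m0\<close> may depend on \<open>u\<close>; the bound then passes to the supremum.\<close>
  have upper: "eventually (\<lambda>u. S u \<le> (1 + \<eta>) * J.T u) at_top" if \<eta>: "\<eta> > 0" for \<eta>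
    using J.maxp_le_tail[OF \<eta>]
  proof eventually_elim
    case (elim u)
    then obtain m0 where m0: "\<And>m. m \<ge> m0 \<Longrightarrow>
        maxp (L.\<nu> (1 / real m) \<star> cpois (L.l / real m) L.\<mu>) u m 0 \<le> ennreal ((1 + \<eta>) * J.T u)" by blast
    have "measure M (G u (2 ^ j)) \<le> (1 + \<eta>) * J.T u" if j: "j \<ge> m0" for j
    proof -
      have "m0 \<le> 2 ^ j" using j less_exp[of j] by linarith
      have "ennreal (measure M (G u (2 ^ j))) = maxp (distr M borel (X (1 / real (2 ^ j)))) u (2 ^ j) 0"
        unfolding G_def emeasure_eq_measure[symmetric] by (rule levy_process_grid_max[OF X]) simp
      also have "\<dots> \<le> ennreal ((1 + \<eta>) * J.T u)"
        using m0[OF \<open>m0 \<le> 2 ^ j\<close>] by (subst law) auto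
      finally show ?thesis using \<eta> J.T_nonneg[of u] by (subst (asm) ennreal_le_iff) auto
    qed
    then show ?case by (intro LIMSEQ_le_const2[OF G_lim]) auto
  qed
  show ?thesis
    unfolding S_def[symmetric] T_eq
  proof (rule order_tendstoI)
    fix y :: real assume "y < 1"
    show "eventually (\<lambda>u. y < S u / J.T u) at_top"
    proof (intro always_eventually allI)
      fix u
      \<comment> \<open>The lower bound holds for every \<open>u\<close>, since time
        \<open>1\<close> belongs to the interval.\<close>
      have "1 \<le> S u / J.T u" using lower[of u] J.T_pos[of u] by simp
      with \<open>y < 1\<close> show "y < S u / J.T u" by linarith
    qed
  next
    fix y :: real assume "1 < y"
    then have "eventually (\<lambda>u. S u \<le> (1 + (y - 1) / 2) * J.T u) at_top" by (intro upper) simp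
    then show "eventually (\<lambda>u. S u / J.T u < y) at_top"
    proof eventually_elim
      case (elim u)
      have "S u / J.T u \<le> 1 + (y - 1) / 2" using elim J.T_pos[of u] by (simp add: divide_le_eq)
      also have "\<dots> < y" using \<open>1 < y\<close> by (simp add: field_simps)
      finally show ?case .
    qed
  qed
qed

end
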